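(* Let $\mathbb K$ be a field of characteristic zero and let $E$ be the elliptic curve $y^2=4x^3-ux-v$ over $\mathbb K$. Consider on the trivial bundle with fiber $\mathbb L_{\mathbb K}(\mathsf S,\mathsf T)^\wedge$ over $E'=E-\{\mathrm{id}\}$ the elliptic KZB connection $\nabla=d+\nu_1^{\mathrm{alg}}$ and the naive connection $\nabla'=d+\nu_1^{\mathrm{naive}}$, where $$\nu_1^{\mathrm{alg}}=-\frac{x\,dx}{y}\mathsf T+\frac{dx}{y}\mathsf S+\sum_{n\ge2}q_n(x,y)\frac{dx}{y}\,\mathsf T^n\cdot\mathsf S,\qquad\nu_1^{\mathrm{naive}}=-\frac{x\,dx}{y}\mathsf T+\frac{dx}{y}\mathsf S.$$ Then over no (nonempty) Zariski open subset of $E_{/\mathbb K}$ is there an algebraic gauge transformation between $\nabla$ and $\nabla'$ that preserves the group structure on the fiber $\mathbb L_{\mathbb K}(\mathsf S,\mathsf T)^\wedge$; that is, there is no rational map $g:E\dashrightarrow\exp\mathbb L_{\mathbb K}(\mathsf S,\mathsf T)^\wedge$ (with coefficients in the function field $\mathbb K(E)$) such that $$\nu_1^{\mathrm{alg}}=-dg\cdot g^{-1}+g\,\nu_1^{\mathrm{naive}}\,g^{-1}.$$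
   Context: Here $u,v\in\mathbb K$, $u^3-27v^2\neq0$, and $\mathrm{id}$ is the point at infinity. $\mathbb L_{\mathbb K}(\mathsf S,\mathsf T)^\wedge$ is the completed free Lie algebra over $\mathbb K$ on $\mathsf S,\mathsf T$ (a group via the Baker–Campbell–Hausdorff formula, isomorphic to $\exp\mathbb L_{\mathbb K}(\mathsf S,\mathsf T)^\wedge$, the group-like power series in noncommuting $\mathsf S,\mathsf T$); $\mathsf T^n\cdot\mathsf S:=\mathrm{ad}_{\mathsf T}^n(\mathsf S)$; Lie algebra elements act on the fiber by the adjoint action. A gauge transformation preserving the group structure means one with values in the subgroup $\exp\mathbb L(\mathsf S,\mathsf T)^\wedge\subset\mathrm{Aut}\,\mathbb L(\mathsf S,\mathsf T)^\wedge$ acting on the fiber by conjugation. Definition of $q_n$: for $\tau$ in the upper half plane and $\xi\in\mathbb C$ let $E_k(\xi,\tau)=\sum_{n,m}(\xi+n\tau+m)^{-k}$, $e_k(\tau)=\sum_{(n,m)\ne(0,0)}(n\tau+m)^{-k}$ for $k\ge2$ (Eisenstein summation for $k=2$: for each $n$ sum symmetrically over $m$ first, then symmetrically over $n$; $e_k=0$ for odd $k$), $P_k(\xi,\tau)=(2\pi i)^{-k}(E_k-e_k)$, and $G_k=\frac12\frac{(k-1)!}{(2\pi i)^k}e_k$ for even $k$. For $k\ge2$ there is a polynomial $P_k(x,y,u,v)\in\mathbb Q[x,y,u,v]$, unique modulo $y^2-4x^3+ux+v$, which equals $P_k(\xi,\tau)$ upon substituting $x=P_2(\xi,\tau)$,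 $y=-2P_3(\xi,\tau)$, $u=20G_4(\tau)$, $v=\frac73G_6(\tau)$; for the given $u,v\in\mathbb K$ it gives $P_k(x,y)\in\mathcal O(E')=\mathbb K[x,y]/(y^2-4x^3+ux+v)$. Then $q_n\in\mathcal O(E')$ is defined by $1+\sum_{n\ge2}q_n(x,y)T^n=\exp\left(-\sum_{k\ge2}\frac{(-T)^k}kP_k(x,y)\right)$; e.g. $q_2=-\frac12x$, $q_3=-\frac16y$, $q_4=\frac u{40}-\frac{x^2}8$. *)

theory Defs
  imports "HOL-Analysis.Analysis" "HOL-Computational_Algebra.Computational_Algebra"
begin

section \<open>Power series in the noncommuting variables S and T\<close>

datatype letter = LS | LT

typedef 'a ncseries = "UNIV :: (letter list \<Rightarrow> 'a) set"
  morphisms nc_coeff Abs_nc ..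

setup_lifting type_definition_ncseries

lemma ncseries_eqI: "(\<And>w. nc_coeff f w = nc_coeff g w) \<Longrightarrow> f = g"
  by transfer auto

instantiation ncseries :: (comm_ring_1) ring_1
begin

lift_definition zero_ncseries :: "'a ncseries" is "\<lambda>w. 0" .
lift_definition one_ncseries :: "'a ncseries" is "\<lambda>w. if w = [] then 1 else 0" .
lift_definition plus_ncseries :: "'a ncseries \<Rightarrow> 'a ncseries \<Rightarrow> 'a ncseries"
  is "\<lambda>f g w. f w + g w" .
lift_definition minus_ncseries :: "'a ncseries \<Rightarrow> 'a ncseries \<Rightarrow> 'a ncseries"
  is "\<lambda>f g w. f w - g w" .
lift_definition uminus_ncseries :: "'a ncseries \<Rightarrow> 'a ncseries"
  is "\<lambda>f w. - f w" .
lift_definition times_ncseries :: "'a ncseries \<Rightarrow> 'a ncseries \<Rightarrow> 'a ncseries"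
  is "\<lambda>f g w. \<Sum>i=0..length w. f (take i w) * g (drop i w)" .

instance
proof
  fix a b c :: "'a ncseries"
  show "a * b * c = a * (b * c)"
  proof transfer
    fix a b c :: "letter list \<Rightarrow> 'a"
    have "(\<Sum>i=0..length w. (\<Sum>j=0..length (take i w).
              a (take j (take i w)) * b (drop j (take i w))) * c (drop i w)) =
          (\<Sum>i=0..length w. a (take i w) *
              (\<Sum>j=0..length (drop i w). b (take j (drop i w)) * c (drop j (drop i w))))" for w
    proof -
      let ?f = "\<lambda>j k m. a (take j w) * b (take k (drop j w)) * c (drop (length w - m) w)"
      have "(\<Sum>i=0..length w. (\<Sum>j=0..length (take i w).
              a (take j (take i w)) * b (drop j (take i w))) * c (drop i w)) =
            (\<Sum>i=0..length w. \<Sum>j=0..i. ?f j (i - j) (length w - i))"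
        by (intro sum.cong refl)
           (auto simp: sum_distrib_right min_def drop_take intro!: sum.cong)
      also have "\<dots> = (\<Sum>j=0..length w. \<Sum>i=0..length w - j. ?f j i (length w - j - i))"
        by (rule fps_mult_assoc_lemma)
      also have "\<dots> = (\<Sum>i=0..length w. a (take i w) *
              (\<Sum>j=0..length (drop i w). b (take j (drop i w)) * c (drop j (drop i w))))"
        by (intro sum.cong refl) (auto simp: sum_distrib_left mult.assoc add.commute intro!: sum.cong)
      finally show ?thesis .
    qed
    then show "(\<lambda>w. \<Sum>i=0..length w. (\<Sum>j=0..length (take i w).
              a (take j (take i w)) * b (drop j (take i w))) * c (drop i w)) =
          (\<lambda>w. \<Sum>i=0..length w. a (take i w) *
              (\<Sum>j=0..length (drop i w). b (take j (drop i w)) * c (drop j (drop i w))))"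
      by blast
  qed
  show "1 * a = a"
  proof transfer
    fix a :: "letter list \<Rightarrow> 'a"
    have "(\<Sum>i=0..length w. (if take i w = [] then 1 else 0) * a (drop i w)) =
          (\<Sum>i=0..length w. if i = 0 then a w else 0)" for w
      by (intro sum.cong) auto
    then show "(\<lambda>w. \<Sum>i=0..length w. (if take i w = [] then 1 else 0) * a (drop i w)) = a"
      by simp
  qed
  show "a * 1 = a"
  proof transfer
    fix a :: "letter list \<Rightarrow> 'a"
    have "(\<Sum>i=0..length w. a (take i w) * (if drop i w = [] then 1 else 0)) =
          (\<Sum>i=0..length w. if i = length w then a w else 0)" for w
      by (intro sum.cong) auto
    then show "(\<lambda>w. \<Sum>i=0..length w. a (take i w) * (if drop i w = [] then 1 else 0)) = a"
      by simp
  qed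
  show "a + b + c = a + (b + c)" "a + b = b + a" "0 + a = a" "- a + a = 0" "a - b = a + - b"
    by (transfer; simp add: add_ac)+
  show "(a + b) * c = a * c + b * c" "a * (b + c) = a * b + a * c"
    by (transfer; simp add: distrib_left distrib_right sum.distrib)+
  show "(0::'a ncseries) \<noteq> 1"
    by transfer (auto simp: fun_eq_iff)
qed

end

lift_definition nc_map :: "('a \<Rightarrow> 'b) \<Rightarrow> 'a ncseries \<Rightarrow> 'b ncseries" is "\<lambda>D f w. D (f w)" .

definition nc_scale :: "'a::comm_ring_1 \<Rightarrow> 'a ncseries \<Rightarrow> 'a ncseries" where
  "nc_scale c = nc_map (\<lambda>a. c * a)"

definition nc_S :: "'a::comm_ring_1 ncseries" where
  "nc_S = Abs_nc (\<lambda>w. if w = [LS] then 1 else 0)"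

definition nc_T :: "'a::comm_ring_1 ncseries" where
  "nc_T = Abs_nc (\<lambda>w. if w = [LT] then 1 else 0)"

definition nc_inverse :: "'a::comm_ring_1 ncseries \<Rightarrow> 'a ncseries" where
  "nc_inverse g = (THE h. g * h = 1 \<and> h * g = 1)"

definition nc_ad :: "'a::comm_ring_1 ncseries \<Rightarrow> 'a ncseries \<Rightarrow> 'a ncseries" where
  "nc_ad f g = f * g - g * f"

definition nc_homogeneous_part :: "nat \<Rightarrow> 'a::comm_ring_1 ncseries \<Rightarrow> 'a ncseries" where
  "nc_homogeneous_part n f = Abs_nc (\<lambda>w. if length w = n then nc_coeff f w else 0)"

text \<open>The free Lie algebra on S and T over a subfield L of the type 'a, as the Lie
  subalgebra of the free associative algebra generated by S and T, and its completion with
  respect to the grading by word length.\<close>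

inductive_set free_lie :: "'a::comm_ring_1 set \<Rightarrow> 'a ncseries set" for L where
  S: "nc_S \<in> free_lie L"
| T: "nc_T \<in> free_lie L"
| add: "f \<in> free_lie L \<Longrightarrow> g \<in> free_lie L \<Longrightarrow> f + g \<in> free_lie L"
| scale: "c \<in> L \<Longrightarrow> f \<in> free_lie L \<Longrightarrow> nc_scale c f \<in> free_lie L"
| bracket: "f \<in> free_lie L \<Longrightarrow> g \<in> free_lie L \<Longrightarrow> nc_ad f g \<in> free_lie L"

definition completed_free_lie :: "'a::comm_ring_1 set \<Rightarrow> 'a ncseries set" where
  "completed_free_lie L = {f. \<forall>n. nc_homogeneous_part n f \<in> free_lie L}"

text \<open>Only meant for series without constant term; then the n-th power has no coefficients at
  words shorter than n, so that truncating the exponential series at the length of the word is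
  harmless.\<close>

definition nc_exp :: "'a::field_char_0 ncseries \<Rightarrow> 'a ncseries" where
  "nc_exp f = Abs_nc (\<lambda>w. \<Sum>n\<le>length w. nc_coeff (f ^ n) w / fact n)"

definition exp_completed_free_lie :: "'a::field_char_0 set \<Rightarrow> 'a ncseries set" where
  "exp_completed_free_lie L = nc_exp ` completed_free_lie L"


section \<open>The polynomials P and q\<close>

text \<open>Eisenstein summation for k = 2, absolutely convergent summation for k > 2.\<close>

definition lattice_sum :: "nat \<Rightarrow> (int \<Rightarrow> int \<Rightarrow> complex) \<Rightarrow> complex" where
  "lattice_sum k f =
    (if k = 2
     then lim (\<lambda>N. \<Sum>n\<in>{-int N..int N}. lim (\<lambda>M. \<Sum>m\<in>{-int M..int M}. f n m))
     else infsum (\<lambda>(n, m). f n m) UNIV)"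

definition eisenstein_E :: "nat \<Rightarrow> complex \<Rightarrow> complex \<Rightarrow> complex" where
  "eisenstein_E k \<xi> \<tau> = lattice_sum k (\<lambda>n m. 1 / (\<xi> + of_int n * \<tau> + of_int m) ^ k)"

definition eisenstein_e :: "nat \<Rightarrow> complex \<Rightarrow> complex" where
  "eisenstein_e k \<tau> =
    lattice_sum k (\<lambda>n m. if (n, m) = (0, 0) then 0 else 1 / (of_int n * \<tau> + of_int m) ^ k)"

definition P_fun :: "nat \<Rightarrow> complex \<Rightarrow> complex \<Rightarrow> complex" where
  "P_fun k \<xi> \<tau> = (eisenstein_E k \<xi> \<tau> - eisenstein_e k \<tau>) / (2 * complex_of_real pi * \<i>) ^ k"

definition G_fun :: "nat \<Rightarrow> complex \<Rightarrow> complex" where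
  "G_fun k \<tau> = 1 / 2 * fact (k - 1) / (2 * complex_of_real pi * \<i>) ^ k * eisenstein_e k \<tau>"

text \<open>Elements of Q[x,y,u,v] are represented as elements of Q[v][u][y][x].\<close>

type_synonym rat_poly4 = "rat poly poly poly poly"

definition eval4 :: "rat_poly4 \<Rightarrow> 'a::field_char_0 \<Rightarrow> 'a \<Rightarrow> 'a \<Rightarrow> 'a \<Rightarrow> 'a" where
  "eval4 p x y u v =
    poly (map_poly (\<lambda>p\<^sub>3. poly (map_poly (\<lambda>p\<^sub>2. poly (map_poly (\<lambda>p\<^sub>1.
      poly (map_poly of_rat p\<^sub>1) v) p\<^sub>2) u) p\<^sub>3) y) p) x"

text \<open>The polynomial is unique only modulo y^2 - 4x^3 + ux + v, but its values at points of the
  curve do not depend on the choice.\<close>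

definition P_poly :: "nat \<Rightarrow> rat_poly4" where
  "P_poly k = (SOME p. \<forall>\<tau> \<xi>. Im \<tau> > 0 \<longrightarrow> (\<forall>n m :: int. \<xi> \<noteq> of_int n * \<tau> + of_int m) \<longrightarrow>
      eval4 p (P_fun 2 \<xi> \<tau>) (- 2 * P_fun 3 \<xi> \<tau>) (20 * G_fun 4 \<tau>) (7 / 3 * G_fun 6 \<tau>)
        = P_fun k \<xi> \<tau>)"

definition q_coeff :: "nat \<Rightarrow> 'a::field_char_0 \<Rightarrow> 'a \<Rightarrow> 'a \<Rightarrow> 'a \<Rightarrow> 'a" where
  "q_coeff n x y u v = fps_nth (fps_compose (fps_exp 1)
      (- Abs_fps (\<lambda>k. if k \<ge> 2 then (- 1) ^ k / of_nat k * eval4 (P_poly k) x y u v else 0))) n"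


section \<open>The function field of the elliptic curve\<close>

text \<open>K[x][y], with y the outer variable.\<close>

definition curve_poly :: "'k::field_char_0 \<Rightarrow> 'k \<Rightarrow> 'k poly poly" where
  "curve_poly u v = [:[:v, u, 0, - 4:], 0, 1:]"

definition eval_xy :: "('k \<Rightarrow> 'f) \<Rightarrow> 'f \<Rightarrow> 'f \<Rightarrow> 'k::field_char_0 poly poly \<Rightarrow> 'f::field_char_0"
  where "eval_xy \<iota> x y p = poly (map_poly (\<lambda>c. poly (map_poly \<iota> c) x) p) y"

text \<open>Evaluation at (x, y) induces an embedding of the coordinate ring
  K[x,y]/(y^2 - 4x^3 + ux + v) into the field 'f, so that the fractions below form a copy of the
  function field K(E) inside 'f.\<close>

definition generic_point ::
    "('k::field_char_0 \<Rightarrow> 'f::field_char_0) \<Rightarrow> 'k \<Rightarrow> 'k \<Rightarrow> 'f \<Rightarrow> 'f \<Rightarrow> bool" where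
  "generic_point \<iota> u v x y \<longleftrightarrow>
     \<iota> 1 = 1 \<and> (\<forall>a b. \<iota> (a + b) = \<iota> a + \<iota> b) \<and> (\<forall>a b. \<iota> (a * b) = \<iota> a * \<iota> b) \<and>
     (\<forall>p. eval_xy \<iota> x y p = 0 \<longleftrightarrow> curve_poly u v dvd p)"

definition function_field ::
    "('k::field_char_0 \<Rightarrow> 'f::field_char_0) \<Rightarrow> 'f \<Rightarrow> 'f \<Rightarrow> 'f set" where
  "function_field \<iota> x y = {eval_xy \<iota> x y p / eval_xy \<iota> x y q | p q. eval_xy \<iota> x y q \<noteq> 0}"

text \<open>The (unique) K-derivation d/dx of K(E). Since the Kaehler differentials of K(E) over K are
  the one-dimensional vector space K(E) dx, a 1-form is represented by its coefficient
  with respect to dx, and d becomes d/dx.\<close>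

definition derivation_ddx ::
    "('k::field_char_0 \<Rightarrow> 'f::field_char_0) \<Rightarrow> 'f \<Rightarrow> 'f \<Rightarrow> ('f \<Rightarrow> 'f) \<Rightarrow> bool" where
  "derivation_ddx \<iota> x y D \<longleftrightarrow>
     (\<forall>f\<in>function_field \<iota> x y. D f \<in> function_field \<iota> x y) \<and>
     (\<forall>f\<in>function_field \<iota> x y. \<forall>g\<in>function_field \<iota> x y.
        D (f + g) = D f + D g \<and> D (f * g) = D f * g + f * D g) \<and>
     (\<forall>c. D (\<iota> c) = 0) \<and> D x = 1"


section \<open>The connection forms\<close>

text \<open>Coefficients with respect to dx of the two connection forms.\<close>

definition nu_naive :: "'f::field_char_0 \<Rightarrow> 'f \<Rightarrow> 'f ncseries" where
  "nu_naive x y = nc_scale (- x / y) nc_T + nc_scale (1 / y) nc_S"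

text \<open>The n-th term of the infinite sum is homogeneous of degree n + 1, so only n < length w
  contributes to the coefficient at w.\<close>

definition nu_alg :: "'f::field_char_0 \<Rightarrow> 'f \<Rightarrow> 'f \<Rightarrow> 'f \<Rightarrow> 'f ncseries" where
  "nu_alg u v x y = nc_scale (- x / y) nc_T + nc_scale (1 / y) nc_S +
     Abs_nc (\<lambda>w. \<Sum>n\<in>{2..<length w}.
       nc_coeff (nc_scale (q_coeff n x y u v / y) ((nc_ad nc_T ^^ n) nc_S)) w)"

end

theory Submission
  imports Defs "HOL-Complex_Analysis.Complex_Analysis"
begin

text \<open>Suppose that g is a gauge transformation. Multiplying the gauge equation by g on the right
  turns it into dg = g \<nu>' - \<nu> g, where \<nu>' is the naive and \<nu> the KZB form. At a
  word w this expresses the differential of the coefficient of w in g by coefficients at words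
  that are shorter by at least one letter. The two forms agree up to degree 2, and in degree 3
  they differ by q_2 (dx/y) [T,[T,S]] with q_2 = -x/2.

  Every coefficient of g is a rational function on the curve, so every differential obtained in
  this way is exact. On the other hand, if a and b are constants and (a x + b) dx/y is exact, then
  a = b = 0: the forms dx/y and x dx/y are independent in the algebraic de Rham cohomology of
  the punctured curve (\<open>exact_differential\<close>). In degree 1 the coefficients s, t of
  S and T in g are constants. The word ST gives -(s x + t) dx/y, so s = t = 0, and then all
  coefficients in degree 2 are constants as well. Let c be the coefficient of ST. The constant part
  of the differential at the word SST is -c, so c = 0, while at the word STT the coefficient of x is
  1/2 - c, so c = 1/2. This contradiction is \<open>no_gauge_transformation\<close>.

  What makes this argument work is the value q_2 = -x/2, that is, that the polynomial expressing
  P_2 by x, y, u, v takes the value x on every curve. The polynomial is only determined by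
  its values at the analytic points (P_2, -2 P_3, 20 G_4, 7/3 G_6), so one has to show that a
  polynomial over the rationals that vanishes at all these points vanishes at every point of every
  Weierstrass curve over every field of characteristic 0
  (\<open>vanishing_on_universal_curve\<close>). The analytic points lie on their curves by the
  differential equation of the Weierstrass function (\<open>weierstrass_equation\<close>), so that
  powers of y can be reduced to A(x,u,v) + y B(x,u,v). For a fixed lattice, P_2 is even and
  unbounded and P_3 is odd, which forces the coefficients of A and B, as polynomials
  in u and v, to vanish at (20 G_4, 7/3 G_6) (\<open>poly_vanishing_imp_0\<close>). Finally G_4 and
  G_6 are algebraically independent (\<open>eisenstein_algebraically_independent\<close>): by
  modularity the relation is stable under the weighted scaling (l^4 u, l^6 v), and the
  ratio of e_6^2 to e_4^3 takes infinitely many values.\<close>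

section \<open>Exact differentials on the curve: the equation in polynomials\<close>

lemma prime_divisor_of_nonunit_poly:
  fixes d :: "'k::field poly"
  assumes "d \<noteq> 0" "\<not> is_unit d"
  shows "\<exists>p. p dvd d \<and> prime_elem p"
  using assms
proof (induction "degree d" arbitrary: d rule: less_induct)
  case less
  show ?case
  proof (cases "irreducible d")
    case True
    then show ?thesis by (intro exI[of _ d] conjI dvd_refl field_poly_irreducible_imp_prime)
  next
    case False
    then obtain a b where ab: "d = a * b" "\<not> is_unit a" "\<not> is_unit b"
      using less.prems unfolding irreducible_def by blast
    have "a \<noteq> 0" "b \<noteq> 0" using ab less.prems by auto
    moreover have "degree b \<noteq> 0" using ab \<open>b \<noteq> 0\<close> is_unit_iff_degree by blast
    ultimately have "degree a < degree d" using ab by (simp add: degree_mult_eq)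
    then obtain p where "p dvd a" "prime_elem p" using less.hyps \<open>a \<noteq> 0\<close> ab(2) by blast
    thus ?thesis using ab(1) by (meson dvd_mult2)
  qed
qed

lemma extract_power_of_nonunit_poly:
  fixes d p :: "'k::field poly"
  assumes "d \<noteq> 0" "\<not> is_unit p"
  shows "\<exists>m e. d = p ^ m * e \<and> \<not> p dvd e"
  using assms(1)
proof (induction "degree d" arbitrary: d rule: less_induct)
  case less
  show ?case
  proof (cases "p dvd d")
    case False
    then show ?thesis by (intro exI[of _ 0] exI[of _ d]) auto
  next
    case True
    then obtain d' where d': "d = p * d'" by (auto elim: dvdE)
    have "p \<noteq> 0" "d' \<noteq> 0" using d' less.prems by auto
    moreover have "degree p \<noteq> 0" using assms(2) \<open>p \<noteq> 0\<close> is_unit_iff_degree by blast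
    ultimately have "degree d' < degree d" using d' by (simp add: degree_mult_eq)
    then obtain m e where "d' = p ^ m * e" "\<not> p dvd e" using less.hyps \<open>d' \<noteq> 0\<close> by blast
    thus ?thesis using d' by (intro exI[of _ "Suc m"] exI[of _ e]) auto
  qed
qed

text \<open>The equation says that n y / d has derivative l / y, where y^2 = Q, and the claim
  is that only n = 0 is possible when l has degree at most 1. At a pole of order m that is not a
  root of Q, differentiation raises the order to m + 1, which nothing can cancel. At a (simple)
  root of Q the leading term is multiplied by 1 - 2 m, up to a nonzero factor, and cannot
  vanish because m is an integer. So there are no poles, and then the degree of the left-hand side
  is at least 2. Poles are irreducible factors of d here, since the field need not be
  algebraically closed.\<close>

lemma no_rational_primitive:
  fixes Q n d l :: "'k::field_char_0 poly"
  assumes sqf: "coprime Q (pderiv Q)" and Q: "degree Q = 3" and l: "degree l \<le> 1"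
    and d: "d \<noteq> 0"
    and eq: "2 * (pderiv n * d - n * pderiv d) * Q + n * d * pderiv Q = 2 * l * d ^ 2"
  shows "n = 0"
  using d eq
proof (induction "degree d" arbitrary: d n rule: less_induct)
  case less
  show ?case
  proof (cases "is_unit d")
    case True
    then obtain c where c: "d = [:c:]" "c \<noteq> 0"
      using less.prems(1) by (auto simp: is_unit_iff_degree elim: degree_eq_zeroE)
    show ?thesis
    proof (rule ccontr)
      assume n: "n \<noteq> 0"
      \<comment> \<open>The leading coefficient of the left-hand side is 2 (degree n) + 3 times a nonzero factor.\<close>
      let ?N = "degree n + 2"
      have eq': "2 * (pderiv n * Q) + n * pderiv Q = smult (2 * c) l"
      proof -
        have "smult c (2 * (pderiv n * Q) + n * pderiv Q) = smult c (smult (2 * c) l)"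
          using less.prems(2) c(1) by (simp add: pderiv_pCons power2_eq_square algebra_simps numeral_poly smult_add_right)
        hence "smult c (2 * (pderiv n * Q) + n * pderiv Q - smult (2 * c) l) = 0"
          by (simp only: smult_diff_right right_minus_eq)
        thus ?thesis using c(2) by (simp only: smult_eq_0_iff right_minus_eq simp_thms)
      qed
      have "coeff (n * pderiv Q) ?N = lead_coeff n * (3 * lead_coeff Q)"
      proof -
        have "degree (pderiv Q) = 2" by (simp add: degree_pderiv Q)
        hence "coeff (n * pderiv Q) ?N = lead_coeff n * coeff (pderiv Q) 2"
          by (metis coeff_mult_degree_sum)
        thus ?thesis by (simp add: coeff_pderiv Q)
      qed
      moreover have "coeff (pderiv n * Q) ?N = of_nat (degree n) * lead_coeff n * lead_coeff Q"
      proof (cases "degree n")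
        case 0
        then have "pderiv n = 0" by (simp add: pderiv_eq_0_iff)
        with 0 show ?thesis by simp
      next
        case (Suc m)
        have "?N = degree (pderiv n) + degree Q" by (simp add: degree_pderiv Q Suc)
        hence "coeff (pderiv n * Q) ?N = lead_coeff (pderiv n) * lead_coeff Q"
          by (metis coeff_mult_degree_sum)
        thus ?thesis by (simp add: degree_pderiv coeff_pderiv Suc)
      qed
      ultimately have "coeff (2 * (pderiv n * Q) + n * pderiv Q) ?N
          = (2 * of_nat (degree n) + 3) * lead_coeff n * lead_coeff Q"
        by (simp add: numeral_poly algebra_simps)
      moreover have "coeff (smult (2 * c) l) ?N = 0"
        using l by (simp add: coeff_eq_0)
      moreover have "(2 * of_nat (degree n) + 3 :: 'k) \<noteq> 0"
        using of_nat_eq_0_iff[where 'a='k, of "2 * degree n + 3"] by simp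
      moreover have "lead_coeff Q \<noteq> 0" using Q by (metis degree_0 leading_coeff_0_iff zero_neq_numeral)
      ultimately show False using n eq' by simp
    qed
  next
    case False
    obtain p where p: "p dvd d" "prime_elem p"
      using prime_divisor_of_nonunit_poly[OF less.prems(1) False] by blast
    show ?thesis
    proof (cases "p dvd n")
      case True
      then obtain n1 d1 where nd: "n = p * n1" "d = p * d1" using p by (auto elim!: dvdE)
      have p0: "p \<noteq> 0" using p by auto
      have "p ^ 2 * (2 * (pderiv n1 * d1 - n1 * pderiv d1) * Q + n1 * d1 * pderiv Q) =
            p ^ 2 * (2 * l * d1 ^ 2)"
        using less.prems(2) unfolding nd by (simp add: pderiv_mult power2_eq_square algebra_simps)
      hence "2 * (pderiv n1 * d1 - n1 * pderiv d1) * Q + n1 * d1 * pderiv Q = 2 * l * d1 ^ 2"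
        using p0 by simp
      moreover have "degree d1 < degree d"
      proof -
        have "degree p \<noteq> 0" using p p0 is_unit_iff_degree prime_elem_not_unit by blast
        thus ?thesis using less.prems(1) nd by (simp add: degree_mult_eq)
      qed
      ultimately have "n1 = 0" using less.hyps[of d1 n1] less.prems(1) nd by auto
      thus ?thesis by (simp add: nd)
    next
      case False
      have nu: "\<not> is_unit p" using p prime_elem_not_unit by blast
      obtain m e where e: "d = p ^ m * e" "\<not> p dvd e"
        using extract_power_of_nonunit_poly[OF less.prems(1) nu] by blast
      have m: "m \<noteq> 0" using e p by (metis mult_1 power_0)
      then obtain k where k: "m = Suc k" by (cases m) auto
      have p0: "p \<noteq> 0" using p by auto
      have dp: "degree p \<noteq> 0" using p p0 is_unit_iff_degree prime_elem_not_unit by blast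
      have "pderiv p \<noteq> 0" using dp by (simp add: pderiv_eq_0_iff)
      have pp': "\<not> p dvd pderiv p"
        using dp \<open>pderiv p \<noteq> 0\<close> dvd_imp_degree_le[of p "pderiv p"] by (auto simp: degree_pderiv)
      define c where "c = (of_nat m :: 'k)"
      have pd: "pderiv d = p ^ k * (smult c (pderiv p * e) + p * pderiv e)"
        unfolding c_def e(1) k pderiv_mult pderiv_power_Suc by (simp add: algebra_simps smult_add_right)
      have *: "p ^ k * (2 * (pderiv n * p * e - n * (smult c (pderiv p * e) + p * pderiv e)) * Q
                 + n * p * e * pderiv Q) = p ^ k * (2 * l * p * e * d)"
        using less.prems(2) unfolding pd power2_eq_square
        unfolding e(1) k by (simp add: algebra_simps)
      hence **: "2 * (pderiv n * p * e - n * (smult c (pderiv p * e) + p * pderiv e)) * Q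
                 + n * p * e * pderiv Q = 2 * l * p * e * d"
        using p0 by simp
      \<comment> \<open>All terms except the one with the derivative of p are divisible by p, so p divides Q.\<close>
      have "p * (2 * pderiv n * e * Q - 2 * n * pderiv e * Q + n * e * pderiv Q - 2 * l * e * d)
          = smult (2 * c) (n * pderiv p * e * Q)"
        using ** by (simp add: algebra_simps numeral_poly of_nat_poly)
      hence "p dvd smult (2 * c) (n * pderiv p * e * Q)" by (rule dvdI[OF sym])
      hence "p dvd n * pderiv p * e * Q"
        using m by (simp add: dvd_smult_iff c_def)
      hence "p dvd Q" using p False pp' e by (auto simp: prime_elem_dvd_mult_iff)
      then obtain Q1 where Q1: "Q = p * Q1" by (auto elim!: dvdE)
      \<comment> \<open>Cancelling one more p leaves the leading coefficients -2 m and 1 of the two terms.\<close>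
      have "p * (2 * (pderiv n * p * e - n * (smult c (pderiv p * e) + p * pderiv e)) * Q1
                 + n * e * pderiv Q) = p * (2 * l * e * d)"
        using ** unfolding Q1 by (simp add: algebra_simps)
      hence "2 * (pderiv n * p * e - n * (smult c (pderiv p * e) + p * pderiv e)) * Q1
                 + n * e * pderiv Q = 2 * l * e * d"
        using p0 by simp
      hence "p * (2 * pderiv n * e * Q1 - 2 * n * pderiv e * Q1 + n * e * pderiv Q1
              - 2 * l * e * p ^ k * e)
          = smult (2 * c - 1) (n * pderiv p * e * Q1)"
        unfolding Q1 e(1) k
        by (simp add: algebra_simps pderiv_mult numeral_poly of_nat_poly smult_diff_left)
      hence "p dvd smult (2 * c - 1) (n * pderiv p * e * Q1)" by (rule dvdI[OF sym])
      moreover have "(2 * c - 1 :: 'k) \<noteq> 0"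
      proof
        assume "(2 * c - 1 :: 'k) = 0"
        hence "of_nat (2 * m) = (of_nat 1 :: 'k)" by (simp add: c_def)
        hence "2 * m = 1" by (simp only: of_nat_eq_iff)
        thus False by presburger
      qed
      ultimately have "p dvd n * pderiv p * e * Q1" by (simp add: dvd_smult_iff)
      hence "p dvd Q1" using p False pp' e by (auto simp: prime_elem_dvd_mult_iff)
      hence "p dvd pderiv Q" unfolding Q1 by (simp add: pderiv_mult)
      with \<open>p dvd Q\<close> sqf nu show ?thesis by (meson coprime_common_divisor)
    qed
  qed
qed

text \<open>The discriminant is a combination of the cubic and its derivative: with
  3 Q - x Q' = -(2 u x + 3 v) one can eliminate x.\<close>

lemma weierstrass_cubic_coprime:
  fixes u v :: "'k::field_char_0"
  assumes "u ^ 3 - 27 * v ^ 2 \<noteq> 0"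
  shows "coprime [:-v, -u, 0, 4:] (pderiv [:-v, -u, 0, 4:])"
proof (rule coprimeI)
  fix c assume c: "c dvd [:-v, -u, 0, 4:]" "c dvd pderiv [:-v, -u, 0, 4:]"
  let ?Q = "[:-v, -u, 0, 4:]"
  \<comment> \<open>The linear factor is 12 (2 u x - 3 v), which makes a difference of squares with 2 u x + 3 v.\<close>
  have "[:4 * u ^ 2:] * pderiv ?Q - (([:0, 1:] * pderiv ?Q - [:3:] * ?Q) * [:-36 * v, 24 * u:])
      = [:-4 * (u ^ 3 - 27 * v ^ 2):]"
    by (simp add: pderiv_pCons algebra_simps power2_eq_square power3_eq_cube)
  moreover have "c dvd [:4 * u ^ 2:] * pderiv ?Q - (([:0, 1:] * pderiv ?Q - [:3:] * ?Q) * [:-36 * v, 24 * u:])"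
    using c by (intro dvd_diff dvd_mult dvd_mult2) auto
  ultimately have "c dvd [:-4 * (u ^ 3 - 27 * v ^ 2):]" by metis
  moreover have "is_unit [:-4 * (u ^ 3 - 27 * v ^ 2):]"
    using assms by (subst is_unit_const_poly_iff) (simp add: dvd_field_iff)
  ultimately show "is_unit c" using dvd_trans by blast
qed

text \<open>Comparison of the leading terms shows that in characteristic 0 either p = 0 or p and q have the
  same degree. This also applies to p minus the multiple of q that cancels the term in the degree
  of q, which must therefore be 0.\<close>

lemma wronskian_zero_imp_proportional:
  fixes p q :: "'k::field_char_0 poly"
  assumes "p * pderiv q = q * pderiv p" and "q \<noteq> 0"
  shows "\<exists>k. p = smult k q"
proof -
  have *: "degree r = degree q" if "r * pderiv q = q * pderiv r" "r \<noteq> 0" for r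
  proof -
    have c: "coeff (a * pderiv b) (degree a + degree b - 1) = of_nat (degree b) * lead_coeff a * lead_coeff b"
      for a b :: "'k poly"
    proof (cases "degree b")
      case 0
      then have "pderiv b = 0" by (simp add: pderiv_eq_0_iff)
      with 0 show ?thesis by simp
    next
      case (Suc m)
      have "coeff (a * pderiv b) (degree a + degree (pderiv b)) = lead_coeff a * lead_coeff (pderiv b)"
        by (rule coeff_mult_degree_sum)
      thus ?thesis by (simp add: degree_pderiv coeff_pderiv Suc)
    qed
    have "of_nat (degree q) * lead_coeff r * lead_coeff q = of_nat (degree r) * lead_coeff r * lead_coeff q"
      using c[of r q] c[of q r] that(1) by (simp add: add.commute mult.commute mult.left_commute)
    thus ?thesis using that(2) assms(2) by simp
  qed
  define k where "k = coeff p (degree q) / lead_coeff q"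
  define r where "r = p - smult k q"
  have "r * pderiv q = q * pderiv r"
    using assms(1) by (simp add: r_def pderiv_diff pderiv_smult algebra_simps)
  moreover have "coeff r (degree q) = 0" using assms(2) by (simp add: r_def k_def)
  ultimately have "r = 0" using *[of r] by (metis leading_coeff_0_iff)
  thus ?thesis unfolding r_def by auto
qed

section \<open>The function field of the curve\<close>

locale elliptic_function_field =
  fixes u v :: "'k::field_char_0" and \<iota> :: "'k \<Rightarrow> 'f::field_char_0" and x y :: 'f
    and D :: "'f \<Rightarrow> 'f"
  assumes discriminant: "u ^ 3 - 27 * v ^ 2 \<noteq> 0"
    and generic: "generic_point \<iota> u v x y"
    and derivation: "derivation_ddx \<iota> x y D"
begin

definition cubic :: "'k poly" where "cubic = [:-v, -u, 0, 4:]"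

definition at_x :: "'k poly \<Rightarrow> 'f" where "at_x p = poly (map_poly \<iota> p) x"

definition at_xy :: "'k poly poly \<Rightarrow> 'f" where "at_xy = eval_xy \<iota> x y"

abbreviation "KE \<equiv> function_field \<iota> x y"

lemma embedding [simp]: "\<iota> 1 = 1" "\<iota> (a + b) = \<iota> a + \<iota> b" "\<iota> (a * b) = \<iota> a * \<iota> b"
  using generic by (auto simp: generic_point_def)

lemma embedding_0 [simp]: "\<iota> 0 = 0"
  using embedding(2)[of 0 0] by simp

lemma embedding_uminus [simp]: "\<iota> (- a) = - \<iota> a"
  using embedding(2)[of a "- a"] by (simp add: eq_neg_iff_add_eq_0 add.commute)

lemma embedding_diff [simp]: "\<iota> (a - b) = \<iota> a - \<iota> b"
  using embedding(2)[of a "- b"] by simp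

lemma embedding_of_nat [simp]: "\<iota> (of_nat n) = of_nat n"
  by (induction n) auto

lemma embedding_numeral [simp]: "\<iota> (numeral n) = numeral n"
  using embedding_of_nat[of "numeral n"] by simp

lemma at_x_pCons [simp]: "at_x (pCons a p) = \<iota> a + x * at_x p"
  by (simp add: at_x_def map_poly_pCons)

lemma at_x_0 [simp]: "at_x 0 = 0"
  by (simp add: at_x_def)

lemma at_x_1 [simp]: "at_x 1 = 1"
  by (simp add: one_pCons)

lemma at_x_add [simp]: "at_x (p + q) = at_x p + at_x q"
  by (induction p q rule: poly_induct2) (auto simp: algebra_simps)

lemma at_x_smult [simp]: "at_x (smult c p) = \<iota> c * at_x p"
  by (induction p) (auto simp: algebra_simps)

lemma at_x_mult [simp]: "at_x (p * q) = at_x p * at_x q"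
  by (induction p) (auto simp: algebra_simps)

lemma at_x_uminus [simp]: "at_x (- p) = - at_x p"
  using at_x_smult[of "-1" p] by simp

lemma at_x_diff [simp]: "at_x (p - q) = at_x p - at_x q"
  using at_x_add[of p "- q"] by simp

lemma at_x_numeral [simp]: "at_x (numeral n) = numeral n"
  by (simp add: numeral_poly)

lemma at_x_power [simp]: "at_x (p ^ n) = at_x p ^ n"
  by (induction n) auto

lemma at_xy_pCons [simp]: "at_xy (pCons a p) = at_x a + y * at_xy p"
  by (simp add: at_xy_def eval_xy_def at_x_def map_poly_pCons)

lemma at_xy_0 [simp]: "at_xy 0 = 0"
  by (simp add: at_xy_def eval_xy_def)

lemma at_xy_1 [simp]: "at_xy 1 = 1"
  by (simp add: one_pCons)

lemma at_xy_add [simp]: "at_xy (p + q) = at_xy p + at_xy q"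
  by (induction p q rule: poly_induct2) (auto simp: algebra_simps)

lemma at_xy_smult [simp]: "at_xy (smult c p) = at_x c * at_xy p"
  by (induction p) (auto simp: algebra_simps)

lemma at_xy_mult [simp]: "at_xy (p * q) = at_xy p * at_xy q"
  by (induction p) (auto simp: algebra_simps)

lemma at_xy_uminus [simp]: "at_xy (- p) = - at_xy p"
  using at_xy_smult[of "-1" p] by simp

lemma at_xy_eq_0_iff: "at_xy p = 0 \<longleftrightarrow> curve_poly u v dvd p"
  using generic by (auto simp: generic_point_def at_xy_def)

lemma KE_altdef: "KE = {at_xy p / at_xy q | p q. at_xy q \<noteq> 0}"
  by (simp add: function_field_def at_xy_def)

lemma y_squared: "y ^ 2 = at_x cubic"
proof -
  have "at_xy (curve_poly u v) = 0" by (simp add: at_xy_eq_0_iff)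
  thus ?thesis
    by (simp add: curve_poly_def cubic_def power2_eq_square algebra_simps add_eq_0_iff)
qed

lemma y_squared': "y ^ 2 = 4 * x ^ 3 - \<iota> u * x - \<iota> v"
  by (simp add: y_squared cubic_def algebra_simps power3_eq_cube)

text \<open>1 and y are independent over the polynomials in x, because the equation of the curve has
  degree 2 in y.\<close>

lemma at_x_y_linear_eq_0_iff: "at_x a + y * at_x b = 0 \<longleftrightarrow> a = 0 \<and> b = 0"
proof -
  have "at_x a + y * at_x b = at_xy [:a, b:]" by simp
  also have "\<dots> = 0 \<longleftrightarrow> curve_poly u v dvd [:a, b:]" by (rule at_xy_eq_0_iff)
  also have "\<dots> \<longleftrightarrow> [:a, b:] = 0"
  proof
    assume "curve_poly u v dvd [:a, b:]"
    moreover have "degree (curve_poly u v) = 2" by (simp add: curve_poly_def)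
    moreover have "degree [:a, b:] \<le> 1" by simp
    ultimately show "[:a, b:] = 0"
      using dvd_imp_degree_le[of "curve_poly u v" "[:a, b:]"] by fastforce
  qed auto
  finally show ?thesis by auto
qed

lemma at_x_eq_0_iff [simp]: "at_x a = 0 \<longleftrightarrow> a = 0"
  using at_x_y_linear_eq_0_iff[of a 0] by (simp del: at_x_y_linear_eq_0_iff)

lemma y_nonzero [simp]: "y \<noteq> 0"
  using at_x_y_linear_eq_0_iff[of 0 1] by simp

lemma at_xy_linear: "\<exists>a b. at_xy p = at_x a + y * at_x b"
proof (induction p)
  case (pCons c p)
  then obtain a b where "at_xy p = at_x a + y * at_x b" by blast
  hence "at_xy (pCons c p) = at_x (c + b * cubic) + y * at_x a"
    using y_squared by (simp add: algebra_simps power2_eq_square)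
  thus ?case by blast
qed (auto intro!: exI[of _ 0])

text \<open>Every rational function becomes a + b y with a polynomial denominator in x alone, after
  multiplication of numerator and denominator by the conjugate of the denominator.\<close>

lemma KE_normal_form:
  assumes "z \<in> KE"
  obtains a b c where "c \<noteq> 0" "z * at_x c = at_x a + y * at_x b"
proof -
  from assms obtain p q where z: "z = at_xy p / at_xy q" "at_xy q \<noteq> 0"
    by (auto simp: KE_altdef)
  obtain a b where q: "at_xy q = at_x a + y * at_x b" using at_xy_linear by blast
  obtain a' b' where pq: "at_xy (p * [:a, -b:]) = at_x a' + y * at_x b'" using at_xy_linear by blast
  have "a \<noteq> 0 \<or> b \<noteq> 0" using z(2) q by auto
  hence n: "at_x a - y * at_x b \<noteq> 0" using at_x_y_linear_eq_0_iff[of a "-b"] by simp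
  define c where "c = a ^ 2 - cubic * b ^ 2"
  have c: "at_x c = at_xy q * (at_x a - y * at_x b)"
    unfolding q c_def using y_squared by (simp add: algebra_simps power2_eq_square)
  have "c \<noteq> 0" using c n z(2) by (metis at_x_0 mult_eq_0_iff)
  moreover have "z * at_x c = at_x a' + y * at_x b'"
    unfolding c using z pq[symmetric] by (simp add: algebra_simps)
  ultimately show ?thesis using that by blast
qed

lemma KE_divide [intro]: assumes "a \<in> KE" "b \<in> KE" shows "a / b \<in> KE"
proof -
  from assms obtain p q r s where *: "a = at_xy p / at_xy q" "at_xy q \<noteq> 0"
    "b = at_xy r / at_xy s" "at_xy s \<noteq> 0" by (auto simp: KE_altdef)
  show ?thesis
  proof (cases "b = 0")
    case True
    hence "a / b = at_xy 0 / at_xy 1" "at_xy 1 \<noteq> 0" by simp_all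
    thus ?thesis unfolding KE_altdef by blast
  next
    case False
    hence "at_xy r \<noteq> 0" using * by auto
    hence "a / b = at_xy (p * s) / at_xy (q * r)" "at_xy (q * r) \<noteq> 0" using * by auto
    thus ?thesis unfolding KE_altdef by blast
  qed
qed

lemma KE_at_xy [intro]: "at_xy p \<in> KE"
proof -
  have "at_xy p = at_xy p / at_xy 1" "at_xy 1 \<noteq> 0" by simp_all
  thus ?thesis unfolding KE_altdef by blast
qed

lemma KE_at_x [intro]: "at_x p \<in> KE"
  using KE_at_xy[of "[:p:]"] by simp

lemma KE_x [intro]: "x \<in> KE" using KE_at_x[of "[:0, 1:]"] by simp
lemma KE_y [intro]: "y \<in> KE" using KE_at_xy[of "[:0, 1:]"] by simp
lemma KE_embedding [intro]: "\<iota> c \<in> KE" using KE_at_x[of "[:c:]"] by simp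
lemma KE_0 [intro]: "0 \<in> KE" using KE_at_x[of 0] by simp
lemma KE_1 [intro]: "1 \<in> KE" using KE_at_x[of 1] by simp

lemma KE_add [intro]: assumes "a \<in> KE" "b \<in> KE" shows "a + b \<in> KE"
proof -
  from assms obtain p q r s where *: "a = at_xy p / at_xy q" "at_xy q \<noteq> 0"
    "b = at_xy r / at_xy s" "at_xy s \<noteq> 0" by (auto simp: KE_altdef)
  have "a + b = at_xy (p * s + r * q) / at_xy (q * s)" "at_xy (q * s) \<noteq> 0"
    using *(2,4) by (simp_all add: *(1,3) field_simps)
  thus ?thesis unfolding KE_altdef by blast
qed

lemma KE_mult [intro]: assumes "a \<in> KE" "b \<in> KE" shows "a * b \<in> KE"
  using KE_divide[OF assms(1) KE_divide[OF KE_1 assms(2)]] by simp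

lemma KE_uminus [intro]: "a \<in> KE \<Longrightarrow> - a \<in> KE"
  using KE_mult[OF KE_embedding[of "- 1"], of a] by simp

lemma KE_diff [intro]: "a \<in> KE \<Longrightarrow> b \<in> KE \<Longrightarrow> a - b \<in> KE"
  using KE_add[of a "- b"] by auto

lemma KE_sum [intro]: "(\<And>i. i \<in> A \<Longrightarrow> f i \<in> KE) \<Longrightarrow> sum f A \<in> KE"
  by (induction A rule: infinite_finite_induct) auto

lemma KE_of_nat [intro]: "of_nat n \<in> KE"
  using KE_embedding[of "of_nat n"] by simp

lemma D_add: "a \<in> KE \<Longrightarrow> b \<in> KE \<Longrightarrow> D (a + b) = D a + D b"
  and D_mult: "a \<in> KE \<Longrightarrow> b \<in> KE \<Longrightarrow> D (a * b) = D a * b + a * D b"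
  and D_embedding [simp]: "D (\<iota> c) = 0"
  and D_x [simp]: "D x = 1"
  using derivation by (auto simp: derivation_ddx_def)

lemma D_0 [simp]: "D 0 = 0" using D_embedding[of 0] by simp

lemma D_at_x: "D (at_x p) = at_x (pderiv p)"
  by (induction p) (simp_all add: D_add D_mult KE_mult KE_x KE_at_x KE_embedding pderiv_pCons)

lemma D_y: "2 * y * D y = at_x (pderiv cubic)"
proof -
  have "D (y * y) = at_x (pderiv cubic)"
    using y_squared D_at_x[of cubic] by (simp add: power2_eq_square)
  thus ?thesis by (simp add: D_mult KE_y mult.assoc)
qed

text \<open>The forms x dx/y and dx/y span the first de Rham cohomology of the punctured curve. In the normal
  form (p + q y) / r of the primitive, comparison of the coefficients of 1 and of
  y gives an equation for q / r that has no nonzero solution and one that makes p / r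
  a constant. The case a = b = 0 says that the constants of the derivation are the
  elements of the base field.\<close>

lemma exact_differential:
  assumes z: "z \<in> KE" and Dz: "D z = (\<iota> a * x + \<iota> b) / y"
  shows "a = 0" "b = 0" "\<exists>k. z = \<iota> k"
proof -
  obtain p q r where r: "r \<noteq> 0" and zr: "z * at_x r = at_x p + y * at_x q"
    by (rule KE_normal_form[OF z])
  define l where "l = [:b, a:]"
  have Dz': "y * D z = at_x l" using Dz by (simp add: l_def mult.commute add.commute)
  have "D (z * at_x r) = D (at_x p + y * at_x q)" by (simp only: zr)
  hence "D z * at_x r + z * at_x (pderiv r)
      = at_x (pderiv p) + (D y * at_x q + y * at_x (pderiv q))"
    unfolding D_mult[OF z KE_at_x] D_add[OF KE_at_x KE_mult[OF KE_y KE_at_x]]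
      D_mult[OF KE_y KE_at_x] D_at_x .
  hence "2 * y * at_x r * (D z * at_x r + z * at_x (pderiv r))
      = 2 * y * at_x r * (at_x (pderiv p) + (D y * at_x q + y * at_x (pderiv q)))"
    by simp
  hence "2 * (y * D z) * at_x r ^ 2 + 2 * y * (z * at_x r) * at_x (pderiv r)
      = 2 * y * at_x r * at_x (pderiv p) + (2 * y * D y) * at_x q * at_x r
        + 2 * y ^ 2 * at_x (pderiv q) * at_x r"
    by (simp add: algebra_simps power2_eq_square)
  hence "2 * at_x l * at_x r ^ 2 + 2 * y * (at_x p + y * at_x q) * at_x (pderiv r)
      = 2 * y * at_x r * at_x (pderiv p) + at_x (pderiv cubic) * at_x q * at_x r
        + 2 * at_x cubic * at_x (pderiv q) * at_x r"
    unfolding Dz' zr D_y y_squared .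
  moreover have "2 * y * (at_x p + y * at_x q) * at_x (pderiv r)
      = 2 * y * at_x p * at_x (pderiv r) + 2 * at_x cubic * at_x q * at_x (pderiv r)"
    by (simp add: y_squared[symmetric] algebra_simps power2_eq_square)
  ultimately have "2 * at_x l * at_x r ^ 2
        + (2 * y * at_x p * at_x (pderiv r) + 2 * at_x cubic * at_x q * at_x (pderiv r))
      = 2 * y * at_x r * at_x (pderiv p) + at_x (pderiv cubic) * at_x q * at_x r
        + 2 * at_x cubic * at_x (pderiv q) * at_x r"
    by (simp only:)
  hence "at_x (2 * l * r ^ 2 + 2 * cubic * q * pderiv r - q * r * pderiv cubic
                - 2 * cubic * pderiv q * r)
      + y * at_x (2 * p * pderiv r - 2 * r * pderiv p) = 0"
    by (simp add: algebra_simps power2_eq_square)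
  hence e: "2 * l * r ^ 2 + 2 * cubic * q * pderiv r - q * r * pderiv cubic
                - 2 * cubic * pderiv q * r = 0" "2 * p * pderiv r - 2 * r * pderiv p = 0"
    by (simp_all only: at_x_y_linear_eq_0_iff)
  have "q = 0"
  proof (rule no_rational_primitive)
    show "coprime cubic (pderiv cubic)"
      unfolding cubic_def by (rule weierstrass_cubic_coprime[OF discriminant])
    show "degree cubic = 3" by (simp add: cubic_def)
    show "degree l \<le> 1" by (simp add: l_def)
    show "2 * (pderiv q * r - q * pderiv r) * cubic + q * r * pderiv cubic = 2 * l * r ^ 2"
      using e(1) by (simp add: algebra_simps)
  qed fact
  with e(1) r have "l = 0" by simp
  thus "a = 0" "b = 0" by (simp_all add: l_def)
  have "p * pderiv r = r * pderiv p" using e(2) by simp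
  then obtain k where "p = smult k r" using wronskian_zero_imp_proportional r by blast
  hence "z * at_x r = \<iota> k * at_x r" using zr \<open>q = 0\<close> by simp
  thus "\<exists>k. z = \<iota> k" using r by auto
qed

end

section \<open>Coefficients of noncommutative power series\<close>

lemmas nc_coeff_simps = zero_ncseries.rep_eq one_ncseries.rep_eq plus_ncseries.rep_eq
  minus_ncseries.rep_eq uminus_ncseries.rep_eq times_ncseries.rep_eq nc_map.rep_eq

lemma nc_coeff_Abs_nc [simp]: "nc_coeff (Abs_nc f) = f"
  by (simp add: Abs_nc_inverse)

lemma nc_coeff_scale [simp]: "nc_coeff (nc_scale c f) w = c * nc_coeff f w"
  by (simp add: nc_scale_def nc_map.rep_eq)

lemma nc_coeff_generators [simp]:
  "nc_coeff nc_S w = (if w = [LS] then 1 else 0)" "nc_coeff nc_T w = (if w = [LT] then 1 else 0)"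
  by (simp_all add: nc_S_def nc_T_def)

lemma nc_coeff_power_eq_0:
  assumes "nc_coeff f [] = 0" and "length w < n"
  shows "nc_coeff (f ^ n) w = 0"
  using assms(2)
proof (induction n arbitrary: w)
  case (Suc n)
  have "nc_coeff f (take i w) * nc_coeff (f ^ n) (drop i w) = 0" if "i \<le> length w" for i
  proof (cases "i = 0")
    case True
    then show ?thesis by (simp add: assms(1))
  next
    case False
    hence "length (drop i w) < n" using that Suc.prems by auto
    then show ?thesis using Suc.IH by simp
  qed
  thus ?case by (simp add: times_ncseries.rep_eq)
qed auto

lemma nc_coeff_sum: "nc_coeff (sum f A) w = (\<Sum>i\<in>A. nc_coeff (f i) w)"
  by (induction A rule: infinite_finite_induct) (auto simp: nc_coeff_simps)

text \<open>The inverse is the geometric series in 1 - g; at words of length N only its terms up to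
  degree N matter. The inverse is two-sided, hence it is the one picked by the description
  operator.\<close>

lemma nc_inverse_left:
  fixes g :: "'a::comm_ring_1 ncseries"
  assumes "nc_coeff g [] = 1"
  shows "nc_inverse g * g = 1"
proof -
  define e where "e = 1 - g"
  have e0: "nc_coeff e [] = 0" by (simp add: e_def assms nc_coeff_simps)
  define h where "h = Abs_nc (\<lambda>w. \<Sum>n\<le>length w. nc_coeff (e ^ n) w)"
  have h: "nc_coeff h w = nc_coeff (\<Sum>n\<le>N. e ^ n) w" if "length w \<le> N" for w N
    unfolding h_def nc_coeff_sum nc_coeff_Abs_nc
    by (rule sum.mono_neutral_left) (use that nc_coeff_power_eq_0[OF e0] in auto)
  have comm: "(\<Sum>n\<le>N. e ^ n) * e = e * (\<Sum>n\<le>N. e ^ n)" for N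
    by (simp add: sum_distrib_left sum_distrib_right power_commutes)
  have tel1: "(1 - e) * (\<Sum>n\<le>N. e ^ n) = 1 - e ^ Suc N" for N
  proof (induction N)
    case (Suc N)
    have "(1 - e) * (\<Sum>n\<le>Suc N. e ^ n) = (1 - e ^ Suc N) + (1 - e) * e ^ Suc N"
      unfolding sum.atMost_Suc distrib_left Suc.IH ..
    thus ?case by (simp add: left_diff_distrib)
  qed simp
  have tel: "(1 - e) * (\<Sum>n\<le>N. e ^ n) = 1 - e ^ Suc N \<and>
      (\<Sum>n\<le>N. e ^ n) * (1 - e) = 1 - e ^ Suc N" for N
    using tel1[of N] comm[of N] by (simp add: left_diff_distrib right_diff_distrib)
  have g: "g = 1 - e" by (simp add: e_def)
  have "g * h = 1"
  proof (rule ncseries_eqI)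
    fix w
    have "nc_coeff (g * h) w = nc_coeff (g * (\<Sum>n\<le>length w. e ^ n)) w"
      unfolding times_ncseries.rep_eq by (intro sum.cong refl arg_cong2[where f = "(*)"] h) auto
    also have "\<dots> = nc_coeff (1 - e ^ Suc (length w)) w"
      using tel unfolding g by metis
    also have "\<dots> = nc_coeff 1 w"
      using nc_coeff_power_eq_0[OF e0, of w "Suc (length w)"] by (simp add: minus_ncseries.rep_eq del: power_Suc)
    finally show "nc_coeff (g * h) w = nc_coeff 1 w" .
  qed
  moreover have "h * g = 1"
  proof (rule ncseries_eqI)
    fix w
    have "nc_coeff (h * g) w = nc_coeff ((\<Sum>n\<le>length w. e ^ n) * g) w"
      unfolding times_ncseries.rep_eq by (intro sum.cong refl arg_cong2[where f = "(*)"] h) auto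
    also have "\<dots> = nc_coeff (1 - e ^ Suc (length w)) w"
      using tel unfolding g by metis
    also have "\<dots> = nc_coeff 1 w"
      using nc_coeff_power_eq_0[OF e0, of w "Suc (length w)"] by (simp add: minus_ncseries.rep_eq del: power_Suc)
    finally show "nc_coeff (h * g) w = nc_coeff 1 w" .
  qed
  ultimately have "nc_inverse g = h"
    unfolding nc_inverse_def by (intro the_equality) (auto, metis mult.assoc mult_1 mult_1_right)
  with \<open>h * g = 1\<close> show ?thesis by simp
qed

lemma nc_exp_constant_coeff: "nc_coeff (nc_exp h) [] = 1"
  by (simp add: nc_exp_def nc_coeff_simps)

text \<open>The two words at which the forms are compared in degree 3.\<close>

lemma nc_coeff_T2_S:
  "nc_coeff (nc_ad nc_T (nc_ad nc_T nc_S)) [LS, LS, LT] = 0"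
  "nc_coeff (nc_ad nc_T (nc_ad nc_T nc_S)) [LS, LT, LT] = 1"
  by (simp_all add: nc_ad_def nc_coeff_simps)

lemma nc_coeff_nu_naive [simp]:
  "nc_coeff (nu_naive x y) w = (if w = [LS] then 1 / y else if w = [LT] then - x / y else 0)"
  by (simp add: nu_naive_def nc_coeff_simps)

lemma nc_coeff_nu_alg:
  "nc_coeff (nu_alg u v x y) w = nc_coeff (nu_naive x y) w +
     (\<Sum>n\<in>{2..<length w}. q_coeff n x y u v / y * nc_coeff ((nc_ad nc_T ^^ n) nc_S) w)"
  by (simp add: nu_alg_def nu_naive_def nc_coeff_simps del: nc_coeff_generators)

section \<open>Comparing coefficients of a gauge transformation\<close>

context elliptic_function_field
begin

lemma free_lie_coeff_KE: "f \<in> free_lie KE \<Longrightarrow> nc_coeff f w \<in> KE"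
proof (induction f arbitrary: w rule: free_lie.induct)
  case (bracket f g)
  show ?case
    unfolding nc_ad_def minus_ncseries.rep_eq times_ncseries.rep_eq
    by (intro KE_diff KE_sum KE_mult bracket.IH)
qed (auto simp: nc_coeff_simps)

lemma exp_coeff_KE:
  assumes "g \<in> exp_completed_free_lie KE"
  shows "nc_coeff g w \<in> KE"
proof -
  obtain h where h: "h \<in> completed_free_lie KE" "g = nc_exp h"
    using assms by (auto simp: exp_completed_free_lie_def)
  have "nc_coeff h w \<in> KE" for w
  proof -
    have "nc_homogeneous_part (length w) h \<in> free_lie KE"
      using h(1) by (simp add: completed_free_lie_def)
    from free_lie_coeff_KE[OF this, of w] show ?thesis
      by (simp add: nc_homogeneous_part_def)
  qed
  hence "nc_coeff (h ^ n) w \<in> KE" for n w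
    by (induction n arbitrary: w)
       (auto simp: one_ncseries.rep_eq times_ncseries.rep_eq intro!: KE_sum KE_mult)
  moreover have "fact n \<in> KE" for n
    using KE_of_nat[of "fact n"] by simp
  ultimately show ?thesis
    unfolding h(2) nc_exp_def nc_coeff_Abs_nc by (intro KE_sum KE_divide)
qed

text \<open>The words ST, SST and STT suffice: ST kills the linear part of g, SST forces the
  coefficient of ST to be 0, and STT forces it to be 1/2.\<close>

theorem no_gauge_transformation:
  assumes q2: "q_coeff 2 x y (\<iota> u) (\<iota> v) = - x / 2"
    and g0: "nc_coeff g [] = 1" and gKE: "\<And>w. nc_coeff g w \<in> KE"
  shows "nu_alg (\<iota> u) (\<iota> v) x y \<noteq>
             - nc_map D g * nc_inverse g + g * nu_naive x y * nc_inverse g"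
proof
  let ?nu = "nu_alg (\<iota> u) (\<iota> v) x y"
  assume eq: "?nu = - nc_map D g * nc_inverse g + g * nu_naive x y * nc_inverse g"
  have "?nu * g = - nc_map D g * (nc_inverse g * g) + g * nu_naive x y * (nc_inverse g * g)"
    by (subst eq) (simp only: distrib_right mult.assoc)
  hence "?nu * g = g * nu_naive x y - nc_map D g"
    by (simp add: nc_inverse_left[OF g0])
  hence "nc_map D g = g * nu_naive x y - ?nu * g" by simp
  hence D: "D (nc_coeff g w) = nc_coeff (g * nu_naive x y) w - nc_coeff (?nu * g) w" for w
    by (metis minus_ncseries.rep_eq nc_map.rep_eq)
  have const: "\<exists>k. nc_coeff g w = \<iota> k" if "D (nc_coeff g w) = 0" for w
    using exact_differential(3)[OF gKE, of w 0 0] that by simp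
  have q2': "q_coeff (Suc (Suc 0)) x y (\<iota> u) (\<iota> v) = - x / 2"
    using q2 by (metis numeral_2_eq_2)
  note simps = times_ncseries.rep_eq nc_coeff_nu_alg g0 sum.atLeast0_atMost_Suc nc_coeff_T2_S
  obtain s where s: "nc_coeff g [LS] = \<iota> s"
    using const[of "[LS]"] D[of "[LS]"] by (auto simp: simps)
  obtain t where t: "nc_coeff g [LT] = \<iota> t"
    using const[of "[LT]"] D[of "[LT]"] by (auto simp: simps)
  have "D (nc_coeff g [LS, LT]) = nc_coeff g [LS] * (- x / y) - 1 / y * nc_coeff g [LT]"
    using D[of "[LS, LT]"]  by (simp add: simps)
  also have "\<dots> = (\<iota> (- s) * x + \<iota> (- t)) / y"
    by (simp add: s t diff_divide_distrib add_divide_distrib algebra_simps)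
  finally have *: "D (nc_coeff g [LS, LT]) = (\<iota> (- s) * x + \<iota> (- t)) / y" .
  from exact_differential[OF gKE *]
  obtain c where c: "nc_coeff g [LS, LT] = \<iota> c" and "s = 0" "t = 0" by auto
  obtain e where e: "nc_coeff g [LS, LS] = \<iota> e"
    using const[of "[LS, LS]"] D[of "[LS, LS]"] s \<open>s = 0\<close> by (auto simp: simps)
  obtain f where f: "nc_coeff g [LT, LT] = \<iota> f"
    using const[of "[LT, LT]"] D[of "[LT, LT]"] t \<open>t = 0\<close> by (auto simp: simps)
  have "D (nc_coeff g [LS, LS, LT]) = nc_coeff g [LS, LS] * (- x / y) - 1 / y * nc_coeff g [LS, LT]"
    using D[of "[LS, LS, LT]"] t \<open>t = 0\<close> by (simp add: simps)
  also have "\<dots> = (\<iota> (- e) * x + \<iota> (- c)) / y"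
    by (simp add: e c diff_divide_distrib add_divide_distrib algebra_simps)
  finally have *: "D (nc_coeff g [LS, LS, LT]) = (\<iota> (- e) * x + \<iota> (- c)) / y" .
  from exact_differential(2)[OF gKE *] have "c = 0" by simp
  have half: "\<iota> (1 / 2) = 1 / 2"
  proof -
    have "\<iota> (1 / 2) * \<iota> 2 = \<iota> (1 / 2 * 2)" by (simp only: embedding)
    thus ?thesis by simp
  qed
  have "D (nc_coeff g [LS, LT, LT]) = nc_coeff g [LS, LT] * (- x / y) - 1 / y * nc_coeff g [LT, LT] - (- x / 2) / y"
    using D[of "[LS, LT, LT]"] t \<open>t = 0\<close> q2' by (simp add: simps)
  also have "\<dots> = (\<iota> (1 / 2 - c) * x + \<iota> (- f)) / y"
    by (simp add: c f half diff_divide_distrib add_divide_distrib algebra_simps)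
  finally have *: "D (nc_coeff g [LS, LT, LT]) = (\<iota> (1 / 2 - c) * x + \<iota> (- f)) / y" .
  from exact_differential(1)[OF gKE *] \<open>c = 0\<close> show False by simp
qed

end

section \<open>Sums over the integers and over pairs of integers\<close>

lemma summable_on_int_even:
  fixes f :: "int \<Rightarrow> real"
  assumes "(\<lambda>n::nat. f (int n)) summable_on UNIV" and even: "\<And>n. f (- n) = f n"
  shows "f summable_on UNIV"
proof -
  have 1: "f summable_on range int"
    using assms(1) by (subst summable_on_reindex) (auto simp: o_def)
  have "(\<lambda>n::nat. f (- int n)) summable_on UNIV" using assms(1) by (simp add: even)
  hence 2: "f summable_on range (\<lambda>n. - int n)"
    by (subst summable_on_reindex) (auto simp: o_def inj_def)
  have "(UNIV :: int set) = range int \<union> range (\<lambda>n. - int n)"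
  proof safe
    fix k :: int assume "k \<notin> range (\<lambda>n. - int n)"
    hence "\<not> k < 0" by (metis minus_minus rangeI negD)
    thus "k \<in> range int" by (metis nat_0_le not_le rangeI)
  qed auto
  with summable_on_union[OF 1 2] show ?thesis by simp
qed

lemma summable_on_int_powr:
  assumes "s > (1 :: real)"
  shows "(\<lambda>n::int. (1 + \<bar>of_int n\<bar>) powr (-s)) summable_on UNIV"
proof (rule summable_on_int_even)
  have "summable (\<lambda>n. of_nat n powr (-s) :: real)"
    using assms by (subst summable_real_powr_iff) auto
  hence "summable (\<lambda>n. of_nat (Suc n) powr (-s) :: real)" by (subst summable_Suc_iff)
  hence "(\<lambda>n. of_nat (Suc n) powr (-s) :: real) summable_on UNIV"
    by (subst summable_on_UNIV_nonneg_real_iff) auto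
  thus "(\<lambda>n::nat. (1 + \<bar>real_of_int (int n)\<bar>) powr (-s)) summable_on UNIV" by simp
qed auto

lemma summable_on_product_real:
  fixes f :: "'a \<Rightarrow> real" and g :: "'b \<Rightarrow> real"
  assumes "f summable_on A" "g summable_on B" "\<And>x. f x \<ge> 0" "\<And>x. g x \<ge> 0"
  shows "((\<lambda>(x, y). f x * g y) has_sum (infsum f A * infsum g B)) (A \<times> B)"
proof (rule has_sum_SigmaI)
  show "((\<lambda>y. case (x, y) of (x, y) \<Rightarrow> f x * g y) has_sum (f x * infsum g B)) B" for x
    using assms(2) by (auto intro!: has_sum_cmult_right)
  show "((\<lambda>x. f x * infsum g B) has_sum (infsum f A * infsum g B)) A"
    using assms(1) by (auto intro!: has_sum_cmult_left)
  show "(\<lambda>(x, y). f x * g y) summable_on A \<times> B"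
  proof (rule summable_on_SigmaI)
    show "((\<lambda>y. case (x, y) of (x, y) \<Rightarrow> f x * g y) has_sum (f x * infsum g B)) B" for x
      using assms(2) by (auto intro!: has_sum_cmult_right)
    show "(\<lambda>x. f x * infsum g B) summable_on A"
      using assms(1) by (rule summable_on_cmult_left)
  qed (use assms in auto)
qed

definition weight :: "int \<times> int \<Rightarrow> real" where
  "weight p = 1 + \<bar>of_int (fst p)\<bar> + \<bar>of_int (snd p)\<bar>"

lemma weight_ge_1: "weight p \<ge> 1"
  by (simp add: weight_def)

text \<open>The product of 1 + |n| and 1 + |m| is at most the square of the weight, so that the
  summand is dominated by a product of convergent one-dimensional series with exponent 3/2.\<close>

lemma summable_on_weight: "(\<lambda>p. 1 / weight p ^ 3) summable_on UNIV"
proof -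
  let ?f = "\<lambda>n::int. (1 + \<bar>of_int n\<bar> :: real) powr (- (3/2))"
  have "(\<lambda>(n, m). ?f n * ?f m) summable_on (UNIV \<times> UNIV)"
    using summable_on_product_real[OF summable_on_int_powr summable_on_int_powr, of "3/2" "3/2"]
    by (auto dest: has_sum_imp_summable)
  hence "(\<lambda>(n, m). ?f n * ?f m) summable_on UNIV" by simp
  thus ?thesis
  proof (rule summable_on_comparison_test)
    fix p :: "int \<times> int"
    obtain n m where p: "p = (n, m)" by (cases p)
    let ?a = "1 + \<bar>of_int n\<bar> :: real" and ?b = "1 + \<bar>of_int m\<bar> :: real"
    have pos: "weight p > 0" using weight_ge_1[of p] by linarith
    have "?a * ?b \<le> weight p * weight p"
      by (rule mult_mono) (auto simp: weight_def p)
    hence "(?a * ?b) powr (3/2) \<le> (weight p ^ 2) powr (3/2)"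
      by (intro powr_mono2) (auto simp: power2_eq_square)
    also have "(weight p ^ 2) powr (3/2) = weight p powr (2 * (3/2))"
      using pos by (subst powr_powr[symmetric]) (auto simp: powr_numeral)
    also have "\<dots> = weight p ^ 3" using pos by (simp add: powr_numeral)
    finally have "1 / weight p ^ 3 \<le> 1 / (?a * ?b) powr (3/2)"
      by (intro divide_left_mono) (auto intro!: mult_pos_pos simp: pos add_pos_nonneg)
    also have "\<dots> = ?f n * ?f m" by (simp add: powr_mult powr_minus_divide)
    finally show "1 / weight p ^ 3 \<le> (case p of (n, m) \<Rightarrow> ?f n * ?f m)" by (simp add: p)
    show "0 \<le> 1 / weight p ^ 3" using pos by simp
  qed
qed

lemma summable_on_cofinite:
  fixes f :: "'a \<Rightarrow> 'b :: {uniform_topological_group_add, topological_comm_monoid_add, ab_group_add, complete_uniform_space}"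
  assumes "finite F" "f summable_on (- F)"
  shows "f summable_on UNIV"
  using summable_on_union[of f F "- F"] assms by simp

lemma inverse_square_summable_on_int:
  fixes z :: complex
  shows "(\<lambda>m::int. 1 / (z + of_int m) ^ 2) summable_on UNIV"
proof (rule summable_on_cofinite)
  define N where "N = \<lceil>2 * norm z\<rceil> + 1"
  show "finite {-N..N}" by simp
  show "(\<lambda>m::int. 1 / (z + of_int m) ^ 2) summable_on (- {-N..N})"
  proof (rule abs_summable_summable, rule Infinite_Sum.abs_summable_on_comparison_test')
    have "(\<lambda>m::int. 16 * (1 + \<bar>of_int m\<bar> :: real) powr (-2)) summable_on UNIV"
      by (intro summable_on_cmult_right summable_on_int_powr) auto
    thus "(\<lambda>m::int. 16 * (1 + \<bar>of_int m\<bar> :: real) powr (-2)) summable_on (- {-N..N})"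
      by (rule summable_on_subset) auto
    fix m assume "m \<in> - {-N..N}"
    hence "\<bar>m\<bar> > N" by auto
    hence m: "\<bar>real_of_int m\<bar> > of_int N" by linarith
    have N: "of_int N \<ge> 2 * norm z + 1" unfolding N_def by linarith
    have "norm (of_int m :: complex) \<le> norm (z + of_int m) + norm z"
      by (metis add.commute add_diff_cancel_left' norm_triangle_ineq4)
    hence "norm (z + of_int m) \<ge> (1 + \<bar>of_int m\<bar>) / 4"
      using m N norm_ge_zero[of z] by simp
    hence "((1 + \<bar>of_int m\<bar>) / 4) ^ 2 \<le> norm (z + of_int m) ^ 2"
      by (intro power_mono) auto
    hence "1 / norm (z + of_int m) ^ 2 \<le> 1 / ((1 + \<bar>of_int m\<bar>) / 4) ^ 2"
      by (intro divide_left_mono) (auto simp: add_pos_nonneg intro!: mult_pos_pos zero_less_power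
           order.strict_trans2[OF _ \<open>norm (z + of_int m) \<ge> (1 + \<bar>of_int m\<bar>) / 4\<close>])
    thus "norm (1 / (z + of_int m) ^ 2) \<le> 16 * (1 + \<bar>of_int m\<bar>) powr (-2)"
      by (simp add: norm_divide norm_power powr_minus_divide powr_numeral power_divide)
  qed
qed

lemma has_sum_int_symmetric:
  assumes "(f has_sum S) (UNIV :: int set)"
  shows "(\<lambda>N::nat. \<Sum>n\<in>{-int N..int N}. f n) \<longlonglongrightarrow> S"
proof -
  have "filterlim (\<lambda>N::nat. {-int N..int N}) (finite_subsets_at_top UNIV) sequentially"
    unfolding filterlim_finite_subsets_at_top
  proof safe
    fix X :: "int set" assume X: "finite X"
    obtain B where B: "\<And>x. x \<in> X \<Longrightarrow> \<bar>x\<bar> \<le> B"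
      using X by (metis finite_imageI Max_ge imageI)
    show "eventually (\<lambda>N. finite {- int N..int N} \<and> X \<subseteq> {- int N..int N} \<and> {- int N..int N} \<subseteq> UNIV)
            sequentially"
      using eventually_ge_at_top[of "nat B"]
    proof eventually_elim
      case (elim N)
      have "x \<in> {- int N..int N}" if "x \<in> X" for x using B[OF that] elim by auto
      thus ?case by auto
    qed
  qed
  from filterlim_compose[OF assms[unfolded has_sum_def] this] show ?thesis .
qed

lemma holomorphic_on_infsum:
  fixes f :: "'a \<Rightarrow> complex \<Rightarrow> complex"
  assumes U: "open U" and hol: "\<And>p. p \<in> X \<Longrightarrow> f p holomorphic_on U"
    and bound: "\<And>p z. p \<in> X \<Longrightarrow> z \<in> U \<Longrightarrow> norm (f p z) \<le> M p" and M: "M summable_on X"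
  shows "(\<lambda>z. \<Sum>\<^sub>\<infinity>p\<in>X. f p z) holomorphic_on U"
proof -
  let ?g = "\<lambda>z. \<Sum>\<^sub>\<infinity>p\<in>X. f p z"
  have "?g field_differentiable at z" if z: "z \<in> U" for z
  proof -
    obtain r where r: "r > 0" "cball z r \<subseteq> U" using U z open_contains_cball by blast
    have ul: "uniform_limit (cball z r) (\<lambda>Y w. \<Sum>p\<in>Y. f p w) ?g (finite_subsets_at_top X)"
      by (rule Weierstrass_m_test_general[OF _ M]) (use bound r in auto)
    have "\<forall>\<^sub>F Y in finite_subsets_at_top X.
        continuous_on (cball z r) (\<lambda>w. \<Sum>p\<in>Y. f p w) \<and> (\<lambda>w. \<Sum>p\<in>Y. f p w) holomorphic_on ball z r"
    proof (rule eventually_finite_subsets_at_top_weakI)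
      fix Y assume "finite Y" "Y \<subseteq> X"
      hence "(\<lambda>w. \<Sum>p\<in>Y. f p w) holomorphic_on U" using hol by (intro holomorphic_intros) auto
      moreover have "ball z r \<subseteq> U" using r(2) by auto
      ultimately show "continuous_on (cball z r) (\<lambda>w. \<Sum>p\<in>Y. f p w) \<and> (\<lambda>w. \<Sum>p\<in>Y. f p w) holomorphic_on ball z r"
        using r(2) by (meson holomorphic_on_imp_continuous_on holomorphic_on_subset)
    qed
    from holomorphic_uniform_limit[OF this ul] have "?g holomorphic_on ball z r" by auto
    thus ?thesis using r by (simp add: holomorphic_on_imp_differentiable_at)
  qed
  thus ?thesis using U by (simp add: field_differentiable_at_within holomorphic_onI)
qed

section \<open>The Weierstrass function of a lattice\<close>

lemma has_sum_diff:
  fixes f g :: "'a \<Rightarrow> 'b :: {topological_ab_group_add, t2_space}"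
  assumes "(f has_sum S) A" "(g has_sum T) A"
  shows "((\<lambda>x. f x - g x) has_sum (S - T)) A"
  using has_sum_add[OF assms(1), of "\<lambda>x. - g x" "- T"] assms(2) by (simp add: has_sum_uminus)

lemma summable_on_diff:
  fixes f g :: "'a \<Rightarrow> 'b :: {topological_ab_group_add, t2_space}"
  assumes "f summable_on A" "g summable_on A"
  shows "(\<lambda>x. f x - g x) summable_on A"
  using has_sum_diff[OF has_sum_infsum[OF assms(1)] has_sum_infsum[OF assms(2)]]
  by (auto simp: summable_on_def)

lemma infsum_diff:
  fixes f g :: "'a \<Rightarrow> 'b :: {topological_ab_group_add, t2_space}"
  assumes "f summable_on A" "g summable_on A"
  shows "(\<Sum>\<^sub>\<infinity>x\<in>A. f x - g x) = infsum f A - infsum g A"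
  using has_sum_diff[OF has_sum_infsum[OF assms(1)] has_sum_infsum[OF assms(2)]]
  by (rule infsumI)

definition lat :: "complex \<Rightarrow> int \<times> int \<Rightarrow> complex" where
  "lat \<tau> p = of_int (fst p) * \<tau> + of_int (snd p)"

text \<open>The origin contributes 1 / 0 = 0, so the sum extends over the nonzero lattice points.\<close>

definition lattice_e :: "complex \<Rightarrow> nat \<Rightarrow> complex" where
  "lattice_e \<tau> k = (\<Sum>\<^sub>\<infinity>p. 1 / lat \<tau> p ^ k)"

lemma lat_simps [simp]: "lat \<tau> (0, 0) = 0" "lat \<tau> (1, 0) = \<tau>" "lat \<tau> (0, 1) = 1"
  by (simp_all add: lat_def)

lemma lat_uminus: "lat \<tau> (- p) = - lat \<tau> p"
  by (simp add: lat_def)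

lemma lat_add: "lat \<tau> (p + q) = lat \<tau> p + lat \<tau> q"
  by (simp add: lat_def algebra_simps)

lemma lattice_e_odd:
  assumes "odd k"
  shows "lattice_e \<tau> k = 0"
proof -
  have "lattice_e \<tau> k = (\<Sum>\<^sub>\<infinity>p. 1 / lat \<tau> (- p) ^ k)"
    unfolding lattice_e_def
    by (rule infsum_reindex_bij_witness[of _ uminus uminus]) auto
  also have "\<dots> = (\<Sum>\<^sub>\<infinity>p. - (1 / lat \<tau> p ^ k))"
    using assms by (simp add: lat_uminus)
  also have "\<dots> = - lattice_e \<tau> k"
    unfolding lattice_e_def by (rule infsum_uminus)
  finally show ?thesis by simp
qed

lemma norm_shift_ge:
  fixes w z :: complex
  assumes "norm z \<le> R" "2 * R \<le> norm w"
  shows "norm (z + w) \<ge> norm w / 2"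
proof -
  have "norm w \<le> norm (z + w) + norm z"
    by (metis add.commute add_diff_cancel_left' norm_triangle_ineq4)
  with assms show ?thesis by simp
qed

locale upper_half_plane =
  fixes \<tau> :: complex
  assumes Im_pos: "Im \<tau> > 0"
begin

abbreviation "\<omega> \<equiv> lat \<tau>"

text \<open>The imaginary part controls n, and then the real part controls m.\<close>

lemma lat_lower_bound:
  obtains C where "C > 0" "\<And>p. p \<noteq> (0, 0) \<Longrightarrow> weight p \<le> C * norm (\<omega> p)"
proof -
  define B where "B = 1 / Im \<tau> + 1 + norm \<tau> / Im \<tau>"
  have B: "B > 0" unfolding B_def using Im_pos by (intro add_pos_nonneg add_pos_pos) auto
  have *: "weight p \<le> 2 * B * norm (\<omega> p)" if p: "p \<noteq> (0, 0)" for p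
  proof -
    obtain n m where nm: "p = (n, m)" by (cases p)
    have "\<bar>of_int n\<bar> * Im \<tau> = \<bar>Im (\<omega> p)\<bar>" using Im_pos by (simp add: lat_def nm abs_mult)
    also have "\<dots> \<le> norm (\<omega> p)" by (rule abs_Im_le_cmod)
    finally have n: "\<bar>of_int n\<bar> \<le> norm (\<omega> p) / Im \<tau>" using Im_pos by (simp add: field_simps)
    have "\<bar>of_int m\<bar> = norm (\<omega> p - of_int n * \<tau>)" by (simp add: lat_def nm)
    also have "\<dots> \<le> norm (\<omega> p) + norm (of_int n * \<tau>)" by (rule norm_triangle_ineq4)
    also have "norm (of_int n * \<tau>) = \<bar>of_int n\<bar> * norm \<tau>" by (simp add: norm_mult)
    also have "\<dots> \<le> norm (\<omega> p) / Im \<tau> * norm \<tau>" by (intro mult_right_mono n) auto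
    finally have "\<bar>of_int n\<bar> + \<bar>of_int m\<bar> \<le> B * norm (\<omega> p)"
      using n by (simp add: B_def algebra_simps)
    moreover have "\<bar>n\<bar> + \<bar>m\<bar> \<ge> 1" using p nm by auto
    hence "\<bar>of_int n\<bar> + \<bar>of_int m\<bar> \<ge> (1::real)" by linarith
    ultimately show ?thesis by (simp add: weight_def nm)
  qed
  show ?thesis by (rule that[of "2 * B"]) (use B * in auto)
qed

lemma lat_eq_0_iff [simp]: "\<omega> p = 0 \<longleftrightarrow> p = (0, 0)"
proof -
  obtain C where C: "C > 0" "\<And>p. p \<noteq> (0, 0) \<Longrightarrow> weight p \<le> C * norm (\<omega> p)"
    using lat_lower_bound by blast
  show ?thesis
  proof (cases "p = (0, 0)")
    case False
    hence "\<omega> p \<noteq> 0" using C(2)[OF False] weight_ge_1[of p] by auto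
    with False show ?thesis by simp
  qed simp
qed

lemma summable_norm_lat:
  assumes "k \<ge> 3"
  shows "(\<lambda>p. 1 / norm (\<omega> p) ^ k) summable_on A"
proof -
  obtain C where C: "C > 0" "\<And>p. p \<noteq> (0, 0) \<Longrightarrow> weight p \<le> C * norm (\<omega> p)"
    using lat_lower_bound by blast
  have "(\<lambda>p. C ^ k * (1 / weight p ^ 3)) summable_on UNIV"
    by (intro summable_on_cmult_right summable_on_weight)
  hence "(\<lambda>p. 1 / norm (\<omega> p) ^ k) summable_on UNIV"
  proof (rule summable_on_comparison_test)
    fix p
    have w: "weight p > 0" using weight_ge_1[of p] by linarith
    show "1 / norm (\<omega> p) ^ k \<le> C ^ k * (1 / weight p ^ 3)"
    proof (cases "p = (0, 0)")
      case True
      then show ?thesis using assms C w by (simp add: power_0_left)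
    next
      case False
      have "weight p ^ 3 \<le> weight p ^ k" using weight_ge_1 assms by (intro power_increasing) auto
      also have "\<dots> \<le> (C * norm (\<omega> p)) ^ k" using C(2)[OF False] w by (intro power_mono) auto
      finally have "weight p ^ 3 \<le> C ^ k * norm (\<omega> p) ^ k" by (simp add: power_mult_distrib)
      moreover have "norm (\<omega> p) ^ k > 0" using False by simp
      ultimately show ?thesis using w by (simp add: field_simps)
    qed
  qed auto
  thus ?thesis by (rule summable_on_subset) auto
qed

lemma summable_lat:
  assumes "k \<ge> 3"
  shows "(\<lambda>p. 1 / \<omega> p ^ k) summable_on A"
  by (rule abs_summable_summable)
     (use summable_norm_lat[OF assms] in \<open>simp add: norm_divide norm_power\<close>)

lemma finite_lat_ball: "finite {p. norm (\<omega> p) < R}"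
proof -
  obtain C where C: "C > 0" "\<And>p. p \<noteq> (0, 0) \<Longrightarrow> weight p \<le> C * norm (\<omega> p)"
    using lat_lower_bound by blast
  define N where "N = \<lceil>C * R\<rceil>"
  have "{p. norm (\<omega> p) < R} \<subseteq> insert (0, 0) ({-N..N} \<times> {-N..N})"
  proof
    fix p assume p: "p \<in> {p. norm (\<omega> p) < R}"
    show "p \<in> insert (0, 0) ({-N..N} \<times> {-N..N})"
    proof (cases "p = (0, 0)")
      case False
      have "weight p \<le> C * norm (\<omega> p)" by (rule C(2)[OF False])
      also have "\<dots> \<le> C * R" using p C by (intro mult_left_mono) auto
      finally have wR: "weight p \<le> C * R" .
      have "\<bar>of_int (fst p)\<bar> \<le> C * R" "\<bar>of_int (snd p)\<bar> \<le> C * R"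
        using wR by (auto simp: weight_def)
      note le = this[THEN order_trans[OF _ le_of_int_ceiling]]
      have "of_int \<bar>fst p\<bar> \<le> (of_int N :: real)" "of_int \<bar>snd p\<bar> \<le> (of_int N :: real)"
        unfolding N_def of_int_abs by (fact le)+
      hence "\<bar>fst p\<bar> \<le> N" "\<bar>snd p\<bar> \<le> N" by (simp_all only: of_int_le_iff)
      hence "p \<in> {-N..N} \<times> {-N..N}" by (cases p) auto
      thus ?thesis by (rule insertI2)
    qed simp
  qed
  moreover have "finite (insert (0, 0) ({-N..N} \<times> {-N..N}))" by simp
  ultimately show ?thesis by (rule finite_subset)
qed

text \<open>At the origin the second fraction is 1 / 0 = 0, so that the sum of all terms is the
  Weierstrass function with its usual exceptional summand.\<close>

definition wp_term :: "complex \<Rightarrow> int \<times> int \<Rightarrow> complex" where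
  "wp_term \<xi> p = 1 / (\<xi> + \<omega> p) ^ 2 - 1 / \<omega> p ^ 2"

definition wp :: "complex \<Rightarrow> complex" where
  "wp \<xi> = (\<Sum>\<^sub>\<infinity>p. wp_term \<xi> p)"

text \<open>This is -1/2 times the derivative of the Weierstrass function; it is treated as a
  function of its own, so that no series has to be differentiated term by term.\<close>

definition E3 :: "complex \<Rightarrow> complex" where
  "E3 \<xi> = (\<Sum>\<^sub>\<infinity>p. 1 / (\<xi> + \<omega> p) ^ 3)"

lemma wp_term_bound:
  assumes "norm \<xi> \<le> R" "2 * R \<le> norm (\<omega> p)" "R > 0"
  shows "norm (wp_term \<xi> p) \<le> 10 * R * (1 / norm (\<omega> p) ^ 3)"
proof -
  let ?w = "\<omega> p"
  have w: "norm ?w > 0" using assms by linarith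
  have s: "norm (\<xi> + ?w) \<ge> norm ?w / 2" by (rule norm_shift_ge[OF assms(1,2)])
  hence "\<xi> + ?w \<noteq> 0" using w by auto
  hence "wp_term \<xi> p = - (\<xi> * (2 * ?w + \<xi>)) / ((\<xi> + ?w) ^ 2 * ?w ^ 2)"
    using w unfolding wp_term_def by (simp add: divide_simps) (simp add: algebra_simps power2_eq_square)
  hence "norm (wp_term \<xi> p) = norm \<xi> * norm (2 * ?w + \<xi>) / (norm (\<xi> + ?w) ^ 2 * norm ?w ^ 2)"
    by (simp add: norm_divide norm_mult norm_power)
  also have "\<dots> \<le> R * (5 / 2 * norm ?w) / ((norm ?w / 2) ^ 2 * norm ?w ^ 2)"
  proof (rule frac_le)
    have "norm (2 * ?w + \<xi>) \<le> 2 * norm ?w + norm \<xi>"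
      using norm_triangle_ineq[of "2 * ?w" \<xi>] by (simp add: norm_mult)
    also have "\<dots> \<le> 5 / 2 * norm ?w" using assms by simp
    finally show "norm \<xi> * norm (2 * ?w + \<xi>) \<le> R * (5 / 2 * norm ?w)"
      using assms by (intro mult_mono) auto
    show "(norm ?w / 2) ^ 2 * norm ?w ^ 2 \<le> norm (\<xi> + ?w) ^ 2 * norm ?w ^ 2"
      using s by (intro mult_right_mono power_mono) auto
  qed (use assms w in auto)
  also have "\<dots> = 10 * R * (1 / norm ?w ^ 3)"
    using w by (simp add: field_simps power2_eq_square power3_eq_cube)
  finally show ?thesis .
qed

lemma E3_term_bound:
  assumes "norm \<xi> \<le> R" "2 * R \<le> norm (\<omega> p)" "R > 0"
  shows "norm (1 / (\<xi> + \<omega> p) ^ 3) \<le> 8 * (1 / norm (\<omega> p) ^ 3)"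
proof -
  let ?w = "\<omega> p"
  have w: "norm ?w > 0" using assms by linarith
  have s: "norm (\<xi> + ?w) \<ge> norm ?w / 2" by (rule norm_shift_ge[OF assms(1,2)])
  have "1 / norm (\<xi> + ?w) ^ 3 \<le> 1 / (norm ?w / 2) ^ 3"
    using s w by (intro divide_left_mono power_mono mult_pos_pos zero_less_power) auto
  thus ?thesis by (simp add: norm_divide norm_power power_divide)
qed

lemma summable_wp: "wp_term \<xi> summable_on A"
proof -
  define R where "R = norm \<xi> + 1"
  have R: "R > 0" "norm \<xi> \<le> R" by (auto simp: R_def add_nonneg_pos)
  have "wp_term \<xi> summable_on (- {p. norm (\<omega> p) < 2 * R})"
  proof (rule abs_summable_summable, rule Infinite_Sum.abs_summable_on_comparison_test')
    show "(\<lambda>p. 10 * R * (1 / norm (\<omega> p) ^ 3)) summable_on (- {p. norm (\<omega> p) < 2 * R})"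
      by (intro summable_on_cmult_right summable_norm_lat) auto
  qed (use wp_term_bound R in auto)
  from summable_on_cofinite[OF finite_lat_ball this] show ?thesis
    by (rule summable_on_subset) auto
qed

lemma summable_E3: "(\<lambda>p. 1 / (\<xi> + \<omega> p) ^ 3) summable_on A"
proof -
  define R where "R = norm \<xi> + 1"
  have R: "R > 0" "norm \<xi> \<le> R" by (auto simp: R_def add_nonneg_pos)
  have "(\<lambda>p. 1 / (\<xi> + \<omega> p) ^ 3) summable_on (- {p. norm (\<omega> p) < 2 * R})"
  proof (rule abs_summable_summable, rule Infinite_Sum.abs_summable_on_comparison_test')
    show "(\<lambda>p. 8 * (1 / norm (\<omega> p) ^ 3)) summable_on (- {p. norm (\<omega> p) < 2 * R})"
      by (intro summable_on_cmult_right summable_norm_lat) auto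
  qed (use E3_term_bound R in auto)
  from summable_on_cofinite[OF finite_lat_ball this] show ?thesis
    by (rule summable_on_subset) auto
qed

text \<open>Near a given point only finitely many terms are not dominated by a multiple of the inverse
  cube of the lattice point; the others form a uniformly convergent series.\<close>

lemma holomorphic_off_lattice:
  assumes "\<xi> \<notin> range \<omega>"
  shows "wp field_differentiable at \<xi>" "E3 field_differentiable at \<xi>"
proof -
  define R where "R = norm \<xi> + 1"
  have R: "R > 0" "norm \<xi> < R" by (auto simp: R_def add_nonneg_pos)
  define F where "F = {p. norm (\<omega> p) < 2 * R}"
  have F: "finite F" unfolding F_def by (rule finite_lat_ball)
  define U where "U = ball 0 R - (\<lambda>p. - \<omega> p) ` F"
  have U: "open U" unfolding U_def using F by (intro open_Diff finite_imp_closed) auto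
  have \<xi>: "\<xi> \<in> U"
  proof -
    have "\<xi> \<noteq> - \<omega> p" for p using assms lat_uminus[of \<tau> p] by (metis rangeI)
    thus ?thesis using R by (auto simp: U_def)
  qed
  have nz: "z + \<omega> p \<noteq> 0" if "z \<in> U" "p \<in> F" for z p
    using that by (auto simp: U_def image_iff add_eq_0_iff2)
  have nz': "z + \<omega> p \<noteq> 0" if "z \<in> U" for z p
  proof (cases "p \<in> F")
    case False
    hence "2 * R \<le> norm (\<omega> p)" by (auto simp: F_def)
    moreover have "norm z \<le> R" using that by (auto simp: U_def)
    ultimately have "norm (z + \<omega> p) \<ge> norm (\<omega> p) / 2" "norm (\<omega> p) > 0"
      using norm_shift_ge R by (blast, linarith)
    thus ?thesis by auto
  qed (use nz that in auto)
  have split: "wp z = (\<Sum>p\<in>F. wp_term z p) + (\<Sum>\<^sub>\<infinity>p\<in>-F. wp_term z p)"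
    "E3 z = (\<Sum>p\<in>F. 1 / (z + \<omega> p) ^ 3) + (\<Sum>\<^sub>\<infinity>p\<in>-F. 1 / (z + \<omega> p) ^ 3)" for z
    using infsum_Un_disjoint[OF summable_wp[of z F] summable_wp[of z "-F"]]
      infsum_Un_disjoint[OF summable_E3[of z F] summable_E3[of z "-F"]] F
    by (simp_all add: wp_def E3_def)
  have "(\<lambda>z. (\<Sum>p\<in>F. wp_term z p) + (\<Sum>\<^sub>\<infinity>p\<in>-F. wp_term z p)) holomorphic_on U"
  proof (intro holomorphic_intros holomorphic_on_infsum[OF U])
    show "(\<lambda>z. wp_term z p) holomorphic_on U" for p
      unfolding wp_term_def using nz' by (intro holomorphic_intros) auto
    thus "(\<lambda>z. wp_term z p) holomorphic_on U" for p .
    show "(\<lambda>p. 10 * R * (1 / norm (\<omega> p) ^ 3)) summable_on - F"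
      by (intro summable_on_cmult_right summable_norm_lat) auto
    show "norm (wp_term z p) \<le> 10 * R * (1 / norm (\<omega> p) ^ 3)" if "p \<in> - F" "z \<in> U" for p z
      by (rule wp_term_bound) (use that R in \<open>auto simp: F_def U_def\<close>)
  qed
  hence "wp holomorphic_on U" unfolding split(1)[abs_def, symmetric] .
  thus "wp field_differentiable at \<xi>"
    using U \<xi> by (simp add: holomorphic_on_imp_differentiable_at)
  have "(\<lambda>z. (\<Sum>p\<in>F. 1 / (z + \<omega> p) ^ 3) + (\<Sum>\<^sub>\<infinity>p\<in>-F. 1 / (z + \<omega> p) ^ 3)) holomorphic_on U"
  proof (intro holomorphic_on_add holomorphic_on_sum holomorphic_on_infsum[OF U])
    show "(\<lambda>z. 1 / (z + \<omega> p) ^ 3) holomorphic_on U" for p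
      using nz' by (intro holomorphic_intros) auto
    thus "(\<lambda>z. 1 / (z + \<omega> p) ^ 3) holomorphic_on U" for p .
    show "(\<lambda>p. 8 * (1 / norm (\<omega> p) ^ 3)) summable_on - F"
      by (intro summable_on_cmult_right summable_norm_lat) auto
    show "norm (1 / (z + \<omega> p) ^ 3) \<le> 8 * (1 / norm (\<omega> p) ^ 3)" if "p \<in> - F" "z \<in> U" for p z
      by (rule E3_term_bound) (use that R in \<open>auto simp: F_def U_def\<close>)
  qed
  hence "E3 holomorphic_on U" unfolding split(2)[abs_def, symmetric] .
  thus "E3 field_differentiable at \<xi>"
    using U \<xi> by (simp add: holomorphic_on_imp_differentiable_at)
qed

lemma wp_even: "wp (- \<xi>) = wp \<xi>"
  unfolding wp_def
  by (rule infsum_reindex_bij_witness[of _ uminus uminus])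
     (auto simp: wp_term_def lat_uminus power2_eq_square algebra_simps)

lemma E3_odd: "E3 (- \<xi>) = - E3 \<xi>"
proof -
  have "E3 (- \<xi>) = (\<Sum>\<^sub>\<infinity>p. - (1 / (\<xi> + \<omega> p) ^ 3))"
    unfolding E3_def
  proof (rule infsum_reindex_bij_witness[of _ uminus uminus])
    fix p
    have "(- \<xi> + \<omega> p) ^ 3 = - ((\<xi> + \<omega> (- p)) ^ 3)"
      by (simp add: lat_uminus power3_eq_cube algebra_simps)
    thus "- (1 / (\<xi> + \<omega> (- p)) ^ 3) = 1 / (- \<xi> + \<omega> p) ^ 3" by simp
  qed auto
  also have "\<dots> = - E3 \<xi>" unfolding E3_def by (rule infsum_uminus)
  finally show ?thesis .
qed

lemma E3_periodic: "E3 (\<xi> + \<omega> q) = E3 \<xi>"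
  unfolding E3_def
  by (rule infsum_reindex_bij_witness[of _ "\<lambda>p. p - q" "\<lambda>p. p + q"])
     (auto simp: lat_add algebra_simps)

lemma tau_nonzero [simp]: "\<tau> \<noteq> 0"
  using Im_pos by auto

text \<open>The difference of two translates is a double series of differences of inverse squares of
  consecutive lattice translates. It converges absolutely and may be summed first in the direction
  of the period, where it is the difference of two equal series.\<close>

lemma wp_periodic_1: "wp (\<xi> + 1) = wp \<xi>"
proof -
  define G where "G = (\<lambda>n m. 1 / (\<xi> + \<omega> (n, m)) ^ 2)"
  have d: "wp_term (\<xi> + 1) (n, m) - wp_term \<xi> (n, m) = G n (m + 1) - G n m" for n m
    by (simp add: wp_term_def G_def lat_def algebra_simps)
  have sG: "G n summable_on UNIV" for n
    using inverse_square_summable_on_int[of "\<xi> + of_int n * \<tau>"]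
    by (simp add: G_def lat_def add.assoc)
  have sG': "(\<lambda>m. G n (m + 1)) summable_on UNIV" and eG: "(\<Sum>\<^sub>\<infinity>m. G n (m + 1)) = (\<Sum>\<^sub>\<infinity>m. G n m)" for n
    using sG[of n] summable_on_reindex_bij_witness[of UNIV "\<lambda>m. m - 1" "\<lambda>m. m + 1" UNIV "G n" "\<lambda>m. G n (m + 1)"]
      infsum_reindex_bij_witness[of UNIV "\<lambda>m. m - 1" "\<lambda>m. m + 1" UNIV "G n" "\<lambda>m. G n (m + 1)"]
    by auto
  have d': "(\<lambda>(n, m). G n (m + 1) - G n m) = (\<lambda>p. wp_term (\<xi> + 1) p - wp_term \<xi> p)"
    by (auto simp: d fun_eq_iff)
  have s: "(\<lambda>(n, m). G n (m + 1) - G n m) summable_on (UNIV \<times> UNIV)"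
    unfolding d' by (intro summable_on_diff summable_wp)
  have "wp (\<xi> + 1) - wp \<xi> = (\<Sum>\<^sub>\<infinity>p. wp_term (\<xi> + 1) p - wp_term \<xi> p)"
    unfolding wp_def by (rule infsum_diff[symmetric]) (rule summable_wp)+
  also have "\<dots> = (\<Sum>\<^sub>\<infinity>(n, m)\<in>UNIV \<times> UNIV. G n (m + 1) - G n m)"
    unfolding d' by simp
  also have "\<dots> = (\<Sum>\<^sub>\<infinity>n. \<Sum>\<^sub>\<infinity>m. G n (m + 1) - G n m)"
    by (rule infsum_Sigma'_banach[OF s, symmetric])
  also have "\<dots> = (\<Sum>\<^sub>\<infinity>n::int. 0)"
    by (rule infsum_cong) (simp add: infsum_diff[OF sG' sG] eG)
  finally show ?thesis by simp
qed

lemma wp_periodic_tau: "wp (\<xi> + \<tau>) = wp \<xi>"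
proof -
  define G where "G = (\<lambda>m n. 1 / (\<xi> + \<omega> (n, m)) ^ 2)"
  have d: "wp_term (\<xi> + \<tau>) (n, m) - wp_term \<xi> (n, m) = G m (n + 1) - G m n" for n m
    by (simp add: wp_term_def G_def lat_def algebra_simps)
  have sG: "G m summable_on UNIV" for m
  proof -
    have "(\<lambda>n::int. 1 / \<tau> ^ 2 * (1 / ((\<xi> + of_int m) / \<tau> + of_int n) ^ 2)) summable_on UNIV"
      by (intro summable_on_cmult_right inverse_square_summable_on_int)
    also have "(\<lambda>n::int. 1 / \<tau> ^ 2 * (1 / ((\<xi> + of_int m) / \<tau> + of_int n) ^ 2)) = G m"
    proof
      fix n :: int
      have "\<xi> + \<omega> (n, m) = \<tau> * ((\<xi> + of_int m) / \<tau> + of_int n)"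
        by (simp add: lat_def field_simps)
      hence "(\<xi> + \<omega> (n, m)) ^ 2 = \<tau> ^ 2 * ((\<xi> + of_int m) / \<tau> + of_int n) ^ 2"
        by (simp only: power_mult_distrib)
      thus "1 / \<tau> ^ 2 * (1 / ((\<xi> + of_int m) / \<tau> + of_int n) ^ 2) = G m n"
        by (simp add: G_def)
    qed
    finally show ?thesis .
  qed
  have sG': "(\<lambda>n. G m (n + 1)) summable_on UNIV" and eG: "(\<Sum>\<^sub>\<infinity>n. G m (n + 1)) = (\<Sum>\<^sub>\<infinity>n. G m n)" for m
    using sG[of m] summable_on_reindex_bij_witness[of UNIV "\<lambda>n. n - 1" "\<lambda>n. n + 1" UNIV "G m" "\<lambda>n. G m (n + 1)"]
      infsum_reindex_bij_witness[of UNIV "\<lambda>n. n - 1" "\<lambda>n. n + 1" UNIV "G m" "\<lambda>n. G m (n + 1)"]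
    by auto
  have d': "(\<lambda>(n, m). G m (n + 1) - G m n) = (\<lambda>p. wp_term (\<xi> + \<tau>) p - wp_term \<xi> p)"
    by (auto simp: d fun_eq_iff)
  have "(\<lambda>(n, m). G m (n + 1) - G m n) summable_on (UNIV \<times> UNIV)"
    unfolding d' by (intro summable_on_diff summable_wp)
  hence s: "(\<lambda>(m, n). G m (n + 1) - G m n) summable_on (UNIV \<times> UNIV)"
    by (subst (asm) summable_on_swap) simp
  have "wp (\<xi> + \<tau>) - wp \<xi> = (\<Sum>\<^sub>\<infinity>p. wp_term (\<xi> + \<tau>) p - wp_term \<xi> p)"
    unfolding wp_def by (rule infsum_diff[symmetric]) (rule summable_wp)+
  also have "\<dots> = (\<Sum>\<^sub>\<infinity>(m, n)\<in>UNIV \<times> UNIV. G m (n + 1) - G m n)"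
    by (rule infsum_reindex_bij_witness[of _ prod.swap prod.swap]) (auto simp: d)
  also have "\<dots> = (\<Sum>\<^sub>\<infinity>m. \<Sum>\<^sub>\<infinity>n. G m (n + 1) - G m n)"
    by (rule infsum_Sigma'_banach[OF s, symmetric])
  also have "\<dots> = (\<Sum>\<^sub>\<infinity>m::int. 0)"
    by (rule infsum_cong) (simp add: infsum_diff[OF sG' sG] eG)
  finally show ?thesis by simp
qed

lemma wp_periodic: "wp (\<xi> + \<omega> q) = wp \<xi>"
proof -
  interpret t1: periodic_fun_simple wp 1 by unfold_locales (rule wp_periodic_1)
  interpret t2: periodic_fun_simple wp \<tau> by unfold_locales (rule wp_periodic_tau)
  have "wp (\<xi> + \<omega> q) = wp ((\<xi> + of_int (fst q) * \<tau>) + of_int (snd q) * 1)"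
    by (simp only: lat_def add.assoc mult_1_right)
  also have "\<dots> = wp (\<xi> + of_int (fst q) * \<tau>)" by (rule t1.plus_of_int)
  also have "\<dots> = wp \<xi>" by (rule t2.plus_of_int)
  finally show ?thesis .
qed

end

section \<open>Laurent expansions and the Weierstrass equation\<close>

text \<open>Taylor expansion of order 4 with an explicit rational remainder.\<close>

lemma wp_term_taylor:
  fixes w \<xi> :: complex
  assumes "w \<noteq> 0" "\<xi> + w \<noteq> 0"
  shows "1 / (\<xi> + w) ^ 2 - 1 / w ^ 2 =
           (- 2 * \<xi>) * (1 / w ^ 3) + 3 * \<xi> ^ 2 * (1 / w ^ 4) + (- 4 * \<xi> ^ 3) * (1 / w ^ 5)
           + 5 * \<xi> ^ 4 * (1 / w ^ 6) + \<xi> ^ 5 * (- (6 * w + 5 * \<xi>) / (w ^ 6 * (\<xi> + w) ^ 2))"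
proof -
  define s i where "s = \<xi> + w" and "i = 1 / (w ^ 6 * s ^ 2)"
  have nz: "s \<noteq> 0" "w \<noteq> 0" using assms by (auto simp: s_def)
  have q: "z / (w ^ 6 * s ^ 2) = z * i" for z by (simp add: i_def)
  have "1 / s ^ 2 = w ^ 6 / (w ^ 6 * s ^ 2)" "1 / w ^ 2 = w ^ 4 * s ^ 2 / (w ^ 6 * s ^ 2)"
    "1 / w ^ 3 = w ^ 3 * s ^ 2 / (w ^ 6 * s ^ 2)" "1 / w ^ 4 = w ^ 2 * s ^ 2 / (w ^ 6 * s ^ 2)"
    "1 / w ^ 5 = w * s ^ 2 / (w ^ 6 * s ^ 2)" "1 / w ^ 6 = s ^ 2 / (w ^ 6 * s ^ 2)"
    by (subst frac_eq_eq; ((simp add: nz; fail) | algebra))+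
  note * = this[unfolded q]
  have \<xi>: "\<xi> = s - w" by (simp add: s_def)
  show ?thesis
    unfolding s_def[symmetric] * q unfolding \<xi> by algebra
qed

lemma E3_term_taylor:
  fixes w \<xi> :: complex
  assumes "w \<noteq> 0" "\<xi> + w \<noteq> 0"
  shows "1 / (\<xi> + w) ^ 3 =
           1 / w ^ 3 + (- 3 * \<xi>) * (1 / w ^ 4) + 6 * \<xi> ^ 2 * (1 / w ^ 5) + (- 10 * \<xi> ^ 3) * (1 / w ^ 6)
           + \<xi> ^ 4 * ((15 * w ^ 2 + 24 * w * \<xi> + 10 * \<xi> ^ 2) / (w ^ 6 * (\<xi> + w) ^ 3))"
proof -
  define s i where "s = \<xi> + w" and "i = 1 / (w ^ 6 * s ^ 3)"
  have nz: "s \<noteq> 0" "w \<noteq> 0" using assms by (auto simp: s_def)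
  have q: "z / (w ^ 6 * s ^ 3) = z * i" for z by (simp add: i_def)
  have "1 / s ^ 3 = w ^ 6 / (w ^ 6 * s ^ 3)"
    "1 / w ^ 3 = w ^ 3 * s ^ 3 / (w ^ 6 * s ^ 3)" "1 / w ^ 4 = w ^ 2 * s ^ 3 / (w ^ 6 * s ^ 3)"
    "1 / w ^ 5 = w * s ^ 3 / (w ^ 6 * s ^ 3)" "1 / w ^ 6 = s ^ 3 / (w ^ 6 * s ^ 3)"
    by (subst frac_eq_eq; ((simp add: nz; fail) | algebra))+
  note * = this[unfolded q]
  have \<xi>: "\<xi> = s - w" by (simp add: s_def)
  show ?thesis
    unfolding s_def[symmetric] * q unfolding \<xi> by algebra
qed

lemma wp_remainder_bound:
  fixes w \<xi> :: complex
  assumes "2 * norm \<xi> \<le> norm w" "w \<noteq> 0"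
  shows "norm (- (6 * w + 5 * \<xi>) / (w ^ 6 * (\<xi> + w) ^ 2)) \<le> 36 * (1 / norm w ^ 7)"
proof -
  have w: "norm w > 0" using assms by simp
  have s: "norm (\<xi> + w) \<ge> norm w / 2" by (rule norm_shift_ge[OF order_refl assms(1)])
  have "norm (- (6 * w + 5 * \<xi>) / (w ^ 6 * (\<xi> + w) ^ 2))
      = norm (6 * w + 5 * \<xi>) / (norm w ^ 6 * norm (\<xi> + w) ^ 2)"
    by (simp only: norm_divide norm_mult norm_power norm_minus_cancel)
  also have "\<dots> \<le> (9 * norm w) / (norm w ^ 6 * (norm w / 2) ^ 2)"
  proof (rule frac_le)
    have "norm (6 * w + 5 * \<xi>) \<le> 6 * norm w + 5 * norm \<xi>"
      using norm_triangle_ineq[of "6 * w" "5 * \<xi>"] by (simp add: norm_mult)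
    thus "norm (6 * w + 5 * \<xi>) \<le> 9 * norm w" using assms(1) w by linarith
    show "norm w ^ 6 * (norm w / 2) ^ 2 \<le> norm w ^ 6 * norm (\<xi> + w) ^ 2"
      using s by (intro mult_left_mono power_mono) auto
  qed (use w in auto)
  also have "\<dots> = 36 * (1 / norm w ^ 7)"
    using w by (simp add: field_simps power2_eq_square flip: power_Suc)
  finally show ?thesis .
qed

lemma E3_remainder_bound:
  fixes w \<xi> :: complex
  assumes "2 * norm \<xi> \<le> norm w" "w \<noteq> 0"
  shows "norm ((15 * w ^ 2 + 24 * w * \<xi> + 10 * \<xi> ^ 2) / (w ^ 6 * (\<xi> + w) ^ 3)) \<le> 240 * (1 / norm w ^ 7)"
proof -
  have w: "norm w > 0" using assms by simp
  have s: "norm (\<xi> + w) \<ge> norm w / 2" by (rule norm_shift_ge[OF order_refl assms(1)])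
  have "norm ((15 * w ^ 2 + 24 * w * \<xi> + 10 * \<xi> ^ 2) / (w ^ 6 * (\<xi> + w) ^ 3))
      = norm (15 * w ^ 2 + 24 * w * \<xi> + 10 * \<xi> ^ 2) / (norm w ^ 6 * norm (\<xi> + w) ^ 3)"
    by (simp add: norm_divide norm_mult norm_power)
  also have "\<dots> \<le> (30 * norm w ^ 2) / (norm w ^ 6 * (norm w / 2) ^ 3)"
  proof (rule frac_le)
    have "norm (15 * w ^ 2 + 24 * w * \<xi> + 10 * \<xi> ^ 2)
        \<le> norm (15 * w ^ 2) + norm (24 * w * \<xi>) + norm (10 * \<xi> ^ 2)"
      by (intro order_trans[OF norm_triangle_ineq] add_mono order_refl)
    also have "\<dots> = 15 * norm w ^ 2 + 24 * (norm w * norm \<xi>) + 10 * norm \<xi> ^ 2"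
      by (simp add: norm_mult norm_power)
    also have "\<dots> \<le> 15 * norm w ^ 2 + 24 * (norm w * (norm w / 2)) + 10 * (norm w / 2) ^ 2"
      using assms(1) by (intro add_mono mult_left_mono power_mono) auto
    also have "\<dots> \<le> 30 * norm w ^ 2" by (simp add: power2_eq_square)
    finally show "norm (15 * w ^ 2 + 24 * w * \<xi> + 10 * \<xi> ^ 2) \<le> 30 * norm w ^ 2" .
    show "norm w ^ 6 * (norm w / 2) ^ 3 \<le> norm w ^ 6 * norm (\<xi> + w) ^ 3"
      using s by (intro mult_left_mono power_mono) auto
  qed (use w in auto)
  also have "\<dots> = 240 * (1 / norm w ^ 7)"
    using w by (simp add: field_simps power2_eq_square power3_eq_cube flip: power_Suc)
  finally show ?thesis .
qed

context upper_half_plane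
begin

text \<open>The Laurent expansions of both functions at 0, up to a bounded multiple of a higher power. The
  radius is also small enough to exclude the other lattice points.\<close>

definition laurent_near_0 :: "real \<Rightarrow> real \<Rightarrow> bool" where
  "laurent_near_0 r M \<longleftrightarrow> (\<forall>\<xi>. 0 < norm \<xi> \<longrightarrow> norm \<xi> < r \<longrightarrow> \<xi> \<notin> range \<omega> \<and>
     (\<exists>\<rho> \<sigma>. norm \<rho> \<le> M \<and> norm \<sigma> \<le> M \<and>
       wp \<xi> = 1 / \<xi> ^ 2 + 3 * lattice_e \<tau> 4 * \<xi> ^ 2 + 5 * lattice_e \<tau> 6 * \<xi> ^ 4 + \<rho> * \<xi> ^ 5 \<and>
       E3 \<xi> = 1 / \<xi> ^ 3 - 3 * lattice_e \<tau> 4 * \<xi> - 10 * lattice_e \<tau> 6 * \<xi> ^ 3 + \<sigma> * \<xi> ^ 4))"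

text \<open>Summation of the Taylor expansions of all terms except the one at the origin. The odd power
  sums vanish, and the remainders are dominated by inverse seventh powers of lattice points.\<close>

lemma laurent_expansions: "\<exists>r M. r > 0 \<and> laurent_near_0 r M"
proof -
  obtain C where C: "C > 0" "\<And>p. p \<noteq> (0, 0) \<Longrightarrow> weight p \<le> C * norm (\<omega> p)"
    using lat_lower_bound by blast
  \<comment> \<open>Every nonzero lattice point has weight at least 2 and hence distance at least 2 r from 0.\<close>
  define r where "r = 1 / C"
  define X where "X = - {(0 :: int, 0 :: int)}"
  have UX: "UNIV = insert (0, 0) X" "(0, 0) \<notin> X" by (auto simp: X_def)
  have far: "2 * r \<le> norm (\<omega> p)" "\<omega> p \<noteq> 0" if "p \<in> X" for p
  proof -
    have p: "p \<noteq> (0, 0)" using that by (auto simp: X_def)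
    hence "\<bar>fst p\<bar> + \<bar>snd p\<bar> \<ge> 1" by (cases p) auto
    hence "real_of_int (\<bar>fst p\<bar> + \<bar>snd p\<bar>) \<ge> 1" by linarith
    hence "2 \<le> weight p" by (simp add: weight_def)
    also have "\<dots> \<le> C * norm (\<omega> p)" using C p by blast
    finally show "2 * r \<le> norm (\<omega> p)" using C(1) by (simp add: r_def field_simps)
    show "\<omega> p \<noteq> 0" using p by simp
  qed
  have e: "((\<lambda>p. 1 / \<omega> p ^ k) has_sum lattice_e \<tau> k) X" if "k \<ge> 3" for k
  proof -
    have "((\<lambda>p. 1 / \<omega> p ^ k) has_sum lattice_e \<tau> k) UNIV"
      unfolding lattice_e_def by (intro has_sum_infsum summable_lat that)
    also have "?this \<longleftrightarrow> ?thesis"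
      by (rule has_sum_cong_neutral) (use that in \<open>auto simp: X_def\<close>)
    finally show ?thesis .
  qed
  define N where "N = (\<Sum>\<^sub>\<infinity>p\<in>X. 1 / norm (\<omega> p) ^ 7)"
  have N: "((\<lambda>p. c * (1 / norm (\<omega> p) ^ 7)) has_sum (c * N)) X" for c
    unfolding N_def by (intro has_sum_cmult_right has_sum_infsum summable_norm_lat) auto
  have N0: "N \<ge> 0" unfolding N_def by (intro infsum_nonneg) auto
  have "laurent_near_0 r (240 * N)"
    unfolding laurent_near_0_def
  proof (intro allI impI conjI)
    fix \<xi> :: complex assume \<xi>: "0 < norm \<xi>" "norm \<xi> < r"
    have far': "2 * norm \<xi> \<le> norm (\<omega> p)" "\<xi> + \<omega> p \<noteq> 0" if "p \<in> X" for p
    proof -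
      show "2 * norm \<xi> \<le> norm (\<omega> p)" using far(1)[OF that] \<xi> by linarith
      hence "norm (\<xi> + \<omega> p) \<ge> norm (\<omega> p) / 2" by (intro norm_shift_ge) auto
      thus "\<xi> + \<omega> p \<noteq> 0" using far(2)[OF that] by auto
    qed
    show "\<xi> \<notin> range \<omega>"
    proof
      assume "\<xi> \<in> range \<omega>"
      then obtain p where p: "\<xi> = \<omega> p" by auto
      hence "p \<in> X" using \<xi>(1) by (auto simp: X_def)
      thus False using far(1)[of p] \<xi> unfolding p by linarith
    qed
    define f where "f = (\<lambda>p. - (6 * \<omega> p + 5 * \<xi>) / (\<omega> p ^ 6 * (\<xi> + \<omega> p) ^ 2))"
    define g where "g = (\<lambda>p. (15 * \<omega> p ^ 2 + 24 * \<omega> p * \<xi> + 10 * \<xi> ^ 2) / (\<omega> p ^ 6 * (\<xi> + \<omega> p) ^ 3))"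
    have fb: "norm (f p) \<le> 36 * (1 / norm (\<omega> p) ^ 7)" and gb: "norm (g p) \<le> 240 * (1 / norm (\<omega> p) ^ 7)"
      if "p \<in> X" for p
      unfolding f_def g_def using far(2)[OF that] far'(1)[OF that]
      by (intro wp_remainder_bound E3_remainder_bound; simp)+
    have "f summable_on X"
      by (rule abs_summable_summable, rule Infinite_Sum.abs_summable_on_comparison_test'[OF has_sum_imp_summable[OF N[of 36]] fb])
    hence f: "(f has_sum infsum f X) X" by simp
    have "g summable_on X"
      by (rule abs_summable_summable, rule Infinite_Sum.abs_summable_on_comparison_test'[OF has_sum_imp_summable[OF N[of 240]] gb])
    hence g: "(g has_sum infsum g X) X" by simp
    have "norm (infsum f X) \<le> 36 * N" by (rule norm_infsum_le[OF f N fb])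
    hence nf: "norm (infsum f X) \<le> 240 * N" using N0 by linarith
    have ng: "norm (infsum g X) \<le> 240 * N" by (rule norm_infsum_le[OF g N gb])
    have "(wp_term \<xi> has_sum ((- 2 * \<xi>) * lattice_e \<tau> 3 + 3 * \<xi> ^ 2 * lattice_e \<tau> 4
             + (- 4 * \<xi> ^ 3) * lattice_e \<tau> 5 + 5 * \<xi> ^ 4 * lattice_e \<tau> 6 + \<xi> ^ 5 * infsum f X)) X"
    proof (rule has_sum_cong[THEN iffD2])
      show "((\<lambda>p. (- 2 * \<xi>) * (1 / \<omega> p ^ 3) + 3 * \<xi> ^ 2 * (1 / \<omega> p ^ 4) + (- 4 * \<xi> ^ 3) * (1 / \<omega> p ^ 5)
           + 5 * \<xi> ^ 4 * (1 / \<omega> p ^ 6) + \<xi> ^ 5 * f p) has_sum ((- 2 * \<xi>) * lattice_e \<tau> 3 + 3 * \<xi> ^ 2 * lattice_e \<tau> 4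
             + (- 4 * \<xi> ^ 3) * lattice_e \<tau> 5 + 5 * \<xi> ^ 4 * lattice_e \<tau> 6 + \<xi> ^ 5 * infsum f X)) X"
        by (intro has_sum_add has_sum_cmult_right e f) auto
      show "wp_term \<xi> p = (- 2 * \<xi>) * (1 / \<omega> p ^ 3) + 3 * \<xi> ^ 2 * (1 / \<omega> p ^ 4) + (- 4 * \<xi> ^ 3) * (1 / \<omega> p ^ 5)
           + 5 * \<xi> ^ 4 * (1 / \<omega> p ^ 6) + \<xi> ^ 5 * f p" if "p \<in> X" for p
        unfolding wp_term_def f_def by (rule wp_term_taylor[OF far(2)[OF that] far'(2)[OF that]])
    qed
    from has_sum_insert[OF UX(2) this] have wp: "wp \<xi> = 1 / \<xi> ^ 2 + 3 * lattice_e \<tau> 4 * \<xi> ^ 2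
        + 5 * lattice_e \<tau> 6 * \<xi> ^ 4 + infsum f X * \<xi> ^ 5"
      unfolding wp_def UX(1)[symmetric]
      by (simp add: infsumI wp_term_def lattice_e_odd algebra_simps)
    have "((\<lambda>p. 1 / (\<xi> + \<omega> p) ^ 3) has_sum (lattice_e \<tau> 3 + (- 3 * \<xi>) * lattice_e \<tau> 4
             + 6 * \<xi> ^ 2 * lattice_e \<tau> 5 + (- 10 * \<xi> ^ 3) * lattice_e \<tau> 6 + \<xi> ^ 4 * infsum g X)) X"
    proof (rule has_sum_cong[THEN iffD2])
      show "((\<lambda>p. 1 / \<omega> p ^ 3 + (- 3 * \<xi>) * (1 / \<omega> p ^ 4) + 6 * \<xi> ^ 2 * (1 / \<omega> p ^ 5)
           + (- 10 * \<xi> ^ 3) * (1 / \<omega> p ^ 6) + \<xi> ^ 4 * g p) has_sum (lattice_e \<tau> 3 + (- 3 * \<xi>) * lattice_e \<tau> 4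
             + 6 * \<xi> ^ 2 * lattice_e \<tau> 5 + (- 10 * \<xi> ^ 3) * lattice_e \<tau> 6 + \<xi> ^ 4 * infsum g X)) X"
        by (intro has_sum_add has_sum_cmult_right e g) auto
      show "1 / (\<xi> + \<omega> p) ^ 3 = 1 / \<omega> p ^ 3 + (- 3 * \<xi>) * (1 / \<omega> p ^ 4) + 6 * \<xi> ^ 2 * (1 / \<omega> p ^ 5)
           + (- 10 * \<xi> ^ 3) * (1 / \<omega> p ^ 6) + \<xi> ^ 4 * g p" if "p \<in> X" for p
        unfolding g_def by (rule E3_term_taylor[OF far(2)[OF that] far'(2)[OF that]])
    qed
    from has_sum_insert[OF UX(2) this] have E3: "E3 \<xi> = 1 / \<xi> ^ 3 - 3 * lattice_e \<tau> 4 * \<xi>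
        - 10 * lattice_e \<tau> 6 * \<xi> ^ 3 + infsum g X * \<xi> ^ 4"
      unfolding E3_def UX(1)[symmetric]
      by (simp add: infsumI lattice_e_odd algebra_simps)
    show "\<exists>\<rho> \<sigma>. norm \<rho> \<le> 240 * N \<and> norm \<sigma> \<le> 240 * N \<and>
       wp \<xi> = 1 / \<xi> ^ 2 + 3 * lattice_e \<tau> 4 * \<xi> ^ 2 + 5 * lattice_e \<tau> 6 * \<xi> ^ 4 + \<rho> * \<xi> ^ 5 \<and>
       E3 \<xi> = 1 / \<xi> ^ 3 - 3 * lattice_e \<tau> 4 * \<xi> - 10 * lattice_e \<tau> 6 * \<xi> ^ 3 + \<sigma> * \<xi> ^ 4"
      using nf ng wp E3 by blast
  qed
  moreover have "r > 0" using C by (simp add: r_def)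
  ultimately show ?thesis by blast
qed

lemma lattice_isolated: "\<exists>r>0. \<forall>\<xi>. 0 < norm \<xi> \<longrightarrow> norm \<xi> < r \<longrightarrow> \<xi> \<notin> range \<omega>"
  using laurent_expansions unfolding laurent_near_0_def by blast

definition defect :: "complex \<Rightarrow> complex" where
  "defect \<xi> = 4 * E3 \<xi> ^ 2 - 4 * wp \<xi> ^ 3 + 60 * lattice_e \<tau> 4 * wp \<xi> + 140 * lattice_e \<tau> 6"

text \<open>The polar parts and the constant terms of the Laurent expansions cancel; this is what determines the
  coefficients 60 and 140.\<close>

lemma defect_tendsto_0: "(defect \<longlongrightarrow> 0) (at 0)"
proof -
  obtain r M where r: "r > 0" and L: "laurent_near_0 r M"
    using laurent_expansions by blast
  define a where "a = lattice_e \<tau> 4"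
  define b where "b = lattice_e \<tau> 6"
  define A where "A = 3 * norm a + 10 * norm b + M"
  define K where "K = 20 * M + 16 * A ^ 2 + 60 * norm a * A + 4 * A ^ 3"
  have bound: "norm (defect \<xi>) \<le> K * norm \<xi>" if \<xi>: "0 < norm \<xi>" "norm \<xi> < r" "norm \<xi> < 1" for \<xi> :: complex
  proof -
    obtain \<rho> \<sigma> where \<rho>: "norm \<rho> \<le> M" and \<sigma>: "norm \<sigma> \<le> M" and
      wp: "wp \<xi> = 1 / \<xi> ^ 2 + 3 * a * \<xi> ^ 2 + 5 * b * \<xi> ^ 4 + \<rho> * \<xi> ^ 5" and
      E3: "E3 \<xi> = 1 / \<xi> ^ 3 - 3 * a * \<xi> - 10 * b * \<xi> ^ 3 + \<sigma> * \<xi> ^ 4"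
      using L \<xi>(1,2) unfolding a_def b_def laurent_near_0_def by blast
    have M0: "M \<ge> 0" using \<rho> norm_ge_zero order_trans by blast
    have nz: "\<xi> \<noteq> 0" using \<xi> by auto
    define X where "X = 3 * a + 5 * b * \<xi> ^ 2 + \<rho> * \<xi> ^ 3"
    define Z where "Z = - 3 * a - 10 * b * \<xi> ^ 2 + \<sigma> * \<xi> ^ 3"
    have pw: "norm \<xi> ^ k \<le> 1" for k using \<xi> by (simp add: power_le_one)
    have mb: "norm c * norm \<xi> ^ k \<le> norm c" for c :: complex and k
      using mult_left_mono[OF pw[of k] norm_ge_zero[of c]] by simp
    have XA: "norm X \<le> A"
    proof -
      have "norm X \<le> norm (3 * a) + norm (5 * b * \<xi> ^ 2) + norm (\<rho> * \<xi> ^ 3)"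
        unfolding X_def by (intro order_trans[OF norm_triangle_ineq] add_mono order_refl)
      also have "\<dots> = 3 * norm a + 5 * (norm b * norm \<xi> ^ 2) + norm \<rho> * norm \<xi> ^ 3"
        by (simp add: norm_mult norm_power)
      also have "\<dots> \<le> A" using mb[of b 2] mb[of \<rho> 3] \<rho> norm_ge_zero[of b] unfolding A_def by linarith
      finally show ?thesis .
    qed
    have ZA: "norm Z \<le> A"
    proof -
      have "norm Z \<le> norm (- 3 * a) + norm (10 * b * \<xi> ^ 2) + norm (\<sigma> * \<xi> ^ 3)"
        unfolding Z_def by (intro order_trans[OF norm_triangle_ineq] order_trans[OF norm_triangle_ineq4] add_mono order_refl)
      also have "\<dots> = 3 * norm a + 10 * (norm b * norm \<xi> ^ 2) + norm \<sigma> * norm \<xi> ^ 3"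
        by (simp add: norm_mult norm_power)
      also have "\<dots> \<le> A" using mb[of b 2] mb[of \<sigma> 3] \<sigma> unfolding A_def by linarith
      finally show ?thesis .
    qed
    have A0: "A \<ge> 0" using XA norm_ge_zero order_trans by blast
    \<comment> \<open>After clearing the powers of the variable, both functions are 1 plus fourth-order terms X and Z.\<close>
    have e1: "\<xi> ^ 2 * wp \<xi> = 1 + \<xi> ^ 4 * X" and e2: "\<xi> ^ 3 * E3 \<xi> = 1 + \<xi> ^ 4 * Z"
      unfolding wp E3 X_def Z_def using nz by (simp_all add: field_simps) algebra+
    have "\<xi> ^ 6 * defect \<xi> = 4 * (\<xi> ^ 3 * E3 \<xi>) ^ 2 - 4 * (\<xi> ^ 2 * wp \<xi>) ^ 3
        + 60 * a * \<xi> ^ 4 * (\<xi> ^ 2 * wp \<xi>) + 140 * b * \<xi> ^ 6"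
      unfolding defect_def a_def b_def by algebra
    also have "\<dots> = \<xi> ^ 6 * (\<xi> * (8 * \<sigma> - 12 * \<rho>) + \<xi> ^ 2 * (4 * Z ^ 2 - 12 * X ^ 2 + 60 * a * X)
        - 4 * \<xi> ^ 6 * X ^ 3)"
    proof -
      have "8 * Z - 12 * X + 60 * a = - 140 * b * \<xi> ^ 2 + \<xi> ^ 3 * (8 * \<sigma> - 12 * \<rho>)"
        unfolding X_def Z_def by algebra
      thus ?thesis unfolding e1 e2 by algebra
    qed
    finally have "defect \<xi> = \<xi> * (8 * \<sigma> - 12 * \<rho>) + \<xi> ^ 2 * (4 * Z ^ 2 - 12 * X ^ 2 + 60 * a * X)
        - 4 * \<xi> ^ 6 * X ^ 3"
      using nz by (simp only: mult_cancel_left power_eq_0_iff simp_thms)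
    hence d: "defect \<xi> = \<xi> * (8 * \<sigma> - 12 * \<rho> + \<xi> * (4 * Z ^ 2 - 12 * X ^ 2 + 60 * a * X)
        - 4 * \<xi> ^ 5 * X ^ 3)"
      by algebra
    have "norm (8 * \<sigma> - 12 * \<rho> + \<xi> * (4 * Z ^ 2 - 12 * X ^ 2 + 60 * a * X) - 4 * \<xi> ^ 5 * X ^ 3)
        \<le> norm (8 * \<sigma>) + norm (12 * \<rho>) + norm \<xi> * norm (4 * Z ^ 2 - 12 * X ^ 2 + 60 * a * X)
          + norm (4 * \<xi> ^ 5 * X ^ 3)"
      unfolding norm_mult[of \<xi>, symmetric]
      by (intro order_trans[OF norm_triangle_ineq] order_trans[OF norm_triangle_ineq4] add_mono order_refl)
    also have "\<dots> \<le> 8 * M + 12 * M + 1 * (4 * A ^ 2 + 12 * A ^ 2 + 60 * norm a * A) + 4 * A ^ 3"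
    proof (intro add_mono mult_mono)
      show "norm (4 * Z ^ 2 - 12 * X ^ 2 + 60 * a * X) \<le> 4 * A ^ 2 + 12 * A ^ 2 + 60 * norm a * A"
      proof -
        have "norm (4 * Z ^ 2 - 12 * X ^ 2 + 60 * a * X) \<le> norm (4 * Z ^ 2) + norm (12 * X ^ 2) + norm (60 * a * X)"
          by (intro order_trans[OF norm_triangle_ineq] order_trans[OF norm_triangle_ineq4] add_mono order_refl)
        also have "\<dots> = 4 * norm Z ^ 2 + 12 * norm X ^ 2 + 60 * norm a * norm X"
          by (simp add: norm_mult norm_power)
        also have "\<dots> \<le> 4 * A ^ 2 + 12 * A ^ 2 + 60 * norm a * A"
          using XA ZA by (intro add_mono mult_left_mono power_mono) auto
        finally show ?thesis .
      qed
      have "norm (4 * \<xi> ^ 5 * X ^ 3) = 4 * (norm \<xi> ^ 5 * norm X ^ 3)" by (simp add: norm_mult norm_power)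
      also have "\<dots> \<le> 4 * (1 * A ^ 3)"
        using XA by (intro mult_left_mono mult_mono pw power_mono) auto
      finally show "norm (4 * \<xi> ^ 5 * X ^ 3) \<le> 4 * A ^ 3" by simp
    qed (use \<rho> \<sigma> \<xi> in \<open>auto simp: norm_mult\<close>)
    also have "\<dots> = K" by (simp add: K_def)
    finally have "norm \<xi> * norm (8 * \<sigma> - 12 * \<rho> + \<xi> * (4 * Z ^ 2 - 12 * X ^ 2 + 60 * a * X) - 4 * \<xi> ^ 5 * X ^ 3)
        \<le> norm \<xi> * K" by (intro mult_left_mono) auto
    thus ?thesis unfolding d norm_mult[of \<xi>] by (simp only: mult.commute[of K])
  qed
  have "eventually (\<lambda>\<xi>. norm (defect \<xi>) \<le> norm \<xi> * K) (at 0)"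
    unfolding eventually_at
    by (rule exI[of _ "min r 1"]) (use r bound in \<open>auto simp: mult.commute\<close>)
  moreover have "((\<lambda>\<xi>. norm \<xi> * K) \<longlongrightarrow> norm (0::complex) * K) (at (0::complex))"
    by (intro tendsto_intros)
  hence "((\<lambda>\<xi>. norm \<xi> * K) \<longlongrightarrow> 0) (at (0::complex))" by simp
  ultimately show ?thesis by (rule Lim_null_comparison)
qed

lemma range_lat_add_iff: "\<xi> + \<omega> q \<in> range \<omega> \<longleftrightarrow> \<xi> \<in> range \<omega>"
proof
  assume "\<xi> + \<omega> q \<in> range \<omega>"
  then obtain p where "\<xi> + \<omega> q = \<omega> p" by auto
  hence "\<xi> = \<omega> (p - q)" using lat_add[of \<tau> "p - q" q] by simp
  thus "\<xi> \<in> range \<omega>" by simp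
next
  assume "\<xi> \<in> range \<omega>"
  thus "\<xi> + \<omega> q \<in> range \<omega>" by (auto simp flip: lat_add)
qed

lemma parallelogram_representative:
  obtains q where "norm (z + \<omega> q) \<le> norm \<tau> + 1"
proof -
  define s where "s = Im z / Im \<tau>"
  define t where "t = Re z - s * Re \<tau>"
  have z: "z = of_real s * \<tau> + of_real t"
    using Im_pos by (auto simp: complex_eq_iff s_def t_def)
  have "z + \<omega> (- \<lfloor>s\<rfloor>, - \<lfloor>t\<rfloor>) = of_real (frac s) * \<tau> + of_real (frac t)"
    by (subst z) (simp add: lat_def frac_def algebra_simps)
  hence "norm (z + \<omega> (- \<lfloor>s\<rfloor>, - \<lfloor>t\<rfloor>)) \<le> norm (of_real (frac s) * \<tau>) + norm (of_real (frac t) :: complex)"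
    by (metis norm_triangle_ineq)
  also have "\<dots> = frac s * norm \<tau> + frac t" by (simp add: norm_mult frac_ge_0)
  also have "\<dots> \<le> 1 * norm \<tau> + 1"
    using frac_lt_1[of s] frac_lt_1[of t] by (intro add_mono mult_right_mono) auto
  finally show ?thesis using that by simp
qed

text \<open>The difference of both sides, extended by 0 to the lattice, is an entire function: it tends to
  0 at the origin and therefore, by periodicity, at every lattice point. It is bounded because its
  values are taken on a compact set, so it is constant by Liouville's theorem.\<close>

theorem weierstrass_equation:
  assumes "\<xi> \<notin> range \<omega>"
  shows "4 * E3 \<xi> ^ 2 = 4 * wp \<xi> ^ 3 - 60 * lattice_e \<tau> 4 * wp \<xi> - 140 * lattice_e \<tau> 6"
proof -
  \<comment> \<open>The value 0 at lattice points is the limit found above.\<close>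
  define F where "F = (\<lambda>\<xi>. if \<xi> \<in> range \<omega> then 0 else defect \<xi>)"
  have per: "F (z + \<omega> q) = F z" for z q
    by (simp add: F_def range_lat_add_iff defect_def wp_periodic E3_periodic)
  obtain r where r: "r > 0" "\<And>\<xi> :: complex. 0 < norm \<xi> \<Longrightarrow> norm \<xi> < r \<Longrightarrow> \<xi> \<notin> range \<omega>"
    using lattice_isolated by blast
  have sep: "z = w" if "z \<in> range \<omega>" "w \<in> range \<omega>" "dist z w < r" for z w
  proof (rule ccontr)
    assume "z \<noteq> w"
    moreover from that obtain p q where "z = \<omega> p" "w = \<omega> q" by auto
    hence "z - w = \<omega> (p - q)" using lat_add[of \<tau> "p - q" q] by simp
    hence "z - w \<in> range \<omega>" by simp
    moreover have "norm (z - w) < r" using that(3) by (simp add: dist_norm)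
    ultimately show False using r(2) by simp
  qed
  have closed: "closed (range \<omega>)"
    using r(1) sep by (intro discrete_imp_closed[of r]) (auto simp: dist_norm)
  have hol: "F holomorphic_on (- range \<omega>)"
  proof -
    have d: "defect field_differentiable at z" if "z \<notin> range \<omega>" for z
      unfolding defect_def using holomorphic_off_lattice[OF that]
      by (intro derivative_intros) auto
    have "defect holomorphic_on (- range \<omega>)"
      by (rule holomorphic_onI, rule field_differentiable_at_within, rule d, erule ComplD)
    thus ?thesis by (rule holomorphic_transform) (auto simp: F_def)
  qed
  have lim0: "(F \<longlongrightarrow> F 0) (at 0)"
  proof -
    have "(F \<longlongrightarrow> 0) (at 0)"
      using defect_tendsto_0
    proof (rule Lim_transform_eventually)
      show "eventually (\<lambda>\<xi>. defect \<xi> = F \<xi>) (at 0)"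
        unfolding eventually_at using r by (auto intro!: exI[of _ r] simp: F_def)
    qed
    moreover have "0 \<in> range \<omega>" by (metis lat_simps(1) rangeI)
    ultimately show ?thesis by (simp add: F_def)
  qed
  have diff0: "F field_differentiable at 0"
  proof -
    have "F holomorphic_on ball 0 r"
    proof (rule no_isolated_singularity'[of "{0}"])
      show "(F \<longlongrightarrow> F z) (at z within ball 0 r)" if "z \<in> {0}" for z
        using lim0 that by (auto intro: tendsto_within_subset)
      show "F holomorphic_on ball 0 r - {0}"
      proof (rule holomorphic_on_subset[OF hol], rule subsetI)
        fix z :: complex assume "z \<in> ball 0 r - {0}"
        hence "0 < norm z" "norm z < r" by auto
        thus "z \<in> - range \<omega>" using r(2) by blast
      qed
    qed auto
    thus ?thesis using r by (simp add: holomorphic_on_imp_differentiable_at)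
  qed
  have diff: "F field_differentiable at z" for z
  proof (cases "z \<in> range \<omega>")
    case True
    then obtain q where z: "z = \<omega> q" by auto
    have "F = F \<circ> (\<lambda>w. w - z)"
    proof
      fix w show "F w = (F \<circ> (\<lambda>w. w - z)) w"
        using per[of "w - z" q] by (simp add: z)
    qed
    moreover have "(F \<circ> (\<lambda>w. w - z)) field_differentiable at z"
      using diff0 by (intro field_differentiable_compose derivative_intros) auto
    ultimately show ?thesis by simp
  next
    case False
    thus ?thesis
      using hol closed by (intro holomorphic_on_imp_differentiable_at[of _ "- range \<omega>"])
                          (simp_all add: open_Compl)
  qed
  hence entire: "F holomorphic_on UNIV"
    by (simp add: holomorphic_on_def field_differentiable_at_within)
  have "bounded (range F)"
  proof -
    have "compact (F ` cball 0 (norm \<tau> + 1))"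
      using entire by (intro compact_continuous_image holomorphic_on_imp_continuous_on)
                      (auto intro: holomorphic_on_subset)
    moreover have "range F \<subseteq> F ` cball 0 (norm \<tau> + 1)"
    proof safe
      fix z
      obtain q where "norm (z + \<omega> q) \<le> norm \<tau> + 1" by (rule parallelogram_representative)
      thus "F z \<in> F ` cball 0 (norm \<tau> + 1)"
        using per[of z q] by (metis imageI mem_cball_0)
    qed
    ultimately show ?thesis using bounded_subset compact_imp_bounded by blast
  qed
  with entire have "F constant_on UNIV" by (rule Liouville_theorem)
  then obtain c where c: "F z = c" for z by (auto simp: constant_on_def)
  have "F 0 = 0" by (simp add: F_def)
  hence "F \<xi> = 0" using c by simp
  thus ?thesis using assms by (simp add: F_def defect_def algebra_simps)
qed

end

section \<open>Eisenstein summation\<close>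

lemma eisenstein_e_eq_lattice_e:
  assumes "k \<noteq> 2" "k > 0"
  shows "eisenstein_e k \<tau> = lattice_e \<tau> k"
  using assms unfolding eisenstein_e_def lattice_e_def lattice_sum_def
  by (auto intro!: infsum_cong simp: lat_def power_0_left)

context upper_half_plane
begin

lemma eisenstein_E_3: "eisenstein_E 3 \<xi> \<tau> = E3 \<xi>"
  unfolding eisenstein_E_def E3_def lattice_sum_def
  by (auto intro!: infsum_cong simp: lat_def add.assoc)

text \<open>Subtracting the telescoping series of 1/(z+m) - 1/(z+m+1), whose sum is 0, turns
  the terms of a row into terms of the size of an inverse cube, so that the rows become part of an
  absolutely convergent double series and the outer Eisenstein sum converges.\<close>

lemma inverse_square_telescoped:
  fixes z :: complex
  assumes z: "\<And>m::int. z + of_int m \<noteq> 0"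
    and s: "(\<lambda>m::int. 1 / ((z + of_int m) ^ 2 * (z + of_int m + 1))) summable_on UNIV"
  shows "(\<Sum>\<^sub>\<infinity>m::int. 1 / (z + of_int m) ^ 2) = (\<Sum>\<^sub>\<infinity>m::int. 1 / ((z + of_int m) ^ 2 * (z + of_int m + 1)))"
proof -
  define h where "h = (\<lambda>m::int. 1 / (z + of_int m) - 1 / (z + of_int (m + 1)))"
  have hd: "1 / (z + of_int m) ^ 2 - 1 / ((z + of_int m) ^ 2 * (z + of_int m + 1)) = h m" for m
  proof -
    define t where "t = z + of_int m"
    define r where "r = t + 1"
    have nz: "t \<noteq> 0" "r \<noteq> 0" using z[of m] z[of "m + 1"] by (auto simp: t_def r_def add.assoc)
    have "1 / t ^ 2 = r / (t ^ 2 * r)" "1 / t = t * r / (t ^ 2 * r)" "1 / r = t ^ 2 / (t ^ 2 * r)"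
      by (subst frac_eq_eq; ((simp add: nz; fail) | algebra))+
    moreover have "r / (t ^ 2 * r) - 1 / (t ^ 2 * r) = t * r / (t ^ 2 * r) - t ^ 2 / (t ^ 2 * r)"
    proof -
      have "r - 1 = t * r - t ^ 2" unfolding r_def by algebra
      thus ?thesis unfolding diff_divide_distrib[symmetric] by (simp only:)
    qed
    moreover have "z + of_int (m + 1) = r" by (simp add: t_def r_def add.assoc)
    ultimately show ?thesis unfolding h_def t_def[symmetric] r_def[symmetric] by (simp only:)
  qed
  have "h summable_on UNIV"
    using summable_on_diff[OF inverse_square_summable_on_int[of z] s] unfolding hd .
  hence h: "(h has_sum infsum h UNIV) UNIV" by simp
  have partial: "(\<Sum>m\<in>{-int N..int N}. h m) = 1 / (z - of_nat N) - 1 / (z + of_nat (Suc N))" for N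
  proof (induction N)
    case (Suc N)
    have "{-int (Suc N)..int (Suc N)} = insert (- int (Suc N)) (insert (int (Suc N)) {-int N..int N})"
      by auto
    hence "(\<Sum>m\<in>{-int (Suc N)..int (Suc N)}. h m) = h (- int (Suc N)) + (h (int (Suc N)) + (\<Sum>m\<in>{-int N..int N}. h m))"
      by simp
    thus ?case unfolding Suc.IH by (simp add: h_def algebra_simps)
  qed (simp add: h_def)
  have "(\<lambda>N. \<Sum>m\<in>{-int N..int N}. h m) \<longlonglongrightarrow> infsum h UNIV" by (rule has_sum_int_symmetric[OF h])
  moreover have "(\<lambda>N. \<Sum>m\<in>{-int N..int N}. h m) \<longlonglongrightarrow> 0 - 0"
    unfolding partial
  proof (intro tendsto_diff)
    have *: "filterlim (\<lambda>N. z + of_nat (Suc N)) at_infinity sequentially" for z :: complex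
      by (intro tendsto_add_filterlim_at_infinity[OF tendsto_const]
           filterlim_compose[OF tendsto_of_nat filterlim_Suc])
    show "(\<lambda>N. 1 / (z + of_nat (Suc N))) \<longlonglongrightarrow> 0"
      by (rule tendsto_divide_0[OF tendsto_const *])
    have "filterlim (\<lambda>N. - z + of_nat N) at_infinity sequentially"
      by (intro tendsto_add_filterlim_at_infinity[OF tendsto_const] tendsto_of_nat)
    hence "(\<lambda>N. -1 / (- z + of_nat N)) \<longlonglongrightarrow> 0"
      by (rule tendsto_divide_0[OF tendsto_const])
    moreover have "-1 / (- z + of_nat N) = 1 / (z - of_nat N)" for N
      by (metis minus_diff_eq minus_divide_divide add.commute diff_conv_add_uminus minus_minus)
    ultimately show "(\<lambda>N. 1 / (z - of_nat N)) \<longlonglongrightarrow> 0" by simp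
  qed
  ultimately have "infsum h UNIV = 0" using LIMSEQ_unique by fastforce
  moreover have "infsum h UNIV = (\<Sum>\<^sub>\<infinity>m::int. 1 / (z + of_int m) ^ 2) - (\<Sum>\<^sub>\<infinity>m::int. 1 / ((z + of_int m) ^ 2 * (z + of_int m + 1)))"
    unfolding hd[symmetric] by (rule infsum_diff[OF inverse_square_summable_on_int s])
  ultimately show ?thesis by simp
qed

lemma summable_telescoped:
  "(\<lambda>(n, m). 1 / (\<omega> (n, m) ^ 2 * (\<omega> (n, m) + 1))) summable_on ((- {0}) \<times> UNIV)"
proof -
  obtain C where C: "C > 0" "\<And>p. p \<noteq> (0, 0) \<Longrightarrow> weight p \<le> C * norm (\<omega> p)"
    using lat_lower_bound by blast
  have "(\<lambda>p. 2 * C ^ 3 * (1 / weight p ^ 3)) summable_on UNIV"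
    by (intro summable_on_cmult_right summable_on_weight)
  hence "(\<lambda>p. 2 * C ^ 3 * (1 / weight p ^ 3)) summable_on ((- {0}) \<times> UNIV)"
    by (rule summable_on_subset) auto
  hence "(\<lambda>p. norm (case p of (n, m) \<Rightarrow> 1 / (\<omega> (n, m) ^ 2 * (\<omega> (n, m) + 1)))) summable_on ((- {0}) \<times> UNIV)"
  proof (rule Infinite_Sum.abs_summable_on_comparison_test')
    fix p :: "int \<times> int" assume "p \<in> (- {0}) \<times> UNIV"
    then obtain n m where p: "p = (n, m)" "n \<noteq> 0" by auto
    have w: "weight p > 0" using weight_ge_1[of p] by linarith
    have 1: "norm (\<omega> p) \<ge> weight p / C" using C p by (simp add: field_simps)
    have "weight p \<le> 2 * weight (n, m + 1)"
    proof -
      have "\<bar>real_of_int m\<bar> \<le> \<bar>real_of_int (m + 1)\<bar> + 1" by simp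
      moreover have "\<bar>real_of_int n\<bar> \<ge> 0" "\<bar>real_of_int (m + 1)\<bar> \<ge> 0" by simp_all
      moreover have "1 + a + b \<le> 2 * (1 + a + c)" if "b \<le> c + 1" "0 \<le> a" "0 \<le> c" for a b c :: real
        using that by (simp add: algebra_simps)
      ultimately show ?thesis unfolding weight_def p fst_conv snd_conv by blast
    qed
    also have "weight (n, m + 1) \<le> C * norm (\<omega> (n, m + 1))" using C(2)[of "(n, m + 1)"] p by auto
    also have "\<omega> (n, m + 1) = \<omega> p + 1" by (simp add: lat_def p)
    finally have 2: "norm (\<omega> p + 1) \<ge> weight p / (2 * C)" using C(1) by (simp add: field_simps)
    have "norm (1 / (\<omega> p ^ 2 * (\<omega> p + 1))) = 1 / (norm (\<omega> p) ^ 2 * norm (\<omega> p + 1))"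
      by (simp add: norm_divide norm_mult norm_power)
    also have "\<dots> \<le> 1 / ((weight p / C) ^ 2 * (weight p / (2 * C)))"
    proof (rule frac_le)
      show "0 < (weight p / C) ^ 2 * (weight p / (2 * C))" using w C by simp
      show "(weight p / C) ^ 2 * (weight p / (2 * C)) \<le> norm (\<omega> p) ^ 2 * norm (\<omega> p + 1)"
        using 1 2 w C by (intro mult_mono power_mono) auto
    qed auto
    also have "\<dots> = 2 * C ^ 3 * (1 / weight p ^ 3)"
      using w C by (simp add: field_simps power2_eq_square power3_eq_cube)
    finally show "norm (case p of (n, m) \<Rightarrow> 1 / (\<omega> (n, m) ^ 2 * (\<omega> (n, m) + 1))) \<le> 2 * C ^ 3 * (1 / weight p ^ 3)"
      by (simp add: p)
  qed
  thus ?thesis by (rule abs_summable_summable)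
qed

lemma summable_row_sums: "(\<lambda>n::int. \<Sum>\<^sub>\<infinity>m::int. 1 / (of_int n * \<tau> + of_int m) ^ 2) summable_on UNIV"
proof -
  let ?f = "\<lambda>n m::int. 1 / (\<omega> (n, m) ^ 2 * (\<omega> (n, m) + 1))"
  have "(\<lambda>n. \<Sum>\<^sub>\<infinity>m. ?f n m) summable_on (- {0})"
    by (rule summable_on_Sigma_banach[OF summable_telescoped])
  also have "?this \<longleftrightarrow> (\<lambda>n::int. \<Sum>\<^sub>\<infinity>m::int. 1 / (of_int n * \<tau> + of_int m) ^ 2) summable_on (- {0})"
  proof (rule summable_on_cong)
    fix n :: int assume n: "n \<in> - {0}"
    have nz: "of_int n * \<tau> + of_int m \<noteq> 0" for m :: int
      using lat_eq_0_iff[of "(n, m)"] n by (simp add: lat_def)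
    have "(\<lambda>m. ?f n m) summable_on UNIV"
      using summable_on_SigmaD1[OF summable_telescoped n] .
    hence "(\<lambda>m. 1 / ((of_int n * \<tau> + of_int m) ^ 2 * (of_int n * \<tau> + of_int m + 1))) summable_on UNIV"
      by (simp add: lat_def)
    from inverse_square_telescoped[OF nz this]
    show "(\<Sum>\<^sub>\<infinity>m. ?f n m) = (\<Sum>\<^sub>\<infinity>m::int. 1 / (of_int n * \<tau> + of_int m) ^ 2)"
      by (simp add: lat_def)
  qed
  finally show ?thesis using summable_on_cofinite[of "{0}"] by blast
qed

text \<open>Both Eisenstein sums converge separately, and the difference of their rows is a row of the
  absolutely convergent series for the Weierstrass function.\<close>

lemma eisenstein_E_2_minus_e_2: "eisenstein_E 2 \<xi> \<tau> - eisenstein_e 2 \<tau> = wp \<xi>"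
proof -
  define S where "S = (\<lambda>n::int. \<Sum>\<^sub>\<infinity>m::int. 1 / (\<xi> + of_int n * \<tau> + of_int m) ^ 2)"
  define S' where "S' = (\<lambda>n::int. \<Sum>\<^sub>\<infinity>m::int. 1 / (of_int n * \<tau> + of_int m) ^ 2)"
  have inner: "lim (\<lambda>M::nat. \<Sum>m\<in>{-int M..int M}. 1 / (z + of_int m) ^ 2) = (\<Sum>\<^sub>\<infinity>m::int. 1 / (z + of_int m) ^ 2)"
    for z :: complex
    by (intro limI has_sum_int_symmetric has_sum_infsum inverse_square_summable_on_int)
  have zero: "(if (n, m) = (0, 0) then 0 else 1 / (of_int n * \<tau> + of_int m) ^ 2)
      = 1 / (of_int n * \<tau> + of_int m) ^ 2" for n m :: int by auto
  have E: "eisenstein_E 2 \<xi> \<tau> = lim (\<lambda>N::nat. \<Sum>n\<in>{-int N..int N}. S n)"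
    unfolding eisenstein_E_def lattice_sum_def S_def inner by simp
  have e: "eisenstein_e 2 \<tau> = lim (\<lambda>N::nat. \<Sum>n\<in>{-int N..int N}. S' n)"
    unfolding eisenstein_e_def lattice_sum_def S'_def zero inner by simp
  have S': "(S' has_sum infsum S' UNIV) UNIV"
    unfolding S'_def using summable_row_sums by simp
  have s: "(\<lambda>(n, m). wp_term \<xi> (n, m)) summable_on (UNIV \<times> UNIV)"
    using summable_wp[of \<xi> UNIV] by simp
  have row: "(\<Sum>\<^sub>\<infinity>m. wp_term \<xi> (n, m)) = S n - S' n" for n
    unfolding S_def S'_def
    by (subst infsum_diff[OF inverse_square_summable_on_int inverse_square_summable_on_int, symmetric])
       (simp add: wp_term_def lat_def add.assoc)
  have "(\<lambda>n. S n - S' n) summable_on UNIV"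
    using summable_on_Sigma_banach[OF s] unfolding row .
  moreover have "(\<Sum>\<^sub>\<infinity>n. S n - S' n) = wp \<xi>"
    using infsum_Sigma'_banach[OF s] unfolding row by (simp add: wp_def)
  ultimately have "((\<lambda>n. S n - S' n) has_sum wp \<xi>) UNIV" by (simp add: has_sum_iff)
  from has_sum_add[OF this S'] have S: "(S has_sum (wp \<xi> + infsum S' UNIV)) UNIV" by simp
  show ?thesis
    unfolding E e limI[OF has_sum_int_symmetric[OF S]] limI[OF has_sum_int_symmetric[OF S']] by simp
qed

abbreviation "two_pi_i \<equiv> 2 * complex_of_real pi * \<i>"

lemma P_fun_2: "P_fun 2 \<xi> \<tau> = wp \<xi> / two_pi_i ^ 2"
  by (simp only: P_fun_def eisenstein_E_2_minus_e_2)

lemma P_fun_3: "P_fun 3 \<xi> \<tau> = E3 \<xi> / two_pi_i ^ 3"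
  by (simp add: P_fun_def eisenstein_E_3 eisenstein_e_eq_lattice_e lattice_e_odd)

lemma G_fun_4: "20 * G_fun 4 \<tau> = 60 * lattice_e \<tau> 4 / two_pi_i ^ 4"
  by (simp add: G_fun_def eisenstein_e_eq_lattice_e fact_numeral)

lemma G_fun_6: "7 / 3 * G_fun 6 \<tau> = 140 * lattice_e \<tau> 6 / two_pi_i ^ 6"
  by (simp add: G_fun_def eisenstein_e_eq_lattice_e fact_numeral)

lemma weierstrass_equation_P_fun:
  assumes "\<xi> \<notin> range \<omega>"
  shows "(- 2 * P_fun 3 \<xi> \<tau>) ^ 2 =
    4 * P_fun 2 \<xi> \<tau> ^ 3 - 20 * G_fun 4 \<tau> * P_fun 2 \<xi> \<tau> - 7 / 3 * G_fun 6 \<tau>"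
proof -
  define c where "c = 1 / two_pi_i"
  have q: "z / two_pi_i ^ k = z * c ^ k" for z k by (simp add: c_def power_one_over)
  show ?thesis
    unfolding P_fun_2 P_fun_3 G_fun_4 G_fun_6 q
    using weierstrass_equation[OF assms] by algebra
qed

text \<open>Replacing \<xi> by -\<xi> separates A from the term with B, and
  P_2 takes infinitely many values near 0, where P_3 does not vanish.\<close>

lemma poly_vanishing_imp_0:
  fixes A B :: "complex poly"
  assumes "\<And>\<xi>. \<xi> \<notin> range \<omega> \<Longrightarrow> poly A (P_fun 2 \<xi> \<tau>) + (- 2 * P_fun 3 \<xi> \<tau>) * poly B (P_fun 2 \<xi> \<tau>) = 0"
  shows "A = 0" "B = 0"
proof -
  obtain r M where r: "r > 0" and L: "laurent_near_0 r M" using laurent_expansions by blast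
  define a where "a = lattice_e \<tau> 4"
  define b where "b = lattice_e \<tau> 6"
  have off: "- \<xi> \<notin> range \<omega>" if "\<xi> \<notin> range \<omega>" for \<xi>
  proof
    assume "- \<xi> \<in> range \<omega>"
    then obtain p where "- \<xi> = \<omega> p" by auto
    hence "\<xi> = \<omega> (- p)" unfolding lat_uminus by (metis minus_minus)
    thus False using that by simp
  qed
  have A: "poly A (P_fun 2 \<xi> \<tau>) = 0" and B: "P_fun 3 \<xi> \<tau> * poly B (P_fun 2 \<xi> \<tau>) = 0"
    if "\<xi> \<notin> range \<omega>" for \<xi>
  proof -
    have e: "P_fun 2 (- \<xi>) \<tau> = P_fun 2 \<xi> \<tau>" "P_fun 3 (- \<xi>) \<tau> = - P_fun 3 \<xi> \<tau>"
      by (simp_all add: P_fun_2 P_fun_3 wp_even E3_odd)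
    have 1: "poly A (P_fun 2 \<xi> \<tau>) + (- 2 * P_fun 3 \<xi> \<tau>) * poly B (P_fun 2 \<xi> \<tau>) = 0"
      using assms that by blast
    have 2: "poly A (P_fun 2 \<xi> \<tau>) - (- 2 * P_fun 3 \<xi> \<tau>) * poly B (P_fun 2 \<xi> \<tau>) = 0"
      using assms[OF off[OF that]] unfolding e by simp
    have "2 * poly A (P_fun 2 \<xi> \<tau>) = 0" "4 * (P_fun 3 \<xi> \<tau> * poly B (P_fun 2 \<xi> \<tau>)) = 0"
      using 1 2 by algebra+
    thus "poly A (P_fun 2 \<xi> \<tau>) = 0" "P_fun 3 \<xi> \<tau> * poly B (P_fun 2 \<xi> \<tau>) = 0" by simp_all
  qed
  define M' where "M' = 10 * norm a + 10 * norm b + M"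
  have near: "norm (wp \<xi>) \<ge> 1 / norm \<xi> ^ 2 - M'" "norm (E3 \<xi>) \<ge> 1 / norm \<xi> ^ 3 - M'" "\<xi> \<notin> range \<omega>"
    if \<xi>: "0 < norm \<xi>" "norm \<xi> < min r 1" for \<xi>
  proof -
    have \<xi>r: "norm \<xi> < r" using \<xi> by simp
    obtain \<rho> \<sigma> where \<rho>: "norm \<rho> \<le> M" and \<sigma>: "norm \<sigma> \<le> M" and
      wp: "wp \<xi> = 1 / \<xi> ^ 2 + 3 * a * \<xi> ^ 2 + 5 * b * \<xi> ^ 4 + \<rho> * \<xi> ^ 5" and
      E3: "E3 \<xi> = 1 / \<xi> ^ 3 - 3 * a * \<xi> - 10 * b * \<xi> ^ 3 + \<sigma> * \<xi> ^ 4"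
      using L \<xi>(1) \<xi>r unfolding a_def b_def laurent_near_0_def by blast
    have pw: "norm \<xi> ^ k \<le> 1" for k using \<xi> by (simp add: power_le_one)
    have mb: "norm c * norm \<xi> ^ k \<le> norm c" for c :: complex and k
      using mult_left_mono[OF pw[of k] norm_ge_zero[of c]] by simp
    have "norm (1 / \<xi> ^ 2) = norm (wp \<xi> - (3 * a * \<xi> ^ 2 + 5 * b * \<xi> ^ 4 + \<rho> * \<xi> ^ 5))"
      by (simp add: wp)
    also have "\<dots> \<le> norm (wp \<xi>) + norm (3 * a * \<xi> ^ 2 + 5 * b * \<xi> ^ 4 + \<rho> * \<xi> ^ 5)"
      by (rule norm_triangle_ineq4)
    also have "norm (3 * a * \<xi> ^ 2 + 5 * b * \<xi> ^ 4 + \<rho> * \<xi> ^ 5)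
        \<le> norm (3 * a * \<xi> ^ 2) + norm (5 * b * \<xi> ^ 4) + norm (\<rho> * \<xi> ^ 5)"
      by (intro order_trans[OF norm_triangle_ineq] add_mono order_refl)
    also have "\<dots> = 3 * (norm a * norm \<xi> ^ 2) + 5 * (norm b * norm \<xi> ^ 4) + norm \<rho> * norm \<xi> ^ 5"
      by (simp add: norm_mult norm_power)
    also have "\<dots> \<le> M'"
      using mb[of a 2] mb[of b 4] mb[of \<rho> 5] \<rho> norm_ge_zero[of a] norm_ge_zero[of b] unfolding M'_def by linarith
    finally show "norm (wp \<xi>) \<ge> 1 / norm \<xi> ^ 2 - M'" by (simp add: norm_divide norm_power)
    have "norm (1 / \<xi> ^ 3) = norm (E3 \<xi> - (- (3 * a * \<xi> ^ 1) - 10 * b * \<xi> ^ 3 + \<sigma> * \<xi> ^ 4))"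
      by (simp add: E3)
    also have "\<dots> \<le> norm (E3 \<xi>) + norm (- (3 * a * \<xi> ^ 1) - 10 * b * \<xi> ^ 3 + \<sigma> * \<xi> ^ 4)"
      by (rule norm_triangle_ineq4)
    also have "norm (- (3 * a * \<xi> ^ 1) - 10 * b * \<xi> ^ 3 + \<sigma> * \<xi> ^ 4)
        \<le> norm (- (3 * a * \<xi> ^ 1)) + norm (10 * b * \<xi> ^ 3) + norm (\<sigma> * \<xi> ^ 4)"
      by (intro order_trans[OF norm_triangle_ineq] order_trans[OF norm_triangle_ineq4] add_mono order_refl)
    also have "\<dots> = 3 * (norm a * norm \<xi> ^ 1) + 10 * (norm b * norm \<xi> ^ 3) + norm \<sigma> * norm \<xi> ^ 4"
      by (simp add: norm_mult norm_power)
    also have "\<dots> \<le> M'"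
      using mb[of a 1] mb[of b 3] mb[of \<sigma> 4] \<sigma> norm_ge_zero[of a] norm_ge_zero[of b] unfolding M'_def by linarith
    finally show "norm (E3 \<xi>) \<ge> 1 / norm \<xi> ^ 3 - M'" by (simp add: norm_divide norm_power)
    show "\<xi> \<notin> range \<omega>" using L \<xi>(1) \<xi>r unfolding laurent_near_0_def by blast
  qed
  have large: "\<exists>\<xi>. \<xi> \<notin> range \<omega> \<and> norm (wp \<xi>) > K \<and> E3 \<xi> \<noteq> 0" for K
  proof -
    \<comment> \<open>Small enough for the pole to dominate both K and the bounded rest.\<close>
    define d where "d = Min {r / 2, 1 / 2, 1 / (\<bar>K\<bar> + \<bar>M'\<bar> + 1)}"
    have d: "d > 0" "d \<le> r / 2" "d \<le> 1 / 2" "d \<le> 1 / (\<bar>K\<bar> + \<bar>M'\<bar> + 1)"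
      using r by (auto simp: d_def)
    hence i: "1 / d \<ge> \<bar>K\<bar> + \<bar>M'\<bar> + 1" by (simp add: field_simps)
    have "d ^ 2 \<le> d ^ 1" "d ^ 3 \<le> d ^ 1" using d by (intro power_decreasing; simp)+
    hence "1 / d ^ 2 \<ge> 1 / d" "1 / d ^ 3 \<ge> 1 / d" using d by (simp_all add: frac_le)
    hence "1 / d ^ 2 > K + M'" "1 / d ^ 3 > M'" using i by linarith+
    moreover have "0 < norm (of_real d :: complex)" "norm (of_real d :: complex) < min r 1"
      using d r by auto
    note near[OF this]
    ultimately have "norm (wp (of_real d)) > K" "norm (E3 (of_real d)) > 0" "of_real d \<notin> range \<omega>"
      using d by auto
    thus ?thesis by (intro exI[of _ "of_real d"]) auto
  qed
  have zeros: "C = 0" if C: "\<And>\<xi>. \<xi> \<notin> range \<omega> \<Longrightarrow> E3 \<xi> \<noteq> 0 \<Longrightarrow> poly C (P_fun 2 \<xi> \<tau>) = 0" for C :: "complex poly"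
  proof (rule ccontr)
    assume "C \<noteq> 0"
    hence "finite {x. poly C x = 0}" by (rule poly_roots_finite)
    hence "bounded {x. poly C x = 0}" by (rule finite_imp_bounded)
    then obtain K where K: "\<And>x. poly C x = 0 \<Longrightarrow> norm x \<le> K" by (auto simp: bounded_iff)
    obtain \<xi> where \<xi>: "\<xi> \<notin> range \<omega>" "norm (wp \<xi>) > K * norm two_pi_i ^ 2" "E3 \<xi> \<noteq> 0"
      using large by blast
    have "norm (P_fun 2 \<xi> \<tau>) \<le> K" using K C \<xi> by blast
    hence "norm (wp \<xi>) \<le> K * norm two_pi_i ^ 2"
      by (simp add: P_fun_2 norm_divide norm_power norm_mult divide_le_eq)
    with \<xi>(2) show False by linarith
  qed
  show "A = 0" using zeros A by blast
  show "B = 0"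
  proof (rule zeros)
    fix \<xi> assume "\<xi> \<notin> range \<omega>" "E3 \<xi> \<noteq> 0"
    thus "poly B (P_fun 2 \<xi> \<tau>) = 0" using B[of \<xi>] by (simp add: P_fun_3)
  qed
qed

end

section \<open>Eisenstein series of weights 4 and 6\<close>

lemma upper_half_plane_it: "t > 0 \<Longrightarrow> upper_half_plane (\<i> * of_real t)"
  by unfold_locales simp

lemma norm_lat_it: "norm (lat (\<i> * of_real t) (n, m)) ^ 2 = (real_of_int n * t) ^ 2 + real_of_int m ^ 2"
  by (simp add: lat_def cmod_power2 algebra_simps)

text \<open>The pair (n, m) is sent to (n + c m, m). For a fixed \<tau>, these transformations alone provide
  infinitely many factors of automorphy c \<tau> + 1.\<close>

lemma lattice_e_modular:
  assumes "Im \<tau> > 0" and "k > 0"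
  shows "lattice_e (\<tau> / (of_nat c * \<tau> + 1)) k = (of_nat c * \<tau> + 1) ^ k * lattice_e \<tau> k"
    and "Im (\<tau> / (of_nat c * \<tau> + 1)) > 0"
proof -
  interpret upper_half_plane \<tau> by unfold_locales (rule assms)
  let ?d = "of_nat c * \<tau> + 1"
  have d: "?d \<noteq> 0" using lat_eq_0_iff[of "(int c, 1)"] by (simp add: lat_def)
  have *: "lat (\<tau> / ?d) p = \<omega> (fst p + int c * snd p, snd p) / ?d" for p
    using d by (simp add: lat_def field_simps)
  have "lattice_e (\<tau> / ?d) k = (\<Sum>\<^sub>\<infinity>p. ?d ^ k * (1 / \<omega> (fst p + int c * snd p, snd p) ^ k))"
    unfolding lattice_e_def * by (simp add: power_divide)
  also have "\<dots> = (\<Sum>\<^sub>\<infinity>p. ?d ^ k * (1 / \<omega> p ^ k))"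
    by (rule infsum_reindex_bij_witness[of _ "\<lambda>p. (fst p - int c * snd p, snd p)" "\<lambda>p. (fst p + int c * snd p, snd p)"]) auto
  also have "\<dots> = ?d ^ k * lattice_e \<tau> k"
    unfolding lattice_e_def by (rule infsum_cmult_right')
  finally show "lattice_e (\<tau> / ?d) k = ?d ^ k * lattice_e \<tau> k" .
  have "Im (\<tau> / ?d) = Im (\<tau> * cnj ?d) / norm ?d ^ 2"
    by (simp add: complex_div_cnj[of \<tau> ?d])
  also have "Im (\<tau> * cnj ?d) = Im \<tau>" by (simp add: algebra_simps)
  finally show "Im (\<tau> / ?d) > 0" using d assms(1) by simp
qed

text \<open>For t \<ge> 1 every lattice point moves away from the origin, so that the terms are dominated by those
  for t = 1.\<close>

lemma lattice_e_continuous_it: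
  assumes k: "k \<ge> 3"
  shows "continuous_on {1..} (\<lambda>t::real. lattice_e (\<i> * of_real t) k)"
proof -
  interpret upper_half_plane \<i> by unfold_locales simp
  have bound: "norm (1 / lat (\<i> * of_real t) p ^ k) \<le> 1 / norm (\<omega> p) ^ k" if "t \<in> {1..}" for t p
  proof (cases "p = (0, 0)")
    case True
    then show ?thesis using k by (simp add: power_0_left)
  next
    case False
    obtain n m where p: "p = (n, m)" by (cases p)
    have "norm (\<omega> p) ^ 2 = real_of_int n ^ 2 + real_of_int m ^ 2"
      using norm_lat_it[of 1 n m] by (simp add: p)
    also have "\<dots> \<le> (real_of_int n * t) ^ 2 + real_of_int m ^ 2"
    proof -
      have "real_of_int n ^ 2 * 1 \<le> real_of_int n ^ 2 * t ^ 2"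
        using that by (intro mult_left_mono) auto
      thus ?thesis by (simp add: power_mult_distrib)
    qed
    also have "\<dots> = norm (lat (\<i> * of_real t) p) ^ 2" by (simp add: norm_lat_it p)
    finally have "norm (\<omega> p) \<le> norm (lat (\<i> * of_real t) p)" by (rule power2_le_imp_le) simp
    moreover have "norm (\<omega> p) > 0" using False by simp
    ultimately show ?thesis
      unfolding norm_divide norm_power norm_one by (intro frac_le power_mono) auto
  qed
  have ul: "uniform_limit {1..} (\<lambda>Y t. \<Sum>p\<in>Y. 1 / lat (\<i> * of_real t) p ^ k)
      (\<lambda>t. lattice_e (\<i> * of_real t) k) (finite_subsets_at_top UNIV)"
    unfolding lattice_e_def
    by (rule Weierstrass_m_test_general[OF bound summable_norm_lat[OF k]])
  show ?thesis
  proof (rule uniform_limit_theorem[OF _ ul])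
    show "\<forall>\<^sub>F Y in finite_subsets_at_top UNIV. continuous_on {1..} (\<lambda>t::real. \<Sum>p\<in>Y. 1 / lat (\<i> * of_real t) p ^ k)"
    proof (intro always_eventually allI continuous_on_sum)
      fix Y p
      show "continuous_on {1..} (\<lambda>t::real. 1 / lat (\<i> * of_real t) p ^ k)"
      proof (cases "p = (0, 0)")
        case True
        then show ?thesis by simp
      next
        case False
        have "lat (\<i> * of_real t) p \<noteq> 0" if "t \<in> {1..}" for t
          using upper_half_plane.lat_eq_0_iff[OF upper_half_plane_it, of t p] that False by simp
        moreover have "continuous_on {1..} (\<lambda>t::real. lat (\<i> * of_real t) p)"
          unfolding lat_def by (intro continuous_intros)
        ultimately show ?thesis by (intro continuous_intros) auto
      qed
    qed
  qed auto
qed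

lemma inverse_square_sum_int:
  shows "(\<lambda>n::int. 1 / real_of_int n ^ 2) summable_on UNIV"
    and "(\<Sum>\<^sub>\<infinity>n::int. 1 / real_of_int n ^ 2) < 4"
proof -
  have S: "((\<lambda>n::nat. 1 / real (Suc n) ^ 2) has_sum (pi ^ 2 / 6)) UNIV"
    using inverse_squares_sums
    by (intro sums_nonneg_imp_has_sum) (auto simp: add.commute)
  have 1: "((\<lambda>n::int. 1 / real_of_int n ^ 2) has_sum (pi ^ 2 / 6)) {1..}"
    using S
  proof (rule has_sum_reindex_bij_witness[THEN iffD1, rotated -1])
    show "int (nat (n - 1)) + 1 = n" if "n \<in> {1..}" for n using that by auto
  qed auto
  have 2: "((\<lambda>n::int. 1 / real_of_int n ^ 2) has_sum (pi ^ 2 / 6)) {..-1}"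
    using 1 by (rule has_sum_reindex_bij_witness[of _ uminus uminus, THEN iffD1, rotated -1]) auto
  have "((\<lambda>n::int. 1 / real_of_int n ^ 2) has_sum (pi ^ 2 / 6 + pi ^ 2 / 6)) ({1..} \<union> {..-1})"
    by (rule has_sum_Un_disjoint[OF 1 2]) auto
  hence "((\<lambda>n::int. 1 / real_of_int n ^ 2) has_sum (1 / real_of_int 0 ^ 2 + (pi ^ 2 / 6 + pi ^ 2 / 6)))
      (insert 0 ({1..} \<union> {..-1}))"
    by (intro has_sum_insert) auto
  also have "insert 0 ({1..} \<union> {..-1}) = (UNIV :: int set)" by auto
  finally have *: "((\<lambda>n::int. 1 / real_of_int n ^ 2) has_sum (pi ^ 2 / 3)) UNIV" by simp
  thus "(\<lambda>n::int. 1 / real_of_int n ^ 2) summable_on UNIV" by (rule has_sum_imp_summable)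
  have "pi ^ 2 < (3.2 :: real) ^ 2" using pi_approx by (intro power_strict_mono) auto
  hence "pi ^ 2 / 3 < 4" by (simp add: power2_eq_square)
  thus "(\<Sum>\<^sub>\<infinity>n::int. 1 / real_of_int n ^ 2) < 4" using * by (simp add: infsumI)
qed

lemma has_sum_finite_support:
  fixes f :: "'a \<Rightarrow> real"
  assumes "finite F"
  shows "((\<lambda>p. if p \<in> F then f p else 0) has_sum sum f F) UNIV"
  by (rule has_sum_finite_neutralI[of F]) (use assms in auto)

text \<open>Twice \<open>\<zeta>(2)\<close>, since the term at 0 is 1 / 0 = 0.\<close>

definition zeta2_int :: real where "zeta2_int = (\<Sum>\<^sub>\<infinity>n::int. 1 / real_of_int n ^ 2)"

lemma zeta2_int: "((\<lambda>n::int. 1 / real_of_int n ^ 2) has_sum zeta2_int) UNIV" "zeta2_int < 4" "zeta2_int \<ge> 0"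
  unfolding zeta2_int_def using inverse_square_sum_int by (auto intro: infsum_nonneg)

lemma norm_lat_it_ge:
  assumes "t > 0"
  shows "norm (lat (\<i> * of_real t) (n, m)) ^ 2 \<ge> 2 * t * \<bar>of_int n\<bar> * \<bar>of_int m\<bar>"
proof -
  have "0 \<le> (\<bar>of_int n\<bar> * t - \<bar>of_int m\<bar>) ^ 2" by simp
  also have "\<dots> = (of_int n * t) ^ 2 + of_int m ^ 2 - 2 * t * \<bar>of_int n\<bar> * \<bar>of_int m\<bar>"
    by (simp add: power2_diff power_mult_distrib algebra_simps)
  finally show ?thesis unfolding norm_lat_it by simp
qed

text \<open>The four shortest points on the axes contribute 2 + 2 / t^4. The other points on the axes
  contribute positive amounts, and by the inequality of the arithmetic and the geometric mean
  the points off the axes contribute less than 4 / t^2 in absolute value.\<close>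

lemma lattice_e_4_it_nonzero:
  assumes t: "t \<ge> 1"
  shows "lattice_e (\<i> * of_real t) 4 \<noteq> 0"
proof -
  interpret upper_half_plane "\<i> * of_real t" by (rule upper_half_plane_it) (use t in simp)
  define F where "F = {(0::int, 1::int), (0, -1), (1, 0), (-1, 0)}"
  define f :: "int \<times> int \<Rightarrow> real" where "f = (\<lambda>p. if fst p = 0 then 1 else 1 / t ^ 4)"
  have s1: "((\<lambda>p. Re (1 / \<omega> p ^ 4)) has_sum Re (lattice_e (\<i> * of_real t) 4)) UNIV"
    unfolding lattice_e_def by (intro has_sum_Re has_sum_infsum summable_lat) auto
  have s2: "((\<lambda>p. (if p \<in> F then f p else 0)
      - 1 / (4 * t ^ 2) * (case p of (n, m) \<Rightarrow> 1 / real_of_int n ^ 2 * (1 / real_of_int m ^ 2)))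
      has_sum (sum f F - 1 / (4 * t ^ 2) * (zeta2_int * zeta2_int))) UNIV"
    using summable_on_product_real[OF has_sum_imp_summable[OF zeta2_int(1)] has_sum_imp_summable[OF zeta2_int(1)]]
    by (intro has_sum_diff has_sum_finite_support has_sum_cmult_right) (auto simp: F_def zeta2_int_def)
  have le: "Re (1 / \<omega> p ^ 4) \<ge> (if p \<in> F then f p else 0)
      - 1 / (4 * t ^ 2) * (case p of (n, m) \<Rightarrow> 1 / real_of_int n ^ 2 * (1 / real_of_int m ^ 2))" for p
  proof -
    obtain n m where p: "p = (n, m)" by (cases p)
    consider "n = 0" | "m = 0" "n \<noteq> 0" | "n \<noteq> 0" "m \<noteq> 0" by blast
    thus ?thesis
    proof cases
      case 1
      have "1 / \<omega> p ^ 4 = of_real (1 / real_of_int m ^ 4)" by (simp add: p lat_def 1)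
      hence "Re (1 / \<omega> p ^ 4) = 1 / real_of_int m ^ 4" by (simp only: Re_complex_of_real)
      thus ?thesis by (auto simp: p 1 F_def f_def)
    next
      case 2
      have "1 / \<omega> p ^ 4 = of_real (1 / (real_of_int n ^ 4 * t ^ 4))"
        by (simp add: p lat_def 2 power_mult_distrib)
      hence "Re (1 / \<omega> p ^ 4) = 1 / (real_of_int n ^ 4 * t ^ 4)" by (simp only: Re_complex_of_real)
      thus ?thesis using t by (auto simp: p 2 F_def f_def)
    next
      case 3
      have pos: "0 < 2 * t * \<bar>real_of_int n\<bar> * \<bar>real_of_int m\<bar>" using 3 t by simp
      have "(2 * t * \<bar>real_of_int n\<bar> * \<bar>real_of_int m\<bar>) ^ 2 \<le> (norm (\<omega> p) ^ 2) ^ 2"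
        unfolding p using norm_lat_it_ge[of t n m] t pos by (intro power_mono) auto
      hence "1 / (norm (\<omega> p) ^ 2) ^ 2 \<le> 1 / (2 * t * \<bar>real_of_int n\<bar> * \<bar>real_of_int m\<bar>) ^ 2"
        using pos by (intro divide_left_mono mult_pos_pos) (auto simp: zero_less_power order.strict_trans2[OF zero_less_power[OF pos]])
      also have "\<dots> = 1 / (4 * t ^ 2) * (1 / real_of_int n ^ 2 * (1 / real_of_int m ^ 2))"
        by (simp add: power_mult_distrib)
      finally have "norm (1 / \<omega> p ^ 4) \<le> 1 / (4 * t ^ 2) * (1 / real_of_int n ^ 2 * (1 / real_of_int m ^ 2))"
        by (simp add: norm_divide norm_power)
      moreover have "- norm (1 / \<omega> p ^ 4) \<le> Re (1 / \<omega> p ^ 4)"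
        using abs_Re_le_cmod[of "1 / \<omega> p ^ 4"] by linarith
      ultimately show ?thesis using 3 by (auto simp: p F_def)
    qed
  qed
  have "sum f F - 1 / (4 * t ^ 2) * (zeta2_int * zeta2_int) \<le> Re (lattice_e (\<i> * of_real t) 4)"
    by (rule has_sum_mono[OF s2 s1 le])
  moreover have "sum f F = 2 + 2 / t ^ 4" by (simp add: F_def f_def)
  moreover have "1 / (4 * t ^ 2) * (zeta2_int * zeta2_int) < 2 + 2 / t ^ 4"
  proof -
    have "zeta2_int * zeta2_int < 16" using zeta2_int mult_strict_mono[of zeta2_int 4 zeta2_int 4] by simp
    hence "1 / (4 * t ^ 2) * (zeta2_int * zeta2_int) < 1 / (4 * t ^ 2) * 16"
      using t by (intro mult_strict_left_mono) auto
    also have "\<dots> = 4 * (1 / t ^ 2)" by simp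
    also have "\<dots> \<le> 2 + 2 * (1 / t ^ 2) ^ 2"
      using zero_le_power2[of "1 / t ^ 2 - 1"] by (simp add: power2_diff)
    also have "\<dots> = 2 + 2 / t ^ 4" by (simp add: power_one_over flip: power_mult)
    finally show ?thesis .
  qed
  ultimately have "Re (lattice_e (\<i> * of_real t) 4) > 0" by linarith
  thus ?thesis by auto
qed

text \<open>Multiplication by \<open>\<i>\<close> permutes the Gaussian integers and changes the sign of
  the sixth powers.\<close>

lemma lattice_e_6_i: "lattice_e \<i> 6 = 0"
proof -
  have "lattice_e \<i> 6 = (\<Sum>\<^sub>\<infinity>p. - (1 / lat \<i> p ^ 6))"
    unfolding lattice_e_def
  proof (rule infsum_reindex_bij_witness[of _ "\<lambda>p. (snd p, - fst p)" "\<lambda>p. (- snd p, fst p)"])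
    fix p :: "int \<times> int"
    have "lat \<i> (- snd p, fst p) = - (\<i> * of_int (snd p)) + of_int (fst p)" by (simp add: lat_def)
    also have "\<dots> = - (\<i> * lat \<i> p)" by (simp add: lat_def algebra_simps)
    finally have e: "lat \<i> (- snd p, fst p) = - (\<i> * lat \<i> p)" .
    show "- (1 / lat \<i> (- snd p, fst p) ^ 6) = 1 / lat \<i> p ^ 6"
    proof -
      have "\<i> ^ 6 = (-1 :: complex)" using power_mult[of \<i> 2 3] by simp
      hence "(- (\<i> * z)) ^ 6 = - (z ^ 6)" for z by (simp add: power_mult_distrib)
      thus ?thesis unfolding e by simp
    qed
  qed auto
  also have "\<dots> = - lattice_e \<i> 6" unfolding lattice_e_def by (rule infsum_uminus)
  finally show ?thesis by simp
qed

text \<open>The points 1 and -1 contribute 2. The remaining points of the real axis contribute positive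
  amounts, and all other points together contribute less than 1 in absolute value.\<close>

lemma lattice_e_6_2i_nonzero: "lattice_e (\<i> * of_real 2) 6 \<noteq> 0"
proof -
  interpret upper_half_plane "\<i> * of_real 2" by (rule upper_half_plane_it) simp
  define F where "F = {(0::int, 1::int), (0, -1)}"
  define z where "z = (\<lambda>m::int. (if m \<in> {0} then 1 else 0) + 1 / real_of_int m ^ 2)"
  have z: "(z has_sum (1 + zeta2_int)) UNIV"
    unfolding z_def using has_sum_finite_support[of "{0::int}" "\<lambda>_. 1"] by (intro has_sum_add zeta2_int(1)) auto
  have s1: "((\<lambda>p. Re (1 / \<omega> p ^ 6)) has_sum Re (lattice_e (\<i> * of_real 2) 6)) UNIV"
    unfolding lattice_e_def by (intro has_sum_Re has_sum_infsum summable_lat) auto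
  have s2: "((\<lambda>p. (if p \<in> F then 1 else 0)
      - 1 / 64 * (case p of (n, m) \<Rightarrow> 1 / real_of_int n ^ 2 * z m))
      has_sum (sum (\<lambda>_. 1) F - 1 / 64 * (zeta2_int * (1 + zeta2_int)))) UNIV"
  proof (intro has_sum_diff has_sum_finite_support has_sum_cmult_right)
    have "z m \<ge> 0" for m by (simp add: z_def)
    from summable_on_product_real[OF has_sum_imp_summable[OF zeta2_int(1)] has_sum_imp_summable[OF z] _ this]
    show "((\<lambda>p. case p of (n, m) \<Rightarrow> 1 / real_of_int n ^ 2 * z m) has_sum zeta2_int * (1 + zeta2_int)) UNIV"
      using infsumI[OF z] infsumI[OF zeta2_int(1)] by simp
  qed (simp add: F_def)
  have le: "Re (1 / \<omega> p ^ 6) \<ge> (if p \<in> F then 1 else 0)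
      - 1 / 64 * (case p of (n, m) \<Rightarrow> 1 / real_of_int n ^ 2 * z m)" for p
  proof -
    obtain n m where p: "p = (n, m)" by (cases p)
    show ?thesis
    proof (cases "n = 0")
      case True
      have "1 / \<omega> p ^ 6 = of_real (1 / real_of_int m ^ 6)" by (simp add: p lat_def True)
      hence "Re (1 / \<omega> p ^ 6) = 1 / real_of_int m ^ 6" by (simp only: Re_complex_of_real)
      thus ?thesis by (auto simp: p True F_def)
    next
      case n: False
      have n1: "real_of_int n ^ 2 \<ge> 1"
        using n by (metis of_int_1_le_iff of_int_power zero_less_power2 int_one_le_iff_zero_less)
      have q: "norm (\<omega> p) ^ 2 = 4 * real_of_int n ^ 2 + real_of_int m ^ 2"
        unfolding p norm_lat_it by (simp add: power_mult_distrib)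
      have "norm (1 / \<omega> p ^ 6) = 1 / (norm (\<omega> p) ^ 2) ^ 3"
        by (simp add: norm_divide norm_power flip: power_mult)
      also have "\<dots> \<le> 1 / 64 * (1 / real_of_int n ^ 2 * z m)"
      proof (cases "m = 0")
        case True
        have "1 / (norm (\<omega> p) ^ 2) ^ 3 = 1 / (64 * (real_of_int n ^ 2 * (real_of_int n ^ 2) ^ 2))"
          unfolding q True by (simp add: power_mult_distrib eval_nat_numeral)
        also have "\<dots> \<le> 1 / (64 * (real_of_int n ^ 2 * 1))"
        proof (rule frac_le)
          have "real_of_int n ^ 2 * 1 \<le> real_of_int n ^ 2 * (real_of_int n ^ 2) ^ 2"
            using one_le_power[OF n1, of 2] by (rule mult_left_mono) simp
          thus "64 * (real_of_int n ^ 2 * 1) \<le> 64 * (real_of_int n ^ 2 * (real_of_int n ^ 2) ^ 2)"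
            by linarith
          show "0 < 64 * (real_of_int n ^ 2 * 1)" using n by simp
        qed auto
        finally show ?thesis by (simp add: True z_def)
      next
        case m: False
        define A where "A = real_of_int n ^ 2"
        define B where "B = real_of_int m ^ 2"
        have A: "A \<ge> 1" using n1 by (simp add: A_def)
        have B: "B > 0" using m by (simp add: B_def)
        \<comment> \<open>Arithmetic and geometric mean of 4 A and B, and then 4 A + B is at least 4.\<close>
        have "64 * (A * B) \<le> 4 * (4 * A + B) ^ 2"
          using zero_le_power2[of "4 * A - B"] by (simp add: power2_eq_square algebra_simps)
        also have "\<dots> \<le> (4 * A + B) * (4 * A + B) ^ 2"
          using A B by (intro mult_right_mono) auto
        also have "\<dots> = (4 * A + B) ^ 3" by (simp add: eval_nat_numeral)
        finally have "1 / (4 * A + B) ^ 3 \<le> 1 / (64 * (A * B))"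
          using A B by (intro divide_left_mono) auto
        thus ?thesis unfolding q using m by (simp add: A_def B_def z_def)
      qed
      finally have "norm (1 / \<omega> p ^ 6) \<le> 1 / 64 * (1 / real_of_int n ^ 2 * z m)" .
      moreover have "- norm (1 / \<omega> p ^ 6) \<le> Re (1 / \<omega> p ^ 6)"
        using abs_Re_le_cmod[of "1 / \<omega> p ^ 6"] by linarith
      ultimately show ?thesis using n by (auto simp: p F_def)
    qed
  qed
  have "sum (\<lambda>_. 1) F - 1 / 64 * (zeta2_int * (1 + zeta2_int)) \<le> Re (lattice_e (\<i> * of_real 2) 6)"
    by (rule has_sum_mono[OF s2 s1 le])
  moreover have "sum (\<lambda>_. 1) F = (2::real)" by (simp add: F_def)
  moreover have "1 / 64 * (zeta2_int * (1 + zeta2_int)) \<le> 1"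
  proof -
    have "zeta2_int * (1 + zeta2_int) \<le> 4 * (1 + 4)" using zeta2_int by (intro mult_mono) auto
    hence "1 / 64 * (zeta2_int * (1 + zeta2_int)) \<le> 1 / 64 * (4 * (1 + 4))" by (rule mult_left_mono) simp
    thus ?thesis by (rule order_trans) simp
  qed
  moreover have "0 < r" if "s - q \<le> r" "s = 2" "q \<le> 1" for s q r :: real
    using that by linarith
  ultimately have "Re (lattice_e (\<i> * of_real 2) 6) > 0" by blast
  thus ?thesis by auto
qed

text \<open>Up to a Moebius transformation this is the j-invariant along the imaginary axis.\<close>

definition e6_e4_ratio :: "real \<Rightarrow> complex" where
  "e6_e4_ratio t = lattice_e (\<i> * of_real t) 6 ^ 2 / lattice_e (\<i> * of_real t) 4 ^ 3"

text \<open>A connected set with more than one point is infinite; the ratio vanishes for the square lattice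
  but not for the lattice with period ratio 2.\<close>

lemma infinite_e6_e4_ratio: "infinite (e6_e4_ratio ` {1..2})"
proof -
  have "continuous_on {1..} e6_e4_ratio"
    unfolding e6_e4_ratio_def using lattice_e_4_it_nonzero
    by (intro continuous_intros lattice_e_continuous_it) auto
  hence "continuous_on {1..2} e6_e4_ratio" by (rule continuous_on_subset) auto
  hence "connected (e6_e4_ratio ` {1..2})"
    by (rule connected_continuous_image) (rule connected_Icc)
  moreover have "e6_e4_ratio 1 \<in> e6_e4_ratio ` {1..2}" "e6_e4_ratio 2 \<in> e6_e4_ratio ` {1..2}" by auto
  moreover have "e6_e4_ratio 1 = 0" using lattice_e_6_i by (simp add: e6_e4_ratio_def)
  moreover have "e6_e4_ratio 2 \<noteq> 0"
    using lattice_e_6_2i_nonzero lattice_e_4_it_nonzero[of 2] by (simp add: e6_e4_ratio_def)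
  ultimately show ?thesis using connected_finite_iff_sing by (metis empty_iff singletonD)
qed

section \<open>Polynomials vanishing on the universal curve\<close>

definition eval1 :: "rat poly \<Rightarrow> 'a::field_char_0 \<Rightarrow> 'a" where
  "eval1 p v = poly (map_poly of_rat p) v"

definition eval2 :: "rat poly poly \<Rightarrow> 'a::field_char_0 \<Rightarrow> 'a \<Rightarrow> 'a" where
  "eval2 p u v = poly (map_poly (\<lambda>q. eval1 q v) p) u"

text \<open>This evaluation is used in two ways: for polynomials in y, u, v, as the inner part of
  \<open>eval4\<close>, and for polynomials in x, u, v after y has been reduced.\<close>

definition eval3 :: "rat poly poly poly \<Rightarrow> 'a::field_char_0 \<Rightarrow> 'a \<Rightarrow> 'a \<Rightarrow> 'a" where
  "eval3 p y u v = poly (map_poly (\<lambda>q. eval2 q u v) p) y"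

lemma eval4_altdef: "eval4 p x y u v = poly (map_poly (\<lambda>q. eval3 q y u v) p) x"
  by (simp add: eval4_def eval3_def eval2_def eval1_def)

lemma eval1_0 [simp]: "eval1 0 v = 0" by (simp add: eval1_def)
lemma eval2_0 [simp]: "eval2 0 u v = 0" by (simp add: eval2_def)
lemma eval3_0 [simp]: "eval3 0 y u v = 0" by (simp add: eval3_def)
lemma eval4_0 [simp]: "eval4 0 x y u v = 0" by (simp add: eval4_altdef)

lemma eval1_pCons [simp]: "eval1 (pCons a p) v = of_rat a + v * eval1 p v"
  by (simp add: eval1_def map_poly_pCons)
lemma eval2_pCons [simp]: "eval2 (pCons a p) u v = eval1 a v + u * eval2 p u v"
  by (simp add: eval2_def map_poly_pCons)
lemma eval3_pCons [simp]: "eval3 (pCons a p) y u v = eval2 a u v + y * eval3 p y u v"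
  by (simp add: eval3_def map_poly_pCons)
lemma eval4_pCons [simp]: "eval4 (pCons a p) x y u v = eval3 a y u v + x * eval4 p x y u v"
  by (simp add: eval4_altdef map_poly_pCons)

lemma eval1_add [simp]: "eval1 (p + q) v = eval1 p v + eval1 q v"
  by (induction p q rule: poly_induct2) (auto simp: of_rat_add algebra_simps)
lemma eval2_add [simp]: "eval2 (p + q) u v = eval2 p u v + eval2 q u v"
  by (induction p q rule: poly_induct2) (auto simp: algebra_simps)
lemma eval3_add [simp]: "eval3 (p + q) y u v = eval3 p y u v + eval3 q y u v"
  by (induction p q rule: poly_induct2) (auto simp: algebra_simps)

lemma eval2_smult_v: "eval2 (smult [:0, 1:] p) u v = v * eval2 p u v"
proof (induction p)
  case (pCons a p)
  have "eval1 ([:0, 1:] * a) v = v * eval1 a v" for a by simp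
  with pCons show ?case by (simp add: algebra_simps)
qed simp

lemma eval1_uminus [simp]: "eval1 (- p) v = - eval1 p v"
  by (induction p) (auto simp: of_rat_minus)
lemma eval2_uminus [simp]: "eval2 (- p) u v = - eval2 p u v"
  by (induction p) auto
lemma eval3_uminus [simp]: "eval3 (- p) y u v = - eval3 p y u v"
  by (induction p) auto

lemma eval3_smult_u: "eval3 (smult [:0, 1:] p) x u v = u * eval3 p x u v"
proof (induction p)
  case (pCons a p)
  have "eval2 ([:0, 1:] * a) u v = u * eval2 a u v" for a by simp
  with pCons show ?case by (simp add: algebra_simps)
qed simp

lemma eval3_smult_v: "eval3 (smult [:[:0, 1:]:] p) x u v = v * eval3 p x u v"
proof (induction p)
  case (pCons a p)
  have "eval2 ([:[:0, 1:]:] * a) u v = v * eval2 a u v" for a by (simp add: eval2_smult_v)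
  with pCons show ?case by (simp add: algebra_simps)
qed simp

text \<open>Multiplication by 4 x^3 - u x - v, for polynomials with outermost variable x.\<close>

definition cubic_times :: "rat poly poly poly \<Rightarrow> rat poly poly poly" where
  "cubic_times p = (let q = pCons 0 (pCons 0 (pCons 0 p)) in q + q + q + q)
     + - pCons 0 (smult [:0, 1:] p) + - smult [:[:0, 1:]:] p"

lemma eval3_cubic_times:
  "eval3 (cubic_times p) x u v = (4 * x ^ 3 - u * x - v) * eval3 p x u v"
  unfolding cubic_times_def Let_def eval3_add eval3_uminus eval3_pCons eval3_smult_u eval3_smult_v eval2_0
  by algebra

definition on_curve :: "'a::field_char_0 \<Rightarrow> 'a \<Rightarrow> 'a \<Rightarrow> 'a \<Rightarrow> bool" where
  "on_curve x y u v \<longleftrightarrow> y ^ 2 = 4 * x ^ 3 - u * x - v"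

text \<open>The same A and B have to work over the complex numbers, where the vanishing is known, and over the
  field in which the generic point lies; hence the two conjuncts with different types.\<close>

lemma reduce_y:
  "\<exists>A B. (\<forall>(x::'a::field_char_0) y u v. on_curve x y u v \<longrightarrow> eval3 p y u v = eval3 A x u v + y * eval3 B x u v) \<and>
         (\<forall>(x::'b::field_char_0) y u v. on_curve x y u v \<longrightarrow> eval3 p y u v = eval3 A x u v + y * eval3 B x u v)"
proof (induction p)
  case 0
  show ?case by (rule exI[of _ 0], rule exI[of _ 0]) simp
next
  case (pCons a p)
  then obtain A B where
    1: "\<And>(x::'a) y u v. on_curve x y u v \<Longrightarrow> eval3 p y u v = eval3 A x u v + y * eval3 B x u v" and
    2: "\<And>(x::'b) y u v. on_curve x y u v \<Longrightarrow> eval3 p y u v = eval3 A x u v + y * eval3 B x u v"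
    by blast
  have step: "e + y * (r + y * s) = e + (4 * x ^ 3 - u * x - v) * s + y * r"
    if "on_curve x y u v" for x y u v r s e :: "'c::field_char_0"
    using that unfolding on_curve_def by algebra
  show ?case
    by (rule exI[of _ "[:a:] + cubic_times B"], rule exI[of _ A])
       (auto simp: 1 2 eval3_cubic_times step)
qed

lemma reduce_xy:
  "\<exists>A B. (\<forall>(x::'a::field_char_0) y u v. on_curve x y u v \<longrightarrow> eval4 p x y u v = eval3 A x u v + y * eval3 B x u v) \<and>
         (\<forall>(x::'b::field_char_0) y u v. on_curve x y u v \<longrightarrow> eval4 p x y u v = eval3 A x u v + y * eval3 B x u v)"
proof (induction p)
  case 0
  show ?case by (rule exI[of _ 0], rule exI[of _ 0]) simp
next
  case (pCons a p)
  then obtain A B where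
    1: "\<And>(x::'a) y u v. on_curve x y u v \<Longrightarrow> eval4 p x y u v = eval3 A x u v + y * eval3 B x u v" and
    2: "\<And>(x::'b) y u v. on_curve x y u v \<Longrightarrow> eval4 p x y u v = eval3 A x u v + y * eval3 B x u v"
    by blast
  obtain A' B' where
    3: "\<And>(x::'a) y u v. on_curve x y u v \<Longrightarrow> eval3 a y u v = eval3 A' x u v + y * eval3 B' x u v" and
    4: "\<And>(x::'b) y u v. on_curve x y u v \<Longrightarrow> eval3 a y u v = eval3 A' x u v + y * eval3 B' x u v"
    using reduce_y[of a, where 'a='a and 'b='b] by blast
  show ?case
    by (rule exI[of _ "A' + pCons 0 A"], rule exI[of _ "B' + pCons 0 B"])
       (auto simp: 1 2 3 4 algebra_simps)
qed

lemma eval2_scaled_poly: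
  fixes a b :: complex
  shows "\<exists>P. \<forall>l. poly P l = eval2 p (l ^ 4 * a) (l ^ 6 * b)"
proof (induction p)
  case 0
  show ?case by (rule exI[of _ 0]) simp
next
  case (pCons c p)
  then obtain P where P: "\<And>l. poly P l = eval2 p (l ^ 4 * a) (l ^ 6 * b)" by blast
  have "\<exists>Q. \<forall>l. poly Q l = eval1 c (l ^ 6 * b)"
  proof (induction c)
    case 0
    show ?case by (rule exI[of _ 0]) simp
  next
    case (pCons d c)
    then obtain Q where Q: "\<And>l. poly Q l = eval1 c (l ^ 6 * b)" by blast
    show ?case
      by (rule exI[of _ "[:of_rat d:] + monom b 6 * Q"]) (auto simp: Q poly_monom)
  qed
  then obtain Q where Q: "\<And>l. poly Q l = eval1 c (l ^ 6 * b)" by blast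
  show ?case
    by (rule exI[of _ "Q + monom a 4 * P"]) (auto simp: P Q poly_monom)
qed

lemma eval2_second_poly: "\<exists>P. \<forall>v. poly P v = eval2 p (u::complex) v"
proof (induction p)
  case 0
  show ?case by (rule exI[of _ 0]) simp
next
  case (pCons c p)
  then obtain P where P: "\<And>v. poly P v = eval2 p u v" by blast
  show ?case
    by (rule exI[of _ "map_poly of_rat c + smult u P"]) (auto simp: P eval1_def)
qed

lemma poly_infinite_zeros:
  fixes P :: "'a::idom poly"
  assumes "infinite X" "\<And>x. x \<in> X \<Longrightarrow> poly P x = 0"
  shows "P = 0"
proof (rule ccontr)
  assume "P \<noteq> 0"
  hence "finite {x. poly P x = 0}" by (rule poly_roots_finite)
  moreover have "X \<subseteq> {x. poly P x = 0}" using assms(2) by auto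
  ultimately show False using assms(1) finite_subset by blast
qed

lemma eval1_all_zero_imp_0:
  assumes "\<And>v::complex. eval1 p v = 0"
  shows "p = 0"
proof -
  have "map_poly of_rat p = (0 :: complex poly)"
    by (rule poly_infinite_zeros[of UNIV]) (use assms in \<open>auto simp: eval1_def infinite_UNIV_char_0\<close>)
  thus ?thesis by (simp add: poly_eq_iff coeff_map_poly)
qed

text \<open>For fixed \<tau> the relation holds after scaling by (d^4, d^6) for infinitely many factors of
  automorphy d, hence for all complex scalars. Scaling moves u to any prescribed
  nonzero U, and then v takes infinitely many values as \<tau> moves along the imaginary axis,
  because v^2 / u^3 does. So the polynomial vanishes for all v and all nonzero u.\<close>

theorem eisenstein_algebraically_independent:
  assumes van: "\<And>\<tau>. Im \<tau> > 0 \<Longrightarrow> eval2 p (20 * G_fun 4 \<tau>) (7 / 3 * G_fun 6 \<tau>) = 0"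
  shows "p = 0"
proof -
  let ?c = "2 * complex_of_real pi * \<i>"
  have scaled: "eval2 p (l ^ 4 * (20 * G_fun 4 \<tau>)) (l ^ 6 * (7 / 3 * G_fun 6 \<tau>)) = 0"
    if \<tau>: "Im \<tau> > 0" for l \<tau>
  proof -
    obtain P where P: "\<And>l. poly P l = eval2 p (l ^ 4 * (20 * G_fun 4 \<tau>)) (l ^ 6 * (7 / 3 * G_fun 6 \<tau>))"
      using eval2_scaled_poly by blast
    have "P = 0"
    proof (rule poly_infinite_zeros)
      have "inj (\<lambda>c::nat. of_nat c * \<tau> + 1)" using \<tau> by (auto simp: inj_def)
      thus "infinite (range (\<lambda>c::nat. of_nat c * \<tau> + 1))" using finite_imageD by blast
      fix d assume "d \<in> range (\<lambda>c::nat. of_nat c * \<tau> + 1)"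
      then obtain c :: nat where d: "d = of_nat c * \<tau> + 1" by auto
      have "G_fun k (\<tau> / d) = d ^ k * G_fun k \<tau>" if "k > 2" for k
        using that lattice_e_modular(1)[OF \<tau>, of k c]
        by (simp add: G_fun_def eisenstein_e_eq_lattice_e d)
      from this[of 4] this[of 6] van[OF lattice_e_modular(2)[OF \<tau>, of 1 c]]
      show "poly P d = 0" unfolding P d by (simp add: algebra_simps)
    qed
    thus ?thesis using P[of l] by simp
  qed
  have zero: "eval2 p U V = 0" if U: "U \<noteq> 0" for U V :: complex
  proof -
    obtain P where P: "\<And>v. poly P v = eval2 p U v" using eval2_second_poly by blast
    have "P = 0"
    proof (rule poly_infinite_zeros)
      define Vs where "Vs = {V. eval2 p U V = 0}"
      have *: "\<exists>V\<in>Vs. e6_e4_ratio t = V ^ 2 / U ^ 3 * (60 ^ 3 / 140 ^ 2)" if t: "t \<in> {1..2}" for t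
      proof -
        define \<tau> where "\<tau> = \<i> * of_real t"
        have \<tau>: "Im \<tau> > 0" using t by (simp add: \<tau>_def)
        interpret upper_half_plane \<tau> by unfold_locales (rule \<tau>)
        define a where "a = 20 * G_fun 4 \<tau>"
        define b where "b = 7 / 3 * G_fun 6 \<tau>"
        have a: "a = 60 * lattice_e \<tau> 4 / ?c ^ 4" and b: "b = 140 * lattice_e \<tau> 6 / ?c ^ 6"
          unfolding a_def b_def by (rule G_fun_4 G_fun_6)+
        have e4: "lattice_e \<tau> 4 \<noteq> 0" using lattice_e_4_it_nonzero[of t] t by (simp add: \<tau>_def)
        have a0: "a \<noteq> 0" using e4 by (simp add: a)
        define l where "l = csqrt (csqrt (U / a))"
        have l: "l ^ 4 = U / a" using power_mult[of l 2 2] by (simp add: l_def)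
        have "l ^ 6 * b \<in> Vs"
          using scaled[OF \<tau>, of l] a0 unfolding Vs_def a_def[symmetric] b_def[symmetric] l by simp
        moreover have "e6_e4_ratio t = (l ^ 6 * b) ^ 2 / U ^ 3 * (60 ^ 3 / 140 ^ 2)"
        proof -
          have "(l ^ 6 * b) ^ 2 = (l ^ 4) ^ 3 * b ^ 2"
            by (simp add: power_mult_distrib flip: power_mult)
          also have "\<dots> = U ^ 3 * (b ^ 2 / a ^ 3)" by (simp add: l power_divide)
          finally have "(l ^ 6 * b) ^ 2 / U ^ 3 = b ^ 2 / a ^ 3" using U by simp
          also have "\<dots> = e6_e4_ratio t * (140 ^ 2 / 60 ^ 3)"
            using e4 unfolding a b e6_e4_ratio_def \<tau>_def[symmetric]
            by (simp add: power_divide power_mult_distrib mult.commute flip: power_mult)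
          finally show ?thesis by simp
        qed
        ultimately show ?thesis by blast
      qed
      hence "e6_e4_ratio ` {1..2} \<subseteq> (\<lambda>V. V ^ 2 / U ^ 3 * (60 ^ 3 / 140 ^ 2)) ` Vs" by blast
      hence "infinite Vs" using infinite_e6_e4_ratio finite_subset finite_imageI by metis
      thus "infinite {V. eval2 p U V = 0}" by (simp add: Vs_def)
      show "poly P V = 0" if "V \<in> {V. eval2 p U V = 0}" for V using that by (simp add: P)
    qed
    thus ?thesis using P[of V] by simp
  qed
  have "coeff p i = 0" for i
  proof (rule eval1_all_zero_imp_0)
    fix v :: complex
    have "map_poly (\<lambda>q. eval1 q v) p = 0"
      by (rule poly_infinite_zeros[of "- {0}"])
         (use zero[of _ v] infinite_UNIV_char_0[where 'a=complex] in \<open>auto simp: eval2_def Compl_eq_Diff_UNIV\<close>)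
    hence "coeff (map_poly (\<lambda>q. eval1 q v) p) i = 0" by simp
    thus "eval1 (coeff p i) v = 0" by (simp add: coeff_map_poly)
  qed
  thus ?thesis by (simp add: poly_eq_iff)
qed

text \<open>The equation of the curve generates the ideal of relations between x, y, u, v: modulo this
  equation only A + y B is left, and the analytic points force A = B = 0.\<close>

lemma vanishing_on_universal_curve:
  assumes van: "\<And>\<tau> \<xi>. Im \<tau> > 0 \<Longrightarrow> \<xi> \<notin> range (lat \<tau>) \<Longrightarrow>
      eval4 p (P_fun 2 \<xi> \<tau>) (- 2 * P_fun 3 \<xi> \<tau>) (20 * G_fun 4 \<tau>) (7 / 3 * G_fun 6 \<tau>) = 0"
    and curve: "on_curve (x::'f::field_char_0) y u v"
  shows "eval4 p x y u v = 0"
proof -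
  obtain A B where
    1: "\<And>(x::complex) y u v. on_curve x y u v \<Longrightarrow> eval4 p x y u v = eval3 A x u v + y * eval3 B x u v" and
    2: "\<And>(x::'f) y u v. on_curve x y u v \<Longrightarrow> eval4 p x y u v = eval3 A x u v + y * eval3 B x u v"
    using reduce_xy[of p, where 'a=complex and 'b='f] by blast
  have AB: "map_poly (\<lambda>q. eval2 q (20 * G_fun 4 \<tau>) (7 / 3 * G_fun 6 \<tau>)) A = 0 \<and>
      map_poly (\<lambda>q. eval2 q (20 * G_fun 4 \<tau>) (7 / 3 * G_fun 6 \<tau>)) B = 0" if \<tau>: "Im \<tau> > 0" for \<tau>
  proof -
    interpret upper_half_plane \<tau> by unfold_locales (rule \<tau>)
    have "poly (map_poly (\<lambda>q. eval2 q (20 * G_fun 4 \<tau>) (7 / 3 * G_fun 6 \<tau>)) A) (P_fun 2 \<xi> \<tau>)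
        + (- 2 * P_fun 3 \<xi> \<tau>) * poly (map_poly (\<lambda>q. eval2 q (20 * G_fun 4 \<tau>) (7 / 3 * G_fun 6 \<tau>)) B) (P_fun 2 \<xi> \<tau>) = 0"
      if \<xi>: "\<xi> \<notin> range (lat \<tau>)" for \<xi>
      using van[OF \<tau> \<xi>] 1[unfolded on_curve_def, OF weierstrass_equation_P_fun[OF \<xi>]]
      by (simp add: eval3_def)
    from poly_vanishing_imp_0[OF this] show ?thesis by blast
  qed
  have "coeff A i = 0" "coeff B i = 0" for i
    using AB by (intro eisenstein_algebraically_independent; metis coeff_0 coeff_map_poly eval2_0)+
  hence "A = 0" "B = 0" by (simp_all add: poly_eq_iff)
  thus ?thesis using 2[OF curve] by simp
qed

section \<open>The coefficient of [T,[T,S]] and the conclusion\<close>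

lemma eval4_uminus: "eval4 (- p) x y u v = - eval4 p x y u v"
  by (induction p) auto

lemma eval4_add: "eval4 (p + q) x y u v = eval4 p x y u v + eval4 q x y u v"
  by (induction p q rule: poly_induct2) (auto simp: algebra_simps)

text \<open>The polynomial x satisfies the defining property of the chosen one, so both agree at
  the analytic points and hence on every curve.\<close>

lemma eval4_P_poly_2:
  fixes x y u v :: "'f::field_char_0"
  assumes "on_curve x y u v"
  shows "eval4 (P_poly 2) x y u v = x"
proof -
  define X :: rat_poly4 where "X = [:0, [:[:[:1:]:]:]:]"
  have X: "eval4 X a b c d = a" for a b c d :: "'b::field_char_0"
    by (simp add: X_def)
  let ?spec = "\<lambda>p. \<forall>\<tau> \<xi>. Im \<tau> > 0 \<longrightarrow> (\<forall>n m :: int. \<xi> \<noteq> of_int n * \<tau> + of_int m) \<longrightarrow>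
      eval4 p (P_fun 2 \<xi> \<tau>) (- 2 * P_fun 3 \<xi> \<tau>) (20 * G_fun 4 \<tau>) (7 / 3 * G_fun 6 \<tau>)
        = P_fun 2 \<xi> \<tau>"
  have "?spec X" by (simp add: X)
  hence spec: "?spec (P_poly 2)" unfolding P_poly_def by (rule someI)
  have "eval4 (P_poly 2 + - X) x y u v = 0"
  proof (rule vanishing_on_universal_curve[OF _ assms])
    fix \<tau> \<xi> :: complex assume \<tau>: "Im \<tau> > 0" and \<xi>: "\<xi> \<notin> range (lat \<tau>)"
    have "\<xi> \<noteq> of_int n * \<tau> + of_int m" for n m :: int
      using \<xi> by (metis lat_def fst_conv snd_conv rangeI)
    thus "eval4 (P_poly 2 + - X) (P_fun 2 \<xi> \<tau>) (- 2 * P_fun 3 \<xi> \<tau>) (20 * G_fun 4 \<tau>) (7 / 3 * G_fun 6 \<tau>) = 0"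
      using spec \<tau> unfolding eval4_add eval4_uminus X by simp
  qed
  thus ?thesis unfolding eval4_add eval4_uminus X by simp
qed

lemma q_coeff_2: "q_coeff 2 x y u v = - eval4 (P_poly 2) x y u v / 2"
proof -
  let ?F = "- Abs_fps (\<lambda>k. if k \<ge> 2 then (- 1) ^ k / of_nat k * eval4 (P_poly k) x y u v else 0)"
  have "q_coeff 2 x y u v = (\<Sum>i=0..2. fps_nth (fps_exp 1) i * fps_nth (?F ^ i) 2)"
    by (simp add: q_coeff_def fps_compose_nth)
  also have "{0..2::nat} = {0, 1, 2}" by auto
  also have "(\<Sum>i\<in>{0, 1, 2::nat}. fps_nth (fps_exp 1) i * fps_nth (?F ^ i) 2) = fps_nth ?F 2 + fps_nth (?F ^ 2) 2 / 2"
    by (simp add: fps_exp_def)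
  also have "fps_nth (?F ^ 2) 2 = 0"
    by (simp add: power2_eq_square fps_mult_nth eval_nat_numeral)
  finally show ?thesis by simp
qed

theorem proposition7p2:
  fixes u v :: "'k::field_char_0"
    and \<iota> :: "'k \<Rightarrow> 'f::field_char_0"
    and x y :: 'f
    and D :: "'f \<Rightarrow> 'f"
  assumes "u ^ 3 - 27 * v ^ 2 \<noteq> 0"
    and "generic_point \<iota> u v x y"
    and "derivation_ddx \<iota> x y D"
  shows "\<not> (\<exists>g\<in>exp_completed_free_lie (function_field \<iota> x y).
           nu_alg (\<iota> u) (\<iota> v) x y =
             - nc_map D g * nc_inverse g + g * nu_naive x y * nc_inverse g)"
proof -
  interpret elliptic_function_field u v \<iota> x y D
    by unfold_locales (rule assms)+
  have "on_curve x y (\<iota> u) (\<iota> v)"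
    unfolding on_curve_def by (rule y_squared')
  hence q2: "q_coeff 2 x y (\<iota> u) (\<iota> v) = - x / 2"
    by (simp add: q_coeff_2 eval4_P_poly_2)
  have "nc_coeff g [] = 1" if "g \<in> exp_completed_free_lie (function_field \<iota> x y)" for g
    using that by (auto simp: exp_completed_free_lie_def nc_exp_constant_coeff)
  thus ?thesis
    using no_gauge_transformation[OF q2] exp_coeff_KE by blast
qed

end
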